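(* Let $\mathcal{M}_{0,4}=\mathbb{C}\setminus\{0,1\}$, regarded as a real $2$-dimensional analytic manifold. Let $Z\subset \mathcal{M}_{0,4}\times\mathbb{R}$ be the set of pairs $(\lambda,a)$ such that the Dunkl connection $\nabla^{\mathrm{D}}_{\lambda,a}$ (defined in the context) preserves a non-zero Hermitian form. Then $Z$ is a proper analytic subset of $\mathcal{M}_{0,4}\times\mathbb{R}$: locally $Z$ is the zero set of real analytic functions which are not identically zero. In particular $Z$ is closed and has Lebesgue measure zero.
   Context: Work on $\mathbb{C}^2$ with linear coordinates $z,w$ and standard Hermitian inner product $\langle v,w\rangle=v_1\bar w_1+v_2\bar w_2$. A Hermitian $2\times 2$ matrix $H$ defines the Hermitian form $\langle v,w\rangle_H=\langle Hv,w\rangle$. For $\lambda\in\mathbb{C}\setminus\{0,1\}$ consider the four lines $L_1=\{z=0\}$, $L_2=\{w=0\}$, $L_3=\{w=z\}$, $L_4=\{z=\lambda w\}$ with defining linear forms $\ell_1=z$, $\ell_2=w$, $\ell_3=w-z$, $\ell_4=z-\lambda w$. Let $H(\lambda)$ be the unique positive definite Hermitian matrix with $\det H(\lambda)=1$ such that $\sum_{i=1}^4 P_i$ is a scalar multiple of the identity, where $P_i$ is the orthogonal projection onto the $\langle\cdot,\cdot\rangle_{H(\lambda)}$-orthogonal complement of $L_i$ (such an $H(\lambda)$ exists and is unique). Let $A_i(\lambda)$ denote the matrix of this orthogonal projection onto $L_i^{\perp}$ with respect to $H(\lambda)$. For $a\in\mathbb{R}$, $\nabla^{\mathrm{D}}_{\lambda,a}$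 is the connection on the tangent bundle of $\mathbb{C}^2\setminus\bigcup_i L_i$ which in the frame $\partial_z,\partial_w$ is $$\nabla^{\mathrm{D}}_{\lambda,a}=d-a\sum_{i=1}^4 A_i(\lambda)\frac{d\ell_i}{\ell_i}.$$ It is flat. A connection "preserves a non-zero Hermitian form" if there is a non-zero (possibly degenerate, possibly indefinite) Hermitian form on the tangent bundle of $\mathbb{C}^2\setminus\bigcup_iL_i$ that is parallel for the connection; equivalently, a non-zero Hermitian form on $T_{x_0}\mathbb{C}^2$ (for a base point $x_0$ off the lines) invariant under the holonomy group. *)

theory Defs
  imports "HOL-Analysis.Analysis"
begin

text \<open>Points of C^2 are vectors x :: complex^2 with z = x$1, w = x$2.
  Matrices are complex^2^2 acting on column vectors by *v.\<close>

definition cmat_adj :: "complex^2^2 \<Rightarrow> complex^2^2" where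
  "cmat_adj M = (\<chi> i j. cnj (M $ j $ i))"

definition herm_ip :: "complex^2^2 \<Rightarrow> complex^2 \<Rightarrow> complex^2 \<Rightarrow> complex" where
  "herm_ip H v w = (\<Sum>k\<in>UNIV. (H *v v) $ k * cnj (w $ k))"

definition pos_def_herm :: "complex^2^2 \<Rightarrow> bool" where
  "pos_def_herm H \<longleftrightarrow> cmat_adj H = H \<and> (\<forall>v. v \<noteq> 0 \<longrightarrow> 0 < Re (herm_ip H v v))"

definition ell :: "complex \<Rightarrow> nat \<Rightarrow> complex^2 \<Rightarrow> complex" where
  "ell lam i x = (if i = 1 then x $ 1 else if i = 2 then x $ 2
                  else if i = 3 then x $ 2 - x $ 1 else x $ 1 - lam * x $ 2)"

definition line :: "complex \<Rightarrow> nat \<Rightarrow> (complex^2) set" where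
  "line lam i = {x. ell lam i x = 0}"

definition line_perp :: "complex^2^2 \<Rightarrow> complex \<Rightarrow> nat \<Rightarrow> (complex^2) set" where
  "line_perp H lam i = {v. \<forall>u\<in>line lam i. herm_ip H u v = 0}"

definition is_orth_proj :: "complex^2^2 \<Rightarrow> (complex^2) set \<Rightarrow> complex^2^2 \<Rightarrow> bool" where
  "is_orth_proj H W P \<longleftrightarrow> (\<forall>v. P *v v \<in> W \<and> (\<forall>u\<in>W. herm_ip H (v - P *v v) u = 0))"

definition proj_mat :: "complex^2^2 \<Rightarrow> complex \<Rightarrow> nat \<Rightarrow> complex^2^2" where
  "proj_mat H lam i = (THE P. is_orth_proj H (line_perp H lam i) P)"

definition H_lam :: "complex \<Rightarrow> complex^2^2" where
  "H_lam lam = (THE H. pos_def_herm H \<and> det H = 1 \<and>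
                    (\<exists>c. (\<Sum>i\<in>{1..4::nat}. proj_mat H lam i) = mat c))"

definition A_mat :: "complex \<Rightarrow> nat \<Rightarrow> complex^2^2" where
  "A_mat lam i = proj_mat (H_lam lam) lam i"

definition arr_compl :: "complex \<Rightarrow> (complex^2) set" where
  "arr_compl lam = {x. \<forall>i\<in>{1..4::nat}. ell lam i x \<noteq> 0}"

text \<open>Connection matrix Omega with nabla = d - Omega, evaluated at point x on tangent vector v:
  Omega_x(v) = a * sum_i A_i * dl_i(v)/l_i(x)  (dl_i = l_i since l_i is linear).\<close>
definition dunkl_form :: "complex \<Rightarrow> real \<Rightarrow> complex^2 \<Rightarrow> complex^2 \<Rightarrow> complex^2^2" where
  "dunkl_form lam a x v = (\<Sum>i\<in>{1..4::nat}. mat (of_real a * ell lam i v / ell lam i x) ** A_mat lam i)"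

text \<open>A Hermitian form h_x(s,t) = <G(x) s, t> on the tangent bundle (in the frame d/dz, d/dw)
  is parallel for nabla = d - Omega iff dG(v) = -(G Omega(v) + Omega(v)^* G).\<close>
definition preserves_herm_form :: "complex \<Rightarrow> real \<Rightarrow> bool" where
  "preserves_herm_form lam a \<longleftrightarrow>
     (\<exists>G :: complex^2 \<Rightarrow> complex^2^2.
        (\<forall>x\<in>arr_compl lam. cmat_adj (G x) = G x) \<and>
        (\<exists>x\<in>arr_compl lam. G x \<noteq> 0) \<and>
        (\<forall>x\<in>arr_compl lam. (G has_derivative
            (\<lambda>v. - (G x ** dunkl_form lam a x v + cmat_adj (dunkl_form lam a x v) ** G x))) (at x)))"

definition M04 :: "complex set" where
  "M04 = - {0, 1}"

definition Z_set :: "(complex \<times> real) set" where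
  "Z_set = {(lam, a). lam \<in> M04 \<and> preserves_herm_form lam a}"

definition real_analytic_on3 :: "(complex \<times> real \<Rightarrow> real) \<Rightarrow> (complex \<times> real) set \<Rightarrow> bool" where
  "real_analytic_on3 f V \<longleftrightarrow>
     (\<forall>p\<in>V. \<exists>r>0. \<exists>c :: nat \<times> nat \<times> nat \<Rightarrow> real. \<forall>q. dist q p < r \<longrightarrow>
        ((\<lambda>(i, j, k). c (i, j, k) * (Re (fst q) - Re (fst p)) ^ i * (Im (fst q) - Im (fst p)) ^ j
                        * (snd q - snd p) ^ k) has_sum f q) UNIV)"

end

(* In the coordinate t = z / w a parallel Hermitian form on C^2 minus the lines becomes a
   Hermitian matrix function on C minus {0, 1, lambda}, parallel for a Fuchsian connection with
   residues a A_1, a A_3, a A_4.  Cutting the plane along rays from a base point c through the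
   three poles leaves a star-shaped region; a form is determined by its value at c, and it glues
   across the cuts iff that value lies in the kernel of a real linear map on the 4-dimensional
   space of Hermitian matrices.  The entries of this map are built from transports of linear
   ODEs, which depend holomorphically on (Re lambda, Im lambda, a) once these three variables
   are complexified, so the Gram determinant of the map is a real analytic function that
   vanishes exactly on Z.
   It is not identically zero: if forms existed for all small a, a normalised limit as a -> 0
   would commute with A_1 and A_3, hence be a multiple of the metric H(lambda), and the
   expansion in a would force |lambda| = |1 - lambda|; this fails off the line Re lambda = 1/2.
   For generic lambda the slice of Z is therefore the real zero set of a nonzero entire function
   of a, hence countable, and Fubini gives measure zero. *)

theory Submission
  imports Defs "HOL-Complex_Analysis.Complex_Analysis" "HOL-Real_Asymp.Real_Asymp"
begin

text \<open>\<open>H_lam\<close> and \<open>A_mat\<close> are definite descriptions and must first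
  become explicit. Their entries are controlled by lam, cnj lam, |lam| and |1 - lam|, and for
  complex u, v in place of the coordinates of lam the two moduli turn into square roots of u^2 + v^2
  and (1 - u)^2 + v^2. The poles remain the points 0, 1, u + i v of the plane, so that the same cuts
  serve complex parameters. The charts are unbounded in \<open>a\<close>: each contains the whole
  line over some generic lam, and a single \<open>a\<close> without a form on that line shows that
  the equation is not trivial in the chart. The obstruction for small \<open>a\<close> is of second
  order, because the first-order correction, -a times a logarithmic potential, is single-valued. At
  the next order the loop integrals of this potential appear next to a commutator term for which
  there is no bound. Pairing the loop around 0 with A_3 and the loop around 1 with A_1 cancels that
  term and leaves a multiple of (ln |lam| - ln |1 - lam|) trace (A_3 [A_4, A_1]); the trace is
  nonzero for nonreal lam.\<close>

no_notation fps_nth (infixl \<open>$\<close> 75)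

section \<open>Holomorphic dependence of integrals on a parameter\<close>

text \<open>Morera's criterion: the integral over a triangle is exchanged with the integral over s,
  and the inner one vanishes by Cauchy's theorem. The integral over s is written as a contour
  integral along \<open>linepath 0 1\<close>, so that \<open>contour_integral_swap\<close> plays the
  part of Fubini's theorem.\<close>

lemma holomorphic_integral_param:
  fixes \<phi> :: "real \<Rightarrow> complex \<Rightarrow> complex"
  assumes "open U"
    and cont: "continuous_on ({0..1} \<times> U) (\<lambda>(s, z). \<phi> s z)"
    and hol: "\<And>s. s \<in> {0..1} \<Longrightarrow> \<phi> s holomorphic_on U"
  shows "(\<lambda>z. integral {0..1} (\<lambda>s. \<phi> s z)) holomorphic_on U"
proof -
  let ?F = "\<lambda>z. contour_integral (linepath 0 1) (\<lambda>w. \<phi> (Re w) z)"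
  have F_eq: "?F z = integral {0..1} (\<lambda>s. \<phi> s z)" for z
    by (simp add: contour_integral_integral linepath_def)
  have contc: "continuous_on (path_image (linepath 0 1) \<times> U) (\<lambda>(w, z). \<phi> (Re w) z)"
  proof -
    have "continuous_on (path_image (linepath 0 1) \<times> U) (\<lambda>p. (\<lambda>(s, z). \<phi> s z) (Re (fst p), snd p))"
      by (rule continuous_on_compose2[OF cont])
        (auto simp: closed_segment_def intro!: continuous_intros)
    then show ?thesis by (simp add: case_prod_unfold)
  qed
  have "continuous_on U (\<lambda>z. integral (cbox 0 1) (\<lambda>s. \<phi> s z))"
  proof (rule integral_continuous_on_param)
    have "continuous_on (U \<times> cbox 0 (1::real)) (\<lambda>p. (\<lambda>(s, z). \<phi> s z) (snd p, fst p))"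
      by (rule continuous_on_compose2[OF cont]) (auto intro!: continuous_intros)
    then show "continuous_on (U \<times> cbox 0 (1::real)) (\<lambda>(z, s). \<phi> s z)"
      by (simp add: case_prod_unfold)
  qed
  then have contF: "continuous_on U ?F" unfolding F_eq by simp
  have "?F analytic_on U"
  proof (rule Morera_triangle[OF contF \<open>open U\<close>], rule impI)
    fix a b c assume hull: "convex hull {a, b, c} \<subseteq> U"
    have seg: "closed_segment a b \<subseteq> U" "closed_segment b c \<subseteq> U" "closed_segment c a \<subseteq> U"
      by (rule order_trans[OF closed_segment_subset_convex_hull hull]; simp add: hull_inc)+
    have swap: "contour_integral (linepath x y) ?F
        = contour_integral (linepath 0 1) (\<lambda>w. contour_integral (linepath x y) (\<lambda>z. \<phi> (Re w) z))"
      and intg: "(\<lambda>w. contour_integral (linepath x y) (\<lambda>z. \<phi> (Re w) z)) contour_integrable_on (linepath 0 1)"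
      if "closed_segment x y \<subseteq> U" for x y
    proof -
      have c1: "continuous_on (path_image (linepath 0 1) \<times> path_image (linepath x y)) (\<lambda>(w, z). \<phi> (Re w) z)"
        by (rule continuous_on_subset[OF contc]) (use that in auto)
      have "contour_integral (linepath 0 1) (\<lambda>w. contour_integral (linepath x y) (\<lambda>z. \<phi> (Re w) z))
        = contour_integral (linepath x y) ?F"
        using c1 by (intro contour_integral_swap) (auto simp: vector_derivative_linepath_at)
      then show "contour_integral (linepath x y) ?F
        = contour_integral (linepath 0 1) (\<lambda>w. contour_integral (linepath x y) (\<lambda>z. \<phi> (Re w) z))" by simp
      have "continuous_on (closed_segment 0 1) (\<lambda>w. integral (cbox 0 1) (\<lambda>t. \<phi> (Re w) (linepath x y t) * (y - x)))"
      proof (rule integral_continuous_on_param)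
        have "(\<lambda>p. (fst p, linepath x y (snd p))) ` (closed_segment 0 1 \<times> cbox 0 1)
            \<subseteq> path_image (linepath 0 1) \<times> path_image (linepath x y)"
          by (auto simp: linepath_in_path simp del: of_real_0 of_real_1)
        moreover have "continuous_on (closed_segment 0 1 \<times> cbox 0 1) (\<lambda>p. (fst p, linepath x y (snd p)))"
          by (auto simp: linepath_def intro!: continuous_intros)
        ultimately have "continuous_on (closed_segment 0 1 \<times> cbox 0 1)
            (\<lambda>p. (\<lambda>(w, z). \<phi> (Re w) z) (fst p, linepath x y (snd p)))"
          by (intro continuous_on_compose2[OF c1])
        then show "continuous_on (closed_segment 0 1 \<times> cbox 0 1) (\<lambda>(w, t). \<phi> (Re w) (linepath x y t) * (y - x))"
          by (simp add: case_prod_unfold continuous_on_mult_right)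
      qed
      then show "(\<lambda>w. contour_integral (linepath x y) (\<lambda>z. \<phi> (Re w) z)) contour_integrable_on (linepath 0 1)"
        by (intro contour_integrable_continuous_linepath) (simp add: contour_integral_integral)
    qed
    have z: "contour_integral (linepath a b) (\<phi> (Re w)) + contour_integral (linepath b c) (\<phi> (Re w))
        + contour_integral (linepath c a) (\<phi> (Re w)) = 0" if "w \<in> closed_segment 0 1" for w
    proof -
      have "Re w \<in> {0..1}" using that by (auto simp: closed_segment_def)
      then have h: "\<phi> (Re w) holomorphic_on U" by (rule hol)
      then have c0: "(\<phi> (Re w) has_contour_integral 0) (linepath a b +++ linepath b c +++ linepath c a)"
        by (rule Cauchy_theorem_triangle[OF holomorphic_on_subset[OF _ hull]])
      have "continuous_on U (\<phi> (Re w))" by (rule holomorphic_on_imp_continuous_on[OF h])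
      then have "\<phi> (Re w) contour_integrable_on linepath a b" "\<phi> (Re w) contour_integrable_on linepath b c"
           "\<phi> (Re w) contour_integrable_on linepath c a"
        using seg by (auto intro!: contour_integrable_continuous_linepath continuous_on_subset[of U])
      then show ?thesis using contour_integral_unique[OF c0]
        by (simp add: contour_integral_join contour_integrable_joinI add.assoc)
    qed
    have "contour_integral (linepath a b) ?F + contour_integral (linepath b c) ?F + contour_integral (linepath c a) ?F
      = contour_integral (linepath 0 1) (\<lambda>w. contour_integral (linepath a b) (\<lambda>z. \<phi> (Re w) z)
         + contour_integral (linepath b c) (\<lambda>z. \<phi> (Re w) z) + contour_integral (linepath c a) (\<lambda>z. \<phi> (Re w) z))"
      using intg seg swap by (simp add: contour_integral_add contour_integrable_add)
    also have "\<dots> = contour_integral (linepath 0 1) (\<lambda>w. 0)"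
      by (rule contour_integral_eq) (use z in auto)
    finally show "contour_integral (linepath a b) ?F + contour_integral (linepath b c) ?F + contour_integral (linepath c a) ?F = 0"
      by simp
  qed
  then show ?thesis
    unfolding F_eq by (rule analytic_imp_holomorphic)
qed

section \<open>Linear differential equations with matrix coefficients\<close>

type_synonym cmat = "complex^2^2"

lemma norm_entry_le: 
  fixes A :: cmat shows "norm (A $ i $ j) \<le> norm A"
  using Finite_Cartesian_Product.norm_nth_le[of A i] Finite_Cartesian_Product.norm_nth_le[of "A $ i" j] by linarith

lemma norm_vec2_le:
  fixes v :: "'a::real_normed_vector^2" shows "norm v \<le> norm (v$1) + norm (v$2)"
  unfolding norm_vec_def using L2_set_le_sum[of UNIV "\<lambda>i. norm (v $ i)"] by (simp add: sum_2)

lemma norm_cmat_le: 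
  fixes A :: cmat shows "norm A \<le> norm (A$1$1) + norm (A$1$2) + norm (A$2$1) + norm (A$2$2)"
  using norm_vec2_le[of A] norm_vec2_le[of "A$1"] norm_vec2_le[of "A$2"] by linarith

text \<open>The norm is the Euclidean norm of the entries. Each of the four entries of the product
  is at most 2 * norm A * norm B; this is the origin of the factor 8 in the estimates below.\<close>

lemma norm_cmat_mult_le:
  fixes A B :: cmat shows "norm (A ** B) \<le> norm A * norm B * 8"
proof -
  have e: "norm ((A ** B) $ i $ j) \<le> 2 * (norm A * norm B)" for i j
  proof -
    have "(A ** B) $ i $ j = A$i$1 * B$1$j + A$i$2 * B$2$j"
      by (simp add: matrix_matrix_mult_def sum_2)
    then have "norm ((A ** B) $ i $ j) \<le> norm (A$i$1) * norm (B$1$j) + norm (A$i$2) * norm (B$2$j)"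
      using norm_triangle_ineq[of "A$i$1 * B$1$j" "A$i$2 * B$2$j"] by (simp add: norm_mult)
    also have "\<dots> \<le> norm A * norm B + norm A * norm B"
      by (intro add_mono mult_mono) (simp_all add: norm_entry_le)
    finally show ?thesis by simp
  qed
  show ?thesis
    using norm_cmat_le[of "A ** B"] e[of 1 1] e[of 1 2] e[of 2 1] e[of 2 2] by linarith
qed

lemma cmat_mult_scaleR:
  "(r *\<^sub>R A) ** B = r *\<^sub>R (A ** (B::cmat))" "A ** (r *\<^sub>R B) = r *\<^sub>R (A ** B)"
  by (simp_all add: matrix_matrix_mult_def vec_eq_iff sum_2 scaleR_add_right)

lemma bounded_bilinear_cmat_mult: "bounded_bilinear ((**) :: cmat \<Rightarrow> cmat \<Rightarrow> cmat)"
proof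
  show "\<exists>K. \<forall>(a::cmat) (b::cmat). norm (a ** b) \<le> norm a * norm b * K"
    by (intro exI[of _ 8] allI norm_cmat_mult_le)
qed (auto simp: cmat_mult_scaleR vec_eq_iff matrix_matrix_mult_def sum_2 algebra_simps)

lemmas continuous_on_cmat_mult [continuous_intros] =
  bounded_bilinear.continuous_on[OF bounded_bilinear_cmat_mult]

text \<open>The iterates of N' = N b with N(0) = 1. The integral over [0, s] is rescaled to [0, 1],
  so that the domain of integration is fixed and the lemmas on parameter integrals apply.\<close>

primrec picard :: "(real \<Rightarrow> cmat) \<Rightarrow> nat \<Rightarrow> real \<Rightarrow> cmat" where
  "picard b 0 s = mat 1"
| "picard b (Suc k) s = s *\<^sub>R integral {0..1} (\<lambda>x. picard b k (s * x) ** b (s * x))"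

definition transport :: "(real \<Rightarrow> cmat) \<Rightarrow> real \<Rightarrow> cmat" where
  "transport b s = (\<Sum>k. picard b k s)"

lemma picard_continuous_param:
  fixes b :: "'p::topological_space \<Rightarrow> real \<Rightarrow> cmat"
  assumes "continuous_on (U \<times> {0..1}) (\<lambda>(z, s). b z s)"
  shows "continuous_on (U \<times> {0..1}) (\<lambda>(z, s). picard (b z) k s)"
proof (induction k)
  case (Suc k)
  have "continuous_on (U \<times> {0..1}) (\<lambda>p. integral (cbox 0 1)
           (\<lambda>x. picard (b (fst p)) k (snd p * x) ** b (fst p) (snd p * x)))"
  proof (rule integral_continuous_on_param)
    have *: "(\<lambda>q. (fst (fst q), snd (fst q) * snd q)) ` ((U \<times> {0..1}) \<times> cbox 0 1) \<subseteq> U \<times> {0..1::real}"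
      by (auto simp: mult_le_one)
    have c: "continuous_on ((U \<times> {0..1}) \<times> cbox 0 (1::real)) (\<lambda>q. (fst (fst q), snd (fst q) * snd q))"
      by (auto intro!: continuous_intros)
    show "continuous_on ((U \<times> {0..1}) \<times> cbox 0 1)
       (\<lambda>(p, x). picard (b (fst p)) k (snd p * x) ** b (fst p) (snd p * x))"
      using continuous_on_cmat_mult[OF continuous_on_compose2[OF Suc c *] continuous_on_compose2[OF assms c *]]
      by (simp add: case_prod_unfold)
  qed
  then show ?case by (auto simp: case_prod_unfold intro!: continuous_intros)
qed (auto simp: case_prod_unfold)

lemma picard_continuous:
  assumes "continuous_on {0..1} b" shows "continuous_on {0..1} (picard b k)"
proof -
  have "continuous_on ({0::real} \<times> {0..1}) (\<lambda>(z, s). picard ((\<lambda>_. b) z) k s)"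
    by (rule picard_continuous_param)
       (auto simp: case_prod_unfold intro!: continuous_on_compose2[OF assms] continuous_intros)
  moreover have "continuous_on {0..1} (\<lambda>s::real. (0::real, s))" "(\<lambda>s. (0, s)) ` {0..1} \<subseteq> {0} \<times> {0..1::real}"
    by (auto intro!: continuous_intros)
  ultimately have "continuous_on {0..1} ((\<lambda>(z, s). picard ((\<lambda>_. b) z) k s) \<circ> (\<lambda>s. (0::real, s)))"
    using continuous_on_compose continuous_on_subset by blast
  then show ?thesis by (simp add: comp_def)
qed

lemma integral_pow01: "integral {0..1} (\<lambda>x::real. x ^ k) = 1 / (Suc k)"
proof -
  have "((\<lambda>x. x ^ Suc k / Suc k) has_vector_derivative x ^ k) (at x within {0..1})" for x :: real
    unfolding has_real_derivative_iff_has_vector_derivative[symmetric]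
    by (rule derivative_eq_intros refl | simp)+
  then have "((\<lambda>x::real. x ^ k) has_integral 1 ^ Suc k / Suc k - 0 ^ Suc k / Suc k) {0..1}"
    by (intro fundamental_theorem_of_calculus) auto
  then show ?thesis by (simp add: integral_unique)
qed

text \<open>Each iteration contributes 8 \<beta> from the product estimate, and integrating x^k
  contributes 1 / (k + 1); together these make the factorial.\<close>

lemma picard_norm_le:
  assumes b: "\<And>s. s \<in> {0..1} \<Longrightarrow> norm (b s) \<le> \<beta>" and cont: "continuous_on {0..1} b" and s: "s \<in> {0..1}"
  shows "norm (picard b k s) \<le> norm (mat 1 :: cmat) * (8 * \<beta> * s) ^ k / fact k"
  using s
proof (induction k arbitrary: s)
  case (Suc k)
  let ?n = "norm (mat 1 :: cmat)"
  have \<beta>: "0 \<le> \<beta>" using order_trans[OF norm_ge_zero b[of 0]] by simp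
  have sx: "s * x \<in> {0..1}" if "x \<in> {0..1}" for x
    using that Suc.prems by (auto simp: mult_le_one)
  have c: "continuous_on {0..1} (\<lambda>x. picard b k (s * x) ** b (s * x))"
  proof -
    have "continuous_on {0..1} (picard b k)"
      by (rule picard_continuous[OF cont])
    note p = this
    have m: "continuous_on {0..1} (\<lambda>x. s * x)" "(\<lambda>x. s * x) ` {0..1} \<subseteq> {0..1}"
      using sx by (auto intro!: continuous_on_mult_left continuous_on_id)
    show ?thesis
      by (rule continuous_on_cmat_mult[OF continuous_on_compose2[OF p m] continuous_on_compose2[OF cont m]])
  qed
  have "norm (integral {0..1} (\<lambda>x. picard b k (s * x) ** b (s * x)))
     \<le> integral {0..1} (\<lambda>x. ?n * (8 * \<beta>) ^ Suc k * s ^ k / fact k * x ^ k)"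
  proof (rule integral_norm_bound_integral)
    show "norm (picard b k (s * x) ** b (s * x)) \<le> ?n * (8 * \<beta>) ^ Suc k * s ^ k / fact k * x ^ k"
      if x: "x \<in> {0..1}" for x
    proof -
      have "norm (picard b k (s * x) ** b (s * x)) \<le> norm (picard b k (s * x)) * norm (b (s * x)) * 8"
        by (rule norm_cmat_mult_le)
      also have "\<dots> \<le> ?n * (8 * \<beta> * (s * x)) ^ k / fact k * \<beta> * 8"
        using Suc.IH[OF sx[OF x]] b[OF sx[OF x]] \<beta> x Suc.prems
        by (intro mult_mono) (auto intro!: divide_nonneg_nonneg mult_nonneg_nonneg)
      also have "\<dots> = ?n * (8 * \<beta>) ^ Suc k * s ^ k / fact k * x ^ k"
        by (simp add: power_mult_distrib)
      finally show ?thesis .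
    qed
  qed (rule integrable_continuous_interval, rule c, rule integrable_continuous_interval, intro continuous_intros)
  also have "\<dots> = ?n * (8 * \<beta>) ^ Suc k * s ^ k / fact (Suc k)"
  proof -
    have "fact (Suc k) = (1 + real k) * fact k" by simp
    then show ?thesis by (simp only: integral_mult_right integral_pow01) simp
  qed
  finally have "s * norm (integral {0..1} (\<lambda>x. picard b k (s * x) ** b (s * x)))
      \<le> s * (?n * (8 * \<beta>) ^ Suc k * s ^ k / fact (Suc k))"
    using Suc.prems by (intro mult_left_mono) auto
  then show ?case using Suc.prems by (simp add: power_mult_distrib mult_ac)
qed simp

lemma picard_Suc_integral:
  assumes cont: "continuous_on {0..1} b" and s: "s \<in> {0..1}"
  shows "picard b (Suc k) s = integral {0..s} (\<lambda>r. picard b k r ** b r)"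
proof (cases "s = 0")
  case False
  then have s0: "0 < s" using s by simp
  let ?f = "\<lambda>r. picard b k r ** b r"
  have "continuous_on {0..s} ?f"
    by (rule continuous_on_subset[OF continuous_on_cmat_mult[OF picard_continuous[OF cont] cont]]) (use s in auto)
  then have "(?f has_integral integral {0..s} ?f) {0..s}"
    by (simp add: integrable_continuous_interval integrable_integral)
  from has_integral_affinity'[OF this[unfolded interval_cbox], of s 0] s0
  have "((\<lambda>x. ?f (s * x)) has_integral inverse s *\<^sub>R integral {0..s} ?f) {0..1}"
    by (simp add: divide_inverse)
  then show ?thesis using s0 by (simp add: integral_unique)
qed simp

text \<open>The M-test is carried out in the parameter and in the time simultaneously, so that it
  yields both the differential equation and the dependence on parameters.\<close>

lemma transport_uniform_limit:
  fixes b :: "'p::topological_space \<Rightarrow> real \<Rightarrow> cmat"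
  assumes cont: "continuous_on (U \<times> {0..1}) (\<lambda>(z, s). b z s)"
    and bnd: "\<And>z s. z \<in> U \<Longrightarrow> s \<in> {0..1} \<Longrightarrow> norm (b z s) \<le> \<beta>"
  shows "uniform_limit (U \<times> {0..1}) (\<lambda>n (z, s). \<Sum>k<n. picard (b z) k s) (\<lambda>(z, s). transport (b z) s) sequentially"
proof -
  have c1: "continuous_on {0..1} (b z)" if "z \<in> U" for z
  proof -
    have m: "continuous_on {0..1} (\<lambda>s::real. (z, s))" "(\<lambda>s. (z, s)) ` {0..1} \<subseteq> U \<times> {0..1}"
      using that by (auto intro!: continuous_intros)
    show ?thesis using continuous_on_compose2[OF cont m] by simp
  qed
  have "uniform_limit (U \<times> {0..1}) (\<lambda>n p. \<Sum>k<n. picard (b (fst p)) k (snd p))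
      (\<lambda>p. \<Sum>k. picard (b (fst p)) k (snd p)) sequentially"
  proof (rule Weierstrass_m_test)
    show "summable (\<lambda>k. norm (mat 1 :: cmat) * (inverse (fact k) * (8 * \<bar>\<beta>\<bar>) ^ k))"
      by (intro summable_mult summable_exp)
    fix k and p :: "'p \<times> real" assume p: "p \<in> U \<times> {0..1}"
    then have p': "fst p \<in> U" "snd p \<in> {0..1}" by auto
    have "norm (picard (b (fst p)) k (snd p)) \<le> norm (mat 1 :: cmat) * (8 * \<beta> * snd p) ^ k / fact k"
      by (rule picard_norm_le[OF bnd[OF p'(1)] c1[OF p'(1)] p'(2)])
    also have "\<dots> \<le> norm (mat 1 :: cmat) * (8 * \<bar>\<beta>\<bar>) ^ k / fact k"
    proof -
      have "(8 * \<beta> * snd p) ^ k \<le> \<bar>8 * \<beta> * snd p\<bar> ^ k" by (metis abs_ge_self power_abs)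
      also have "\<dots> \<le> (8 * \<bar>\<beta>\<bar>) ^ k"
        using p'(2) by (intro power_mono) (auto simp: abs_mult mult_left_le)
      finally show ?thesis by (intro divide_right_mono mult_left_mono) auto
    qed
    finally show "norm (picard (b (fst p)) k (snd p)) \<le> norm (mat 1 :: cmat) * (inverse (fact k) * (8 * \<bar>\<beta>\<bar>) ^ k)"
      by (simp add: field_simps)
  qed
  then show ?thesis by (simp add: case_prod_unfold transport_def)
qed

lemma transport_0 [simp]: "transport b 0 = mat 1"
proof -
  have "picard b k 0 = (if k = 0 then mat 1 else 0)" for k by (cases k) auto
  then show ?thesis unfolding transport_def using suminf_finite[of "{0}" "\<lambda>k. picard b k 0"] by simp
qed

lemma continuous_bounded_on_compact:
  fixes f :: "'a::topological_space \<Rightarrow> 'b::real_normed_vector"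
  assumes "compact S" "continuous_on S f" obtains \<beta> where "\<And>x. x \<in> S \<Longrightarrow> norm (f x) \<le> \<beta>"
  using compact_imp_bounded[OF compact_continuous_image[OF assms(2,1)]] unfolding bounded_iff by auto

text \<open>The partial sums satisfy S (n + 1) = 1 + integral of S n ** b. Uniform convergence
  carries this integral equation over to the limit, where it can be differentiated.\<close>

lemma transport_ode:
  assumes cont: "continuous_on {0..1} b" and s: "s \<in> {0..1}"
  shows "(transport b has_vector_derivative transport b s ** b s) (at s within {0..1})"
proof -
  obtain \<beta> where \<beta>: "\<And>x. x \<in> {0..1} \<Longrightarrow> norm (b x) \<le> \<beta>"
    using continuous_bounded_on_compact[OF compact_Icc cont] by auto
  \<comment> \<open>A constant family over a dummy real parameter, to which the parametric M-test
    applies.\<close>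
  have ca: "continuous_on (UNIV \<times> {0..1}) (\<lambda>(z::real, s). b s)"
  proof -
    have m: "continuous_on (UNIV \<times> {0..1}) (\<lambda>p::real\<times>real. snd p)" "(\<lambda>p. snd p) ` (UNIV \<times> {0..1}) \<subseteq> {0..1::real}"
      by (auto intro!: continuous_intros)
    show ?thesis using continuous_on_compose2[OF cont m] by (simp add: case_prod_unfold)
  qed
  have ul0: "uniform_limit (UNIV \<times> {0..1}) (\<lambda>n (z::real, s). \<Sum>k<n. picard b k s) (\<lambda>(z, s). transport b s) sequentially"
    by (rule transport_uniform_limit[OF ca]) (use \<beta> in auto)
  define S where "S n s = (\<Sum>k<n. picard b k s)" for n s
  have ul: "uniform_limit {0..1} S (transport b) sequentially"
    unfolding uniform_limit_iff
  proof (intro allI impI)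
    fix e :: real assume "e > 0"
    from uniform_limitD[OF ul0 this]
    show "\<forall>\<^sub>F n in sequentially. \<forall>x\<in>{0..1}. dist (S n x) (transport b x) < e"
      by (rule eventually_mono) (auto simp: S_def)
  qed
  have cS: "continuous_on {0..1} (S n)" for n
    unfolding S_def by (intro continuous_on_sum picard_continuous cont)
  have cT: "continuous_on {0..1} (transport b)"
    by (rule uniform_limit_theorem[OF _ ul]) (auto intro!: always_eventually cS)
  have cTb: "continuous_on {0..1} (\<lambda>r. transport b r ** b r)"
    by (rule continuous_on_cmat_mult[OF cT cont])
  have ulb: "uniform_limit {0..1} (\<lambda>n r. S n r ** b r) (\<lambda>r. transport b r ** b r) sequentially"
    unfolding uniform_limit_iff
  proof (intro allI impI)
    fix e :: real assume e: "e > 0"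
    have d: "0 < e / (8 * \<bar>\<beta>\<bar> + 1)" using e by (simp add: add_nonneg_pos)
    show "\<forall>\<^sub>F n in sequentially. \<forall>x\<in>{0..1}. dist (S n x ** b x) (transport b x ** b x) < e"
      using uniform_limitD[OF ul d]
    proof eventually_elim
      case (elim n)
      show ?case
      proof
        fix x :: real assume x: "x \<in> {0..1}"
        have "dist (S n x ** b x) (transport b x ** b x) = norm ((S n x - transport b x) ** b x)"
          by (simp add: dist_norm bounded_bilinear.diff_left[OF bounded_bilinear_cmat_mult])
        also have "\<dots> \<le> norm (S n x - transport b x) * norm (b x) * 8" by (rule norm_cmat_mult_le)
        also have "\<dots> \<le> norm (S n x - transport b x) * \<bar>\<beta>\<bar> * 8"
          using \<beta>[OF x] by (intro mult_right_mono mult_left_mono) auto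
        also have "\<dots> \<le> norm (S n x - transport b x) * (8 * \<bar>\<beta>\<bar> + 1)"
          by (simp add: algebra_simps)
        also have "\<dots> < e"
          using bspec[OF elim x] by (simp add: dist_norm pos_less_divide_eq add_nonneg_pos)
        finally show "dist (S n x ** b x) (transport b x ** b x) < e" .
      qed
    qed
  qed
  have inteq: "transport b s = mat 1 + integral {0..s} (\<lambda>r. transport b r ** b r)" if s: "s \<in> {0..1}" for s
  proof -
    have sub: "{0..s} \<subseteq> {0..1}" using s by auto
    have rec: "S (Suc n) s = mat 1 + integral {0..s} (\<lambda>r. S n r ** b r)" for n
    proof -
      have "S (Suc n) s = mat 1 + (\<Sum>k<n. picard b (Suc k) s)"
        unfolding S_def by (subst sum.lessThan_Suc_shift) simp
      also have "(\<Sum>k<n. picard b (Suc k) s) = (\<Sum>k<n. integral {0..s} (\<lambda>r. picard b k r ** b r))"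
        using picard_Suc_integral[OF cont s] by simp
      also have "\<dots> = integral {0..s} (\<lambda>r. \<Sum>k<n. picard b k r ** b r)"
        by (rule integral_sum[symmetric])
          (auto intro!: integrable_continuous_interval continuous_on_subset[OF continuous_on_cmat_mult[OF picard_continuous[OF cont] cont] sub])
      also have "\<dots> = integral {0..s} (\<lambda>r. S n r ** b r)"
        unfolding S_def by (simp add: bounded_bilinear.sum_left[OF bounded_bilinear_cmat_mult])
      finally show ?thesis .
    qed
    have "(\<lambda>n. S (Suc n) s) \<longlonglongrightarrow> transport b s"
      using tendsto_uniform_limitI[OF ul s] by (rule LIMSEQ_Suc)
    moreover have "(\<lambda>n. integral {0..s} (\<lambda>r. S n r ** b r)) \<longlonglongrightarrow> integral {0..s} (\<lambda>r. transport b r ** b r)"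
    proof -
      have u: "uniform_limit {0..s} (\<lambda>n r. S n r ** b r) (\<lambda>r. transport b r ** b r) sequentially"
        by (rule uniform_limit_on_subset[OF ulb sub])
      have c: "continuous_on {0..s} (\<lambda>r. S n r ** b r)" for n
        by (rule continuous_on_subset[OF continuous_on_cmat_mult[OF cS cont] sub])
      obtain I J where IJ: "\<And>n. ((\<lambda>r. S n r ** b r) has_integral I n) {0..s}"
          "((\<lambda>r. transport b r ** b r) has_integral J) {0..s}" "I \<longlonglongrightarrow> J"
        by (rule uniform_limit_integral[OF u c sequentially_bot]) auto
      then show ?thesis by (simp add: integral_unique[OF IJ(1)] integral_unique[OF IJ(2)])
    qed
    then have "(\<lambda>n. S (Suc n) s) \<longlonglongrightarrow> mat 1 + integral {0..s} (\<lambda>r. transport b r ** b r)"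
      unfolding rec by (intro tendsto_intros)
    ultimately show ?thesis by (rule LIMSEQ_unique)
  qed
  have "((\<lambda>s. mat 1 + integral {0..s} (\<lambda>r. transport b r ** b r)) has_vector_derivative transport b s ** b s) (at s within {0..1})"
    using integral_has_vector_derivative[OF cTb s] by (auto intro!: derivative_eq_intros)
  then show ?thesis
    by (rule has_vector_derivative_transform[OF s, rotated]) (simp add: inteq)
qed

lemma integral_entry:
  fixes f :: "real \<Rightarrow> cmat"
  assumes "f integrable_on S"
  shows "integral S f $ i $ j = integral S (\<lambda>x. f x $ i $ j)"
proof -
  have "bounded_linear (\<lambda>A::cmat. A $ i $ j)"
    by (intro bounded_linear_compose[OF bounded_linear_vec_nth bounded_linear_vec_nth])
  from integral_linear[OF assms this] show ?thesis by (simp add: comp_def)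
qed

text \<open>By induction each iterate is an integral of functions holomorphic in the parameter, so
  \<open>holomorphic_integral_param\<close> applies entry by entry.\<close>

lemma picard_holomorphic:
  fixes b :: "complex \<Rightarrow> real \<Rightarrow> cmat"
  assumes U: "open U"
    and cont: "continuous_on (U \<times> {0..1}) (\<lambda>(z, s). b z s)"
    and hol: "\<And>s i j. s \<in> {0..1} \<Longrightarrow> (\<lambda>z. b z s $ i $ j) holomorphic_on U"
    and s: "s \<in> {0..1}"
  shows "(\<lambda>z. picard (b z) k s $ i $ j) holomorphic_on U"
  using s
proof (induction k arbitrary: s i j)
  case (Suc k)
  let ?f = "\<lambda>x z. picard (b z) k (s * x) ** b z (s * x)"
  have sx: "s * x \<in> {0..1}" if "x \<in> {0..1}" for x
    using that Suc.prems by (auto simp: mult_le_one)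
  have c: "continuous_on (U \<times> {0..1}) (\<lambda>(z, x). ?f x z)"
  proof -
    have m: "continuous_on (U \<times> {0..1}) (\<lambda>p. (fst p, s * snd p))" 
        "(\<lambda>p. (fst p, s * snd p)) ` (U \<times> {0..1}) \<subseteq> U \<times> {0..1}"
      using sx by (auto intro!: continuous_intros)
    show ?thesis
      using continuous_on_cmat_mult[OF continuous_on_compose2[OF picard_continuous_param[OF cont] m]
           continuous_on_compose2[OF cont m]] by (simp add: case_prod_unfold)
  qed
  have int: "(\<lambda>x. ?f x z) integrable_on {0..1}" if "z \<in> U" for z
  proof -
    have m: "continuous_on {0..1} (\<lambda>x::real. (z, x))" "(\<lambda>x. (z, x)) ` {0..1} \<subseteq> U \<times> {0..1}"
      using that by (auto intro!: continuous_intros)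
    show ?thesis using continuous_on_compose2[OF c m] by (simp add: integrable_continuous_interval)
  qed
  have "(\<lambda>z. integral {0..1} (\<lambda>x. ?f x z $ i $ j)) holomorphic_on U"
  proof (rule holomorphic_integral_param[OF U])
    have m: "continuous_on ({0..1::real} \<times> U) (\<lambda>p. (snd p, fst p))" 
        "(\<lambda>p. (snd p, fst p)) ` ({0..1} \<times> U) \<subseteq> U \<times> {0..1}"
      by (auto intro!: continuous_intros)
    show "continuous_on ({0..1} \<times> U) (\<lambda>(x, z). ?f x z $ i $ j)"
      using continuous_on_compose2[OF c m] by (auto simp: case_prod_unfold intro!: continuous_intros)
  next
    fix x :: real assume x: "x \<in> {0..1}"
    have "(\<lambda>z. picard (b z) k (s * x) $ i $ 1 * b z (s * x) $ 1 $ j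
        + picard (b z) k (s * x) $ i $ 2 * b z (s * x) $ 2 $ j) holomorphic_on U"
      by (intro holomorphic_intros Suc.IH hol sx[OF x])
    then show "(\<lambda>z. ?f x z $ i $ j) holomorphic_on U"
      by (simp add: matrix_matrix_mult_def sum_2)
  qed
  then have "(\<lambda>z. of_real s * integral {0..1} (\<lambda>x. ?f x z $ i $ j)) holomorphic_on U"
    by (intro holomorphic_intros)
  then show ?case
  proof (rule holomorphic_transform)
    fix z assume "z \<in> U"
    show "of_real s * integral {0..1} (\<lambda>x. ?f x z $ i $ j) = picard (b z) (Suc k) s $ i $ j"
      unfolding picard.simps vector_scaleR_component integral_entry[OF int[OF \<open>z \<in> U\<close>]]
      by (rule scaleR_conv_of_real[symmetric])
  qed
qed simp

text \<open>The bound on \<open>b\<close> that the M-test asks for exists over compact sets of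
  parameters.\<close>

lemma transport_uniform_limit_compact:
  fixes b :: "'p::topological_space \<Rightarrow> real \<Rightarrow> cmat"
  assumes cont: "continuous_on (U \<times> {0..1}) (\<lambda>(z, s). b z s)" and K: "compact K" "K \<subseteq> U" and s: "s \<in> {0..1}"
  shows "uniform_limit K (\<lambda>n z. \<Sum>k<n. picard (b z) k s) (\<lambda>z. transport (b z) s) sequentially"
proof -
  have c: "continuous_on (K \<times> {0..1}) (\<lambda>(z, s). b z s)"
    by (rule continuous_on_subset[OF cont]) (use K in auto)
  have "compact (K \<times> {0..1::real})" using K by (intro compact_Times) auto
  from continuous_bounded_on_compact[OF this c] obtain \<beta> where
    "\<And>p. p \<in> K \<times> {0..1} \<Longrightarrow> norm (case p of (z, s) \<Rightarrow> b z s) \<le> \<beta>" by auto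
  then have \<beta>: "norm (b z s) \<le> \<beta>" if "z \<in> K" "s \<in> {0..1}" for z s
    using that by fastforce
  have u: "uniform_limit (K \<times> {0..1}) (\<lambda>n (z, s). \<Sum>k<n. picard (b z) k s) (\<lambda>(z, s). transport (b z) s) sequentially"
    by (rule transport_uniform_limit[OF c]) (rule \<beta>)
  show ?thesis
    unfolding uniform_limit_iff
  proof (intro allI impI)
    fix e :: real assume "e > 0"
    from uniform_limitD[OF u this]
    show "\<forall>\<^sub>F n in sequentially. \<forall>z\<in>K. dist (\<Sum>k<n. picard (b z) k s) (transport (b z) s) < e"
      by (rule eventually_mono) (use s in auto)
  qed
qed

lemma transport_continuous_param:
  fixes b :: "'p::heine_borel \<Rightarrow> real \<Rightarrow> cmat"
  assumes U: "open U" and cont: "continuous_on (U \<times> {0..1}) (\<lambda>(z, s). b z s)" and s: "s \<in> {0..1}"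
  shows "continuous_on U (\<lambda>z. transport (b z) s)"
proof -
  have "isCont (\<lambda>z. transport (b z) s) z" if z: "z \<in> U" for z
  proof -
    obtain d where d: "d > 0" "cball z d \<subseteq> U" using U z open_contains_cball by blast
    have cp: "continuous_on U (\<lambda>z. picard (b z) k s)" for k
    proof -
      have m: "continuous_on U (\<lambda>z. (z, s))" "(\<lambda>z. (z, s)) ` U \<subseteq> U \<times> {0..1}"
        using s by (auto intro!: continuous_intros)
      show ?thesis using continuous_on_compose2[OF picard_continuous_param[OF cont] m] by simp
    qed
    have "continuous_on (cball z d) (\<lambda>z. transport (b z) s)"
    proof (rule uniform_limit_theorem[OF _ transport_uniform_limit_compact[OF cont compact_cball d(2) s]])
      show "\<forall>\<^sub>F n in sequentially. continuous_on (cball z d) (\<lambda>z. \<Sum>k<n. picard (b z) k s)"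
        by (intro always_eventually allI continuous_on_sum continuous_on_subset[OF cp d(2)])
    qed simp
    then have "continuous_on (ball z d) (\<lambda>z. transport (b z) s)"
      by (rule continuous_on_subset) auto
    then show ?thesis using d by (auto simp: continuous_on_eq_continuous_at)
  qed
  then show ?thesis by (simp add: continuous_at_imp_continuous_on)
qed

text \<open>Locally uniform limit of the holomorphic partial sums.\<close>

lemma transport_holomorphic:
  fixes b :: "complex \<Rightarrow> real \<Rightarrow> cmat"
  assumes U: "open U"
    and cont: "continuous_on (U \<times> {0..1}) (\<lambda>(z, s). b z s)"
    and hol: "\<And>s i j. s \<in> {0..1} \<Longrightarrow> (\<lambda>z. b z s $ i $ j) holomorphic_on U"
    and s: "s \<in> {0..1}"
  shows "(\<lambda>z. transport (b z) s $ i $ j) holomorphic_on U"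
proof (rule holomorphic_uniform_sequence[OF U])
  show "(\<lambda>z. (\<Sum>k<n. picard (b z) k s) $ i $ j) holomorphic_on U" for n
    by (simp add: sum_component) (intro holomorphic_intros picard_holomorphic[OF U cont hol s])
  fix z assume z: "z \<in> U"
  then obtain d where d: "d > 0" "cball z d \<subseteq> U" using U open_contains_cball by blast
  have u: "uniform_limit (cball z d) (\<lambda>n z. \<Sum>k<n. picard (b z) k s) (\<lambda>z. transport (b z) s) sequentially"
    by (rule transport_uniform_limit_compact[OF cont compact_cball d(2) s])
  have "uniform_limit (cball z d) (\<lambda>n z. (\<Sum>k<n. picard (b z) k s) $ i $ j) (\<lambda>z. transport (b z) s $ i $ j) sequentially"
    unfolding uniform_limit_iff
  proof (intro allI impI)
    fix e :: real assume "e > 0"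
    from uniform_limitD[OF u this]
    show "\<forall>\<^sub>F n in sequentially. \<forall>z\<in>cball z d. dist ((\<Sum>k<n. picard (b z) k s) $ i $ j) (transport (b z) s $ i $ j) < e"
    proof (rule eventually_mono)
      fix n assume a: "\<forall>x\<in>cball z d. dist (\<Sum>k<n. picard (b x) k s) (transport (b x) s) < e"
      have "dist (A $ i $ j) (B $ i $ j) \<le> dist A B" for A B :: cmat
        using norm_entry_le[of "A - B" i j] by (simp add: dist_norm)
      then show "\<forall>z\<in>cball z d. dist ((\<Sum>k<n. picard (b z) k s) $ i $ j) (transport (b z) s $ i $ j) < e"
        using a order.strict_trans1 by fast
    qed
  qed
  then show "\<exists>d>0. cball z d \<subseteq> U \<and> uniform_limit (cball z d) (\<lambda>n z. (\<Sum>k<n. picard (b z) k s) $ i $ j)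
       (\<lambda>z. transport (b z) s $ i $ j) sequentially"
    using d by blast
qed

section \<open>The balanced metric\<close>

lemma herm_ip_coord:
  "herm_ip H v w = (H$1$1 * v$1 + H$1$2 * v$2) * cnj (w$1) + (H$2$1 * v$1 + H$2$2 * v$2) * cnj (w$2)"
  by (simp add: herm_ip_def sum_2 matrix_vector_mult_def)

lemma herm_ip_diff_left: "herm_ip H (v - v') w = herm_ip H v w - herm_ip H v' w"
  by (simp add: herm_ip_coord algebra_simps)

lemma herm_ip_diff_right: "herm_ip H v (w - w') = herm_ip H v w - herm_ip H v w'"
  by (simp add: herm_ip_coord algebra_simps)

lemma herm_ip_scale_left: "herm_ip H (c *s v) w = c * herm_ip H v w"
  by (simp add: herm_ip_coord algebra_simps)

lemma herm_ip_scale_right: "herm_ip H v (c *s w) = cnj c * herm_ip H v w"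
  by (simp add: herm_ip_coord algebra_simps)

lemma cmat_adj_entry [simp]: "cmat_adj M $ i $ j = cnj (M $ j $ i)"
  by (simp add: cmat_adj_def)

lemma herm_ip_sym:
  assumes "cmat_adj H = H" shows "herm_ip H w v = cnj (herm_ip H v w)"
proof -
  have "cnj (H$j$i) = H$i$j" for i j using assms cmat_adj_entry[of H i j] by simp
  then show ?thesis by (simp add: herm_ip_coord algebra_simps)
qed

lemma pos_def_herm_ip:
  assumes "pos_def_herm H" "v \<noteq> 0"
  obtains h where "herm_ip H v v = complex_of_real h" "0 < h"
proof
  show "0 < Re (herm_ip H v v)" using assms by (auto simp: pos_def_herm_def)
  have "herm_ip H v v = cnj (herm_ip H v v)"
    by (rule herm_ip_sym) (use assms in \<open>simp add: pos_def_herm_def\<close>)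
  then have "Im (herm_ip H v v) = Im (cnj (herm_ip H v v))" by (rule arg_cong)
  then show "herm_ip H v v = complex_of_real (Re (herm_ip H v v))"
    by (simp add: complex_eq_iff)
qed

text \<open>For a positive definite \<open>H\<close> and nonzero \<open>u\<close>, the matrix of the
  \<open>H\<close>-orthogonal projection whose kernel is spanned by \<open>u\<close>.\<close>

definition compl_proj :: "cmat \<Rightarrow> complex^2 \<Rightarrow> cmat" where
  "compl_proj H u = (\<chi> j k. (if j = k then 1 else 0)
     - u$j * (cnj (u$1) * H$1$k + cnj (u$2) * H$2$k) / herm_ip H u u)"

lemma compl_proj_mult: "compl_proj H u *v v = v - (herm_ip H v u / herm_ip H u u) *s u"
  by (auto simp: vec_eq_iff forall_2 compl_proj_def matrix_vector_mult_def sum_2 herm_ip_coord add_divide_distrib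
      algebra_simps)

lemma is_orth_proj_unique:
  assumes H: "pos_def_herm H" and P: "is_orth_proj H W P" "is_orth_proj H W P'"
    and W: "\<And>v w. v \<in> W \<Longrightarrow> w \<in> W \<Longrightarrow> v - w \<in> W"
  shows "P = P'"
proof -
  have "P *v v = P' *v v" for v
  proof (rule ccontr)
    assume ne: "P *v v \<noteq> P' *v v"
    let ?d = "P *v v - P' *v v"
    have d: "?d \<in> W" using P W by (auto simp: is_orth_proj_def)
    have "herm_ip H (v - P *v v) ?d = 0" "herm_ip H (v - P' *v v) ?d = 0"
      using P d by (auto simp: is_orth_proj_def)
    then have "herm_ip H ?d ?d = 0" by (simp add: herm_ip_diff_left)
    moreover have "?d \<noteq> 0" using ne by simp
    ultimately show False using H by (metis less_irrefl pos_def_herm_def zero_complex.sel(1))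
  qed
  then show ?thesis by (simp add: matrix_eq)
qed

lemma proj_mat_eq:
  assumes H: "pos_def_herm H" and u: "u \<noteq> 0" "line lam i = range (\<lambda>c. c *s u)"
  shows "proj_mat H lam i = compl_proj H u"
  unfolding proj_mat_def
proof (rule the_equality)
  obtain h where h: "herm_ip H u u = complex_of_real h" "0 < h" using pos_def_herm_ip[OF H u(1)] .
  have adj: "cmat_adj H = H" using H by (simp add: pos_def_herm_def)
  have W: "line_perp H lam i = {v. herm_ip H u v = 0}"
    by (auto simp: line_perp_def u(2) herm_ip_scale_left)
  show o: "is_orth_proj H (line_perp H lam i) (compl_proj H u)"
    unfolding is_orth_proj_def W compl_proj_mult using h herm_ip_sym[OF adj, of u, symmetric]
    by (auto simp: herm_ip_diff_left herm_ip_diff_right herm_ip_scale_left herm_ip_scale_right)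
  fix P assume "is_orth_proj H (line_perp H lam i) P"
  then show "P = compl_proj H u"
    by (rule is_orth_proj_unique[OF H _ o]) (auto simp: W herm_ip_diff_right)
qed

definition line_vec :: "complex \<Rightarrow> nat \<Rightarrow> complex^2" where
  "line_vec lam i = (if i = 1 then vector [0, 1] else if i = 2 then vector [1, 0]
     else if i = 3 then vector [1, 1] else vector [lam, 1])"

lemma line_vec_nz: "line_vec lam i \<noteq> 0"
  by (auto simp: line_vec_def vec_eq_iff forall_2)

lemma line_eq_range: "line lam i = range (\<lambda>c. c *s line_vec lam i)"
proof -
  have "x \<in> range (\<lambda>c. c *s line_vec lam i)" if "ell lam i x = 0" for x
    using that
    by (intro range_eqI[of _ _ "if i = 2 then x$1 else x$2"])
       (auto simp: line_vec_def ell_def vec_eq_iff forall_2 split: if_splits)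
  then show ?thesis by (auto simp: line_def) (auto simp: ell_def line_vec_def)
qed

lemmas proj_mat_line = proj_mat_eq[OF _ line_vec_nz line_eq_range]

lemma sum_1_4: "(\<Sum>i\<in>{1..4::nat}. f i) = f 1 + f 2 + f 3 + (f 4 :: 'a::comm_monoid_add)"
proof -
  have "{1..4::nat} = {1, 2, 3, 4}" by auto
  then show ?thesis by (simp add: add.assoc)
qed

lemma pos_def_herm_coord:
  assumes "pos_def_herm H" "det H = 1"
  obtains p r q where "0 < p" "0 < r" "H$1$1 = complex_of_real p" "H$2$2 = complex_of_real r" "H$1$2 = q"
    "H$2$1 = cnj q" "complex_of_real (p * r) - q * cnj q = 1"
proof -
  have n: "vector [1, 0] \<noteq> (0::complex^2)" "vector [0, 1] \<noteq> (0::complex^2)"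
    by (auto simp: vec_eq_iff forall_2)
  obtain p where p: "herm_ip H (vector [1, 0]) (vector [1, 0]) = complex_of_real p" "0 < p"
    using pos_def_herm_ip[OF assms(1) n(1)] .
  obtain r where r: "herm_ip H (vector [0, 1]) (vector [0, 1]) = complex_of_real r" "0 < r"
    using pos_def_herm_ip[OF assms(1) n(2)] .
  have "cmat_adj H = H" using assms by (simp add: pos_def_herm_def)
  then have a: "H$2$1 = cnj (H$1$2)" using cmat_adj_entry[of H 2 1] by simp
  show ?thesis
    using p r a assms(2) by (intro that[of p r "H$1$2"]) (auto simp: herm_ip_coord det_2)
qed

lemma compl_proj_entry:
  "compl_proj H u $ j $ k = (if j = k then 1 else 0)
     - u$j * (cnj (u$1) * H$1$k + cnj (u$2) * H$2$k) / herm_ip H u u"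
  by (simp add: compl_proj_def)

text \<open>Multiplying the balance condition of \<open>H\<close> by the adjugate of \<open>H\<close> and pairing with \<open>H'\<close>.\<close>

lemma balanced_trace:
  assumes H: "pos_def_herm H" "det H = 1" and bal: "(\<Sum>i\<in>{1..4::nat}. proj_mat H lam i) = mat c"
  shows "(\<Sum>i\<in>{1..4::nat}. herm_ip H' (line_vec lam i) (line_vec lam i) / herm_ip H (line_vec lam i) (line_vec lam i))
     = 2 * (H$2$2 * H'$1$1 + H$1$1 * H'$2$2 - H$1$2 * H'$2$1 - H$2$1 * H'$1$2)"
proof -
  define u where "u i = line_vec lam i" for i
  define h where "h i = herm_ip H (u i) (u i)" for i
  define X where "X j k = (\<Sum>i\<in>{1..4::nat}. u i $ j * (cnj (u i $1) * H$1$k + cnj (u i $2) * H$2$k) / h i)" for j k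
  have h0: "h i \<noteq> 0" for i
    unfolding h_def u_def using pos_def_herm_ip[OF H(1) line_vec_nz, of lam i]
    by (metis of_real_eq_0_iff order_less_irrefl)
  have ent: "(if j = k then c else 0) = (if j = k then 4 else 0) - X j k" for j k
  proof -
    have "(if j = k then c else 0) = (\<Sum>i\<in>{1..4::nat}. proj_mat H lam i) $ j $ k"
      unfolding bal by (simp add: mat_def)
    also have "\<dots> = (\<Sum>i\<in>{1..4::nat}. (if j = k then 1 else 0)
       - u i $ j * (cnj (u i $1) * H$1$k + cnj (u i $2) * H$2$k) / h i)"
      by (simp add: sum_component proj_mat_line[OF H(1)] compl_proj_entry u_def h_def)
    also have "\<dots> = (if j = k then 4 else 0) - X j k"
      by (simp add: sum_subtractf X_def)
    finally show ?thesis .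
  qed
  \<comment> \<open>Each of the four summands of \<open>X\<close> is a rank-one projection and has
    trace one; comparing traces with the balance condition forces \<open>c = 2\<close>.\<close>
  have "X 1 1 + X 2 2 = (\<Sum>i\<in>{1..4::nat}. 1)"
    unfolding X_def sum.distrib[symmetric]
  proof (intro sum.cong refl)
    fix i
    have "u i $ 1 * (cnj (u i $ 1) * H $ 1 $ 1 + cnj (u i $ 2) * H $ 2 $ 1) +
         u i $ 2 * (cnj (u i $ 1) * H $ 1 $ 2 + cnj (u i $ 2) * H $ 2 $ 2) = h i"
      by (simp add: h_def herm_ip_coord algebra_simps)
    then show "u i $ 1 * (cnj (u i $ 1) * H $ 1 $ 1 + cnj (u i $ 2) * H $ 2 $ 1) / h i +
         u i $ 2 * (cnj (u i $ 1) * H $ 1 $ 2 + cnj (u i $ 2) * H $ 2 $ 2) / h i = 1"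
      using h0[of i] by (simp add: add_divide_distrib[symmetric])
  qed
  then have "c = 2" using ent[of 1 1] ent[of 2 2] by simp
  then have X: "X 1 1 = 2" "X 2 2 = 2" "X 1 2 = 0" "X 2 1 = 0"
    using ent[of 1 1] ent[of 2 2] ent[of 1 2] ent[of 2 1] by auto
  have d: "H$1$1 * H$2$2 - H$1$2 * H$2$1 = 1" using H(2) by (simp add: det_2)
  have t: "herm_ip H' (u i) (u i) / h i
     = (u i $ 1 * (cnj (u i $1) * H$1$1 + cnj (u i $2) * H$2$1) / h i) * (H$2$2 * H'$1$1 - H$1$2 * H'$2$1)
     + (u i $ 1 * (cnj (u i $1) * H$1$2 + cnj (u i $2) * H$2$2) / h i) * (H$1$1 * H'$2$1 - H$2$1 * H'$1$1)
     + (u i $ 2 * (cnj (u i $1) * H$1$1 + cnj (u i $2) * H$2$1) / h i) * (H$2$2 * H'$1$2 - H$1$2 * H'$2$2)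
     + (u i $ 2 * (cnj (u i $1) * H$1$2 + cnj (u i $2) * H$2$2) / h i) * (H$1$1 * H'$2$2 - H$2$1 * H'$1$2)"
    for i
  proof -
    have "herm_ip H' (u i) (u i) = herm_ip H' (u i) (u i) * (H$1$1 * H$2$2 - H$1$2 * H$2$1)" by (simp add: d)
    also have "\<dots> = (u i $ 1 * (cnj (u i $1) * H$1$1 + cnj (u i $2) * H$2$1)) * (H$2$2 * H'$1$1 - H$1$2 * H'$2$1)
     + (u i $ 1 * (cnj (u i $1) * H$1$2 + cnj (u i $2) * H$2$2)) * (H$1$1 * H'$2$1 - H$2$1 * H'$1$1)
     + (u i $ 2 * (cnj (u i $1) * H$1$1 + cnj (u i $2) * H$2$1)) * (H$2$2 * H'$1$2 - H$1$2 * H'$2$2)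
     + (u i $ 2 * (cnj (u i $1) * H$1$2 + cnj (u i $2) * H$2$2)) * (H$1$1 * H'$2$2 - H$2$1 * H'$1$2)"
      by (simp add: herm_ip_coord algebra_simps)
    finally show ?thesis by (simp add: add_divide_distrib)
  qed
  have "(\<Sum>i\<in>{1..4::nat}. herm_ip H' (u i) (u i) / h i)
    = X 1 1 * (H$2$2 * H'$1$1 - H$1$2 * H'$2$1) + X 1 2 * (H$1$1 * H'$2$1 - H$2$1 * H'$1$1)
     + X 2 1 * (H$2$2 * H'$1$2 - H$1$2 * H'$2$2) + X 2 2 * (H$1$1 * H'$2$2 - H$2$1 * H'$1$2)"
    unfolding t X_def sum.distrib sum_distrib_right ..
  then show ?thesis unfolding X u_def h_def by (simp add: algebra_simps)
qed

section \<open>Uniqueness of the balanced metric\<close>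

text \<open>With the conjugates replaced by independent variables this is a polynomial
  identity.\<close>

lemma pencil_identity_aux:
  fixes p q Q r p' q' Q' r' a b A B :: complex
  defines "h \<equiv> (p * a + q * b) * A + (Q * a + r * b) * B"
    and "h' \<equiv> (p' * a + q' * b) * A + (Q' * a + r' * b) * B"
  shows "h\<^sup>2 * (p' * r' - q' * Q') + h'\<^sup>2 * (p * r - q * Q) - (r * p' + p * r' - q * Q' - Q * q') * h * h'
    = - (((p * a + q * b) * (Q' * a + r' * b) - (Q * a + r * b) * (p' * a + q' * b)) *
         ((p * A + Q * B) * (q' * A + r' * B) - (q * A + r * B) * (p' * A + Q' * B)))"
  unfolding h_def h'_def power2_eq_square by (simp add: algebra_simps)

text \<open>The left side is the determinant of h H' - h' H, a Hermitian matrix whose form vanishes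
  at v = (a, b); such a determinant cannot be positive. The quantity \<open>e\<close> is the
  determinant with columns H v and H' v, so it vanishes when these are proportional.\<close>

lemma pencil_identity:
  fixes p r p' r' :: real and q q' a b :: complex
  defines "h \<equiv> (p * a + q * b) * cnj a + (cnj q * a + r * b) * cnj b"
    and "h' \<equiv> (p' * a + q' * b) * cnj a + (cnj q' * a + r' * b) * cnj b"
    and "e \<equiv> (p * a + q * b) * (cnj q' * a + r' * b) - (cnj q * a + r * b) * (p' * a + q' * b)"
  shows "h\<^sup>2 * (p' * r' - q' * cnj q') + h'\<^sup>2 * (p * r - q * cnj q)
    - (r * p' + p * r' - q * cnj q' - cnj q * q') * h * h' = - (e * cnj e)"
  using pencil_identity_aux[where p = p and r = r and p' = p' and r' = r' and q = q and q' = q' and Q = "cnj q"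
      and Q' = "cnj q'" and a = a and b = b and A = "cnj a" and B = "cnj b"]
  by (simp add: h_def h'_def e_def)

text \<open>Pairing the balance condition of each metric with the other one shows that the sum of h'
  i / h i + h i / h' i is 4 t. By \<open>pencil_identity\<close> each of these four terms is t minus
  a nonnegative defect, hence all defects vanish. So the directions of the lines are eigenvectors of
  H^-1 H'; three different directions make it a scalar, which the determinants and positivity fix to
  be 1.\<close>

lemma balanced_metric_unique:
  assumes H: "pos_def_herm H" "det H = 1" "(\<Sum>i\<in>{1..4::nat}. proj_mat H lam i) = mat c"
    and H': "pos_def_herm H'" "det H' = 1" "(\<Sum>i\<in>{1..4::nat}. proj_mat H' lam i) = mat c'"
  shows "H = H'"
proof -
  obtain p r q where P: "0 < p" "0 < r" "H$1$1 = complex_of_real p" "H$2$2 = complex_of_real r" "H$1$2 = q"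
    "H$2$1 = cnj q" "complex_of_real (p * r) - q * cnj q = 1" using pos_def_herm_coord[OF H(1,2)] .
  obtain p' r' q' where P': "0 < p'" "0 < r'" "H'$1$1 = complex_of_real p'" "H'$2$2 = complex_of_real r'" "H'$1$2 = q'"
    "H'$2$1 = cnj q'" "complex_of_real (p' * r') - q' * cnj q' = 1" using pos_def_herm_coord[OF H'(1,2)] .
  define u where "u i = line_vec lam i" for i
  define h where "h i = herm_ip H (u i) (u i)" for i
  define h' where "h' i = herm_ip H' (u i) (u i)" for i
  define t where "t = r * p' + p * r' - q * cnj q' - cnj q * q'"
  define e where "e i = (p * u i $ 1 + q * u i $ 2) * (cnj q' * u i $ 1 + r' * u i $ 2)
      - (cnj q * u i $ 1 + r * u i $ 2) * (p' * u i $ 1 + q' * u i $ 2)" for i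
  have pos: "\<exists>x x'. h i = complex_of_real x \<and> h' i = complex_of_real x' \<and> 0 < x \<and> 0 < x'" for i
    unfolding h_def h'_def u_def
    using pos_def_herm_ip[OF H(1) line_vec_nz, of lam i] pos_def_herm_ip[OF H'(1) line_vec_nz, of lam i] by metis
  then have h0: "h i \<noteq> 0" "h' i \<noteq> 0" for i by (metis of_real_eq_0_iff order_less_irrefl)+
  have id: "h' i / h i + h i / h' i = t - e i * cnj (e i) / (h i * h' i)" for i
  proof -
    have "(h i)\<^sup>2 * (p' * r' - q' * cnj q') + (h' i)\<^sup>2 * (p * r - q * cnj q) - t * h i * h' i = - (e i * cnj (e i))"
      unfolding h_def h'_def e_def t_def herm_ip_coord P(3-6) P'(3-6)
      using pencil_identity[where p = p and r = r and p' = p' and r' = r' and q = q and q' = q' and a = "u i $ 1" and b = "u i $ 2"]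
      by (simp add: P(3-6) P'(3-6))
    then have "(h i)\<^sup>2 + (h' i)\<^sup>2 - t * h i * h' i = - (e i * cnj (e i))" using P(7) P'(7) by simp
    then have eq: "(h' i)\<^sup>2 + (h i)\<^sup>2 = t * (h i * h' i) - e i * cnj (e i)" by (simp add: algebra_simps)
    have "h' i / h i + h i / h' i = ((h' i)\<^sup>2 + (h i)\<^sup>2) / (h i * h' i)"
      using h0[of i] by (simp add: add_divide_distrib power2_eq_square)
    then show ?thesis unfolding eq using h0[of i] by (simp add: diff_divide_distrib)
  qed
  have "(\<Sum>i\<in>{1..4::nat}. h' i / h i) = 2 * t"
    unfolding h_def h'_def u_def balanced_trace[OF H] t_def by (simp add: P P' algebra_simps)
  moreover have "(\<Sum>i\<in>{1..4::nat}. h i / h' i) = 2 * t"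
    unfolding h_def h'_def u_def balanced_trace[OF H'] t_def by (simp add: P P' algebra_simps)
  ultimately have "(\<Sum>i\<in>{1..4::nat}. h' i / h i + h i / h' i) = 4 * t" by (simp add: sum.distrib)
  then have s0: "(\<Sum>i\<in>{1..4::nat}. e i * cnj (e i) / (h i * h' i)) = 0"
    unfolding id by (simp add: sum_subtractf)
  define y where "y i = (norm (e i))\<^sup>2 / Re (h i * h' i)" for i
  have y: "y i \<ge> 0" "e i * cnj (e i) / (h i * h' i) = complex_of_real (y i)" "y i = 0 \<Longrightarrow> e i = 0" for i
  proof -
    obtain x x' where x: "h i = complex_of_real x" "h' i = complex_of_real x'" "0 < x" "0 < x'" using pos by blast
    show "y i \<ge> 0" "y i = 0 \<Longrightarrow> e i = 0" using x(3,4) by (auto simp: y_def x(1,2))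
    have "e i * cnj (e i) = complex_of_real ((norm (e i))\<^sup>2)" by (rule complex_norm_square[symmetric])
    then show "e i * cnj (e i) / (h i * h' i) = complex_of_real (y i)" by (simp add: y_def x(1,2))
  qed
  have "complex_of_real (\<Sum>i\<in>{1..4::nat}. y i) = 0"
    using s0 unfolding y(2) of_real_sum .
  then have sy: "(\<Sum>i\<in>{1..4::nat}. y i) = 0" by (rule of_real_eq_0_iff[THEN iffD1])
  have e: "e i = 0" if "i \<in> {1..4}" for i
    using sum_nonneg_eq_0_iff[of "{1..4::nat}" y] y(1) sy that by (intro y(3)) blast
  have e1: "q * r' = r * q'" using e[of 1] by (simp add: e_def u_def line_vec_def)
  have e2: "p * cnj q' = cnj q * p'" using e[of 2] by (simp add: e_def u_def line_vec_def)
  have e3: "(p + q) * (cnj q' + r') = (cnj q + r) * (p' + q')" using e[of 3] by (simp add: e_def u_def line_vec_def)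
  define k where "k = p' / p"
  have k: "k > 0" "p' = k * p" using P P' by (auto simp: k_def)
  have cq': "cnj q' = k * cnj q" using e2 P(1) k(2) by (simp add: field_simps)
  then have "cnj (cnj q') = cnj (k * cnj q)" by (simp only:)
  then have q': "q' = k * q" by simp
  have e4: "q * cnj q' = cnj q * q'" unfolding cq' unfolding q' by (simp add: mult_ac)
  have "complex_of_real p * r' = complex_of_real r * p'"
    using e3 e1 e2 e4 by (simp add: ring_distribs)
  then have "complex_of_real (p * r') = complex_of_real (r * p')" by simp
  then have "p * r' = r * p'" by (rule of_real_eq_iff[THEN iffD1])
  then have r': "r' = k * r" using P(1) k(2) by (simp add: field_simps)
  have "complex_of_real (p' * r') - q' * cnj q' = complex_of_real (k * k) * (complex_of_real (p * r) - q * cnj q)"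
    unfolding cq' unfolding q' r' k(2) by (simp add: algebra_simps)
  then have "complex_of_real (k * k) = 1" unfolding P(7) P'(7) by simp
  then have "k * k = 1" by (rule of_real_eq_1_iff[THEN iffD1])
  then have "k = 1" using k(1) by (simp add: power2_eq_square[symmetric] power2_eq_1_iff)
  then show ?thesis using k q' cq' r' P(3-6) P'(3-6) by (simp add: vec_eq_iff forall_2)
qed

section \<open>An explicit balanced metric\<close>

text \<open>The balanced metric up to scale, obtained by averaging over the group of four Moebius transformations
  that permute the points \<open>0, \<infinity>, 1, \<lambda>\<close> in pairs.\<close>

definition bal_metric :: "complex \<Rightarrow> cmat" where
  "bal_metric lam = (let \<rho> = norm lam; m = 1 + \<rho> + norm (1 - lam) in
     \<chi> i j. if i = 1 then (if j = 1 then of_real m else - (of_real \<rho> + lam))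
       else (if j = 1 then - (of_real \<rho> + cnj lam) else of_real (\<rho> * m)))"

lemma bal_metric_entry:
  "bal_metric lam $ 1 $ 1 = of_real (1 + norm lam + norm (1 - lam))"
  "bal_metric lam $ 1 $ 2 = - (of_real (norm lam) + lam)"
  "bal_metric lam $ 2 $ 1 = - (of_real (norm lam) + cnj lam)"
  "bal_metric lam $ 2 $ 2 = of_real (norm lam * (1 + norm lam + norm (1 - lam)))"
  by (simp_all add: bal_metric_def Let_def)

lemma norm_relations:
  fixes lam :: complex
  shows "complex_of_real (norm lam) * norm lam = lam * cnj lam"
    "complex_of_real (norm (1 - lam)) * norm (1 - lam) = (1 - lam) * (1 - cnj lam)"
  using complex_norm_square[of lam] complex_norm_square[of "1 - lam"] by (simp_all add: power2_eq_square)

lemma bal_metric_det: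
  "det (bal_metric lam) = of_real (2 * norm lam * norm (1 - lam) * (1 + norm lam + norm (1 - lam)))"
proof -
  have ring: "(1 + r + s) * (r * (1 + r + s)) - (- (r + l)) * (- (r + l')) = 2 * r * s * (1 + r + s)"
    if "r * r = l * l'" "s * s = (1 - l) * (1 - l')" for r s l l' :: complex
  proof -
    have "s * s = 1 - l - l' + r * r" using that by (simp add: algebra_simps)
    then have l: "l + l' = 1 + r * r - s * s" by (simp add: algebra_simps)
    have "(1 + r + s) * (r * (1 + r + s)) - (- (r + l)) * (- (r + l'))
      = r * (1 + r + s) * (1 + r + s) - r * r - r * (l + l') - l * l'" by (simp add: algebra_simps)
    then show ?thesis unfolding l that(1)[symmetric] by (simp add: algebra_simps)
  qed
  show ?thesis
    unfolding det_2 bal_metric_entry of_real_mult of_real_add of_real_1 of_real_numeral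
    by (rule ring[OF norm_relations])
qed

definition balanced :: "complex \<Rightarrow> cmat" where
  "balanced lam = (\<chi> i j. bal_metric lam $ i $ j /
     of_real (sqrt (2 * norm lam * norm (1 - lam) * (1 + norm lam + norm (1 - lam)))))"

context
  fixes lam :: complex assumes lam: "lam \<noteq> 0" "lam \<noteq> 1"
begin

lemma scale_pos: "0 < 2 * norm lam * norm (1 - lam) * (1 + norm lam + norm (1 - lam))"
  using lam by (intro mult_pos_pos add_pos_nonneg) auto

lemma det_balanced: "det (balanced lam) = 1"
proof -
  let ?d = "2 * norm lam * norm (1 - lam) * (1 + norm lam + norm (1 - lam))"
  have "det (balanced lam) = det (bal_metric lam) / (of_real (sqrt ?d) * of_real (sqrt ?d))"
    by (simp add: det_2 balanced_def diff_divide_distrib)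
  also have "of_real (sqrt ?d) * of_real (sqrt ?d) = (of_real ?d :: complex)"
    using scale_pos by (simp flip: of_real_mult)
  finally have "det (balanced lam) = of_real ?d / of_real ?d" unfolding bal_metric_det .
  also have "\<dots> = 1" using scale_pos by (intro divide_self) (simp only: of_real_eq_0_iff)
  finally show ?thesis .
qed

lemma pos_def_balanced: "pos_def_herm (balanced lam)"
proof -
  let ?\<rho> = "norm lam" and ?m = "1 + norm lam + norm (1 - lam)"
  let ?d = "2 * ?\<rho> * norm (1 - lam) * ?m"
  have m: "?m > 0" by (simp add: add_pos_nonneg)
  have re: "Re (herm_ip (bal_metric lam) v v) > 0" if v: "v \<noteq> 0" for v
  proof -
    let ?z = "of_real ?m * v$1 - (of_real ?\<rho> + lam) * v$2"
    \<comment> \<open>Completing the square in the first coordinate.\<close>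
    have "of_real ?m * herm_ip (bal_metric lam) v v = ?z * cnj ?z + det (bal_metric lam) * (v$2 * cnj (v$2))"
      unfolding herm_ip_coord bal_metric_entry det_2 by (simp add: algebra_simps)
    also have "\<dots> = of_real ((norm ?z)\<^sup>2 + ?d * (norm (v$2))\<^sup>2)"
      unfolding bal_metric_det of_real_add of_real_mult[of _ "(norm (v$2))\<^sup>2"] complex_norm_square ..
    finally have "Re (of_real ?m * herm_ip (bal_metric lam) v v) = (norm ?z)\<^sup>2 + ?d * (norm (v$2))\<^sup>2"
      by (simp only: Re_complex_of_real)
    then have eq: "?m * Re (herm_ip (bal_metric lam) v v) = (norm ?z)\<^sup>2 + ?d * (norm (v$2))\<^sup>2"
      by (simp only: Re_complex_of_real Im_complex_of_real times_complex.simps mult_zero_left diff_0_right)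
    have "0 < (norm ?z)\<^sup>2 + ?d * (norm (v$2))\<^sup>2"
    proof (cases "v$2 = 0")
      case True
      then have "v$1 \<noteq> 0" using v by (auto simp: vec_eq_iff forall_2)
      moreover have "complex_of_real ?m \<noteq> 0" using m of_real_eq_0_iff[of ?m, where 'a = complex] by linarith
      ultimately have "?z \<noteq> 0" using True by simp
      then show ?thesis using True by simp
    next
      case False
      then show ?thesis using scale_pos by (intro add_nonneg_pos mult_pos_pos) auto
    qed
    then show ?thesis unfolding eq[symmetric] using m by (rule zero_less_mult_pos)
  qed
  have sq: "sqrt ?d > 0" using scale_pos by simp
  have "herm_ip (balanced lam) v v = herm_ip (bal_metric lam) v v / of_real (sqrt ?d)" for v
    by (simp only: herm_ip_coord balanced_def vec_lambda_beta add_divide_distrib distrib_right times_divide_eq_left)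
  then have "Re (herm_ip (balanced lam) v v) = Re (herm_ip (bal_metric lam) v v) / sqrt ?d" for v
    by (simp only: Re_divide_of_real)
  then have "Re (herm_ip (balanced lam) v v) > 0" if "v \<noteq> 0" for v
    using re[OF that] sq by (simp only: divide_pos_pos)
  moreover have "cmat_adj (balanced lam) = balanced lam"
    by (simp add: vec_eq_iff forall_2 balanced_def bal_metric_entry)
  ultimately show ?thesis by (simp add: pos_def_herm_def)
qed

end

section \<open>Power series of separately holomorphic functions\<close>

text \<open>The Cauchy integral over the circle of radius \<rho> around u, parametrised on [0, 1].
  In this form the coefficient inherits continuity and holomorphy in further variables from the
  integrand.\<close>

definition taylor_coeff :: "(complex \<Rightarrow> complex) \<Rightarrow> complex \<Rightarrow> real \<Rightarrow> nat \<Rightarrow> complex" where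
  "taylor_coeff f u \<rho> n = integral {0..1} (\<lambda>t. f (u + of_real \<rho> * exp (2 * of_real pi * \<i> * of_real t)) /
      (of_real \<rho> * exp (2 * of_real pi * \<i> * of_real t)) ^ n)"

lemma taylor_coeff_sums:
  assumes hol: "f holomorphic_on ball u R" and \<rho>: "0 < \<rho>" "\<rho> < R" and z: "z \<in> ball u \<rho>"
  shows "(\<lambda>n. taylor_coeff f u \<rho> n * (z - u) ^ n) sums f z"
proof -
  have sub: "cball u \<rho> \<subseteq> ball u R" using \<rho> by auto
  have h: "f holomorphic_on ball u \<rho>" using hol sub by (meson ball_subset_cball holomorphic_on_subset)
  have c: "continuous_on (cball u \<rho>) f"
    using hol sub by (meson holomorphic_on_imp_continuous_on holomorphic_on_subset)
  have "taylor_coeff f u \<rho> n = (deriv ^^ n) f u / fact n" for n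
  proof -
    have "contour_integral (circlepath u \<rho>) (\<lambda>w. f w / (w - u) ^ Suc n) = (2 * pi * \<i>) / fact n * (deriv ^^ n) f u"
      by (rule contour_integral_unique[OF Cauchy_has_contour_integral_higher_derivative_circlepath[OF c h]]) (use \<rho> in auto)
    moreover have "contour_integral (circlepath u \<rho>) (\<lambda>w. f w / (w - u) ^ Suc n)
      = integral {0..1} (\<lambda>t. (2 * pi * \<i>) * (f (u + of_real \<rho> * exp (2 * of_real pi * \<i> * of_real t)) /
      (of_real \<rho> * exp (2 * of_real pi * \<i> * of_real t)) ^ n))"
      unfolding contour_integral_integral vector_derivative_circlepath unfolding circlepath
      using \<rho> by (intro Henstock_Kurzweil_Integration.integral_cong) (simp add: field_simps)
    ultimately have "(2 * pi * \<i>) * taylor_coeff f u \<rho> n = (2 * pi * \<i>) * ((deriv ^^ n) f u / fact n)"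
      by (simp only: taylor_coeff_def integral_mult_right) simp
    then show ?thesis by (metis (no_types, lifting) complex_i_not_zero mult_cancel_left
          mult_eq_0_iff of_real_eq_0_iff pi_neq_zero zero_neq_numeral)
  qed
  then show ?thesis using holomorphic_power_series[OF h z] by simp
qed

lemma taylor_coeff_norm_le:
  assumes c: "continuous_on (cball u \<rho>) f" and \<rho>: "0 < \<rho>" and M: "\<And>z. z \<in> cball u \<rho> \<Longrightarrow> norm (f z) \<le> M"
  shows "norm (taylor_coeff f u \<rho> n) \<le> M / \<rho> ^ n"
proof -
  have in_c: "u + of_real \<rho> * exp (2 * of_real pi * \<i> * of_real t) \<in> cball u \<rho>" for t :: real
    using \<rho> by (simp add: dist_norm norm_mult)
  have "norm (taylor_coeff f u \<rho> n) \<le> integral {0..1} (\<lambda>t::real. M / \<rho> ^ n)"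
    unfolding taylor_coeff_def
  proof (rule integral_norm_bound_integral)
    show "(\<lambda>t. f (u + of_real \<rho> * exp (2 * of_real pi * \<i> * of_real t)) /
      (of_real \<rho> * exp (2 * of_real pi * \<i> * of_real t)) ^ n) integrable_on {0..1}"
      using in_c \<rho>
      by (intro integrable_continuous_interval continuous_intros continuous_on_compose2[OF c]) auto
    fix t :: real
    show "norm (f (u + of_real \<rho> * exp (2 * of_real pi * \<i> * of_real t)) /
      (of_real \<rho> * exp (2 * of_real pi * \<i> * of_real t)) ^ n) \<le> M / \<rho> ^ n"
      using M[OF in_c[of t]] \<rho> by (simp add: norm_divide norm_power norm_mult divide_right_mono)
  qed auto
  then show ?thesis by simp
qed

lemma taylor_coeff_continuous:
  fixes f :: "complex \<Rightarrow> 'p::topological_space \<Rightarrow> complex"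
  assumes c: "continuous_on (cball u \<rho> \<times> Y) (\<lambda>(z, y). f z y)" and \<rho>: "0 < \<rho>"
  shows "continuous_on Y (\<lambda>y. taylor_coeff (\<lambda>z. f z y) u \<rho> n)"
proof -
  let ?e = "\<lambda>t::real. of_real \<rho> * exp (2 * of_real pi * \<i> * of_real t)"
  have m: "continuous_on (Y \<times> cbox 0 1) (\<lambda>p. (u + ?e (snd p), fst p))"
     "(\<lambda>p. (u + ?e (snd p), fst p)) ` (Y \<times> cbox 0 1) \<subseteq> cball u \<rho> \<times> Y"
    using \<rho> by (auto intro!: continuous_intros simp: dist_norm norm_mult)
  have "continuous_on Y (\<lambda>y. integral (cbox 0 1) (\<lambda>t. f (u + ?e t) y / ?e t ^ n))"
    by (rule integral_continuous_on_param)
      (use continuous_on_compose2[OF c m] \<rho> in \<open>auto simp: case_prod_unfold intro!: continuous_intros\<close>)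
  then show ?thesis by (simp add: taylor_coeff_def)
qed

lemma taylor_coeff_holomorphic:
  fixes f :: "complex \<Rightarrow> complex \<Rightarrow> complex"
  assumes c: "continuous_on (cball u \<rho> \<times> Y) (\<lambda>(z, y). f z y)" and \<rho>: "0 < \<rho>" and Y: "open Y"
    and hol: "\<And>z. z \<in> cball u \<rho> \<Longrightarrow> f z holomorphic_on Y"
  shows "(\<lambda>y. taylor_coeff (\<lambda>z. f z y) u \<rho> n) holomorphic_on Y"
proof -
  let ?e = "\<lambda>t::real. of_real \<rho> * exp (2 * of_real pi * \<i> * of_real t)"
  have m: "continuous_on ({0..1} \<times> Y) (\<lambda>p. (u + ?e (fst p), snd p))"
     "(\<lambda>p. (u + ?e (fst p), snd p)) ` ({0..1} \<times> Y) \<subseteq> cball u \<rho> \<times> Y"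
    using \<rho> by (auto intro!: continuous_intros simp: dist_norm norm_mult)
  have "(\<lambda>y. integral {0..1} (\<lambda>t. f (u + ?e t) y / ?e t ^ n)) holomorphic_on Y"
  proof (rule holomorphic_integral_param[OF Y])
    show "continuous_on ({0..1} \<times> Y) (\<lambda>(t, y). f (u + ?e t) y / ?e t ^ n)"
      using continuous_on_compose2[OF c m] \<rho> by (auto simp: case_prod_unfold intro!: continuous_intros)
    show "(\<lambda>y. f (u + ?e t) y / ?e t ^ n) holomorphic_on Y" for t
      using \<rho> by (intro holomorphic_intros hol) (auto simp: dist_norm norm_mult)
  qed
  then show ?thesis by (simp add: taylor_coeff_def)
qed

text \<open>Joint continuity is part of the notion, so that the Cauchy integrals can be taken one
  variable after the other, as in Osgood's lemma.\<close>

definition separately_holomorphic :: "complex set \<Rightarrow> complex set \<Rightarrow> complex set \<Rightarrow>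
    (complex \<times> complex \<times> complex \<Rightarrow> complex) \<Rightarrow> bool" where
  "separately_holomorphic A B C f \<longleftrightarrow> continuous_on (A \<times> B \<times> C) f \<and>
     (\<forall>v\<in>B. \<forall>w\<in>C. (\<lambda>u. f (u, v, w)) holomorphic_on A) \<and>
     (\<forall>u\<in>A. \<forall>w\<in>C. (\<lambda>v. f (u, v, w)) holomorphic_on B) \<and>
     (\<forall>u\<in>A. \<forall>v\<in>B. (\<lambda>w. f (u, v, w)) holomorphic_on C)"

lemma power_product_summable:
  fixes q :: real assumes q: "0 \<le> q" "q < 1"
  shows "(\<lambda>(i, j, k). M * (q ^ i * q ^ j * q ^ k)) summable_on (UNIV :: (nat \<times> nat \<times> nat) set)"
proof -
  have g: "((\<lambda>n::nat. q ^ n) has_sum 1 / (1 - q)) UNIV"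
    using q by (intro norm_summable_imp_has_sum geometric_sums) (auto simp: norm_power)
  have s2: "((\<lambda>(j, k). q ^ j * q ^ k) has_sum (1 / (1 - q)) * (1 / (1 - q))) (UNIV \<times> UNIV :: (nat \<times> nat) set)"
  proof (rule has_sum_SigmaI)
    show "((\<lambda>k. case (j, k) of (j, k) \<Rightarrow> q ^ j * q ^ k) has_sum q ^ j * (1 / (1 - q))) UNIV" for j :: nat
      using has_sum_cmult_right[OF g] by simp
    show "((\<lambda>j. q ^ j * (1 / (1 - q))) has_sum (1 / (1 - q)) * (1 / (1 - q))) UNIV"
      by (rule has_sum_cmult_left[OF g])
    show "(\<lambda>(j, k). q ^ j * q ^ k) summable_on (UNIV \<times> UNIV :: (nat \<times> nat) set)"
    proof (rule summable_on_SigmaI)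
      show "((\<lambda>k. case (j, k) of (j, k) \<Rightarrow> q ^ j * q ^ k) has_sum q ^ j * (1 / (1 - q))) UNIV" for j :: nat
        using has_sum_cmult_right[OF g] by simp
      show "(\<lambda>j. q ^ j * (1 / (1 - q))) summable_on UNIV"
        by (rule has_sum_imp_summable[OF has_sum_cmult_left[OF g]])
    qed (use q in auto)
  qed
  have "(\<lambda>(i, p). q ^ i * (\<lambda>(j, k). q ^ j * q ^ k) p) summable_on (UNIV \<times> (UNIV \<times> UNIV) :: (nat \<times> nat \<times> nat) set)"
  proof (rule summable_on_SigmaI)
    show "((\<lambda>p. case (i, p) of (i, p) \<Rightarrow> q ^ i * (\<lambda>(j, k). q ^ j * q ^ k) p) has_sum
        q ^ i * ((1 / (1 - q)) * (1 / (1 - q)))) (UNIV \<times> UNIV)" for i :: nat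
      using has_sum_cmult_right[OF s2] by (simp add: case_prod_unfold)
    show "(\<lambda>i. q ^ i * ((1 / (1 - q)) * (1 / (1 - q)))) summable_on UNIV"
      by (rule has_sum_imp_summable[OF has_sum_cmult_left[OF g]])
  qed (use q in auto)
  then have "(\<lambda>p. M * (case p of (i, p) \<Rightarrow> q ^ i * (\<lambda>(j, k). q ^ j * q ^ k) p)) summable_on (UNIV :: (nat \<times> nat \<times> nat) set)"
    by (intro summable_on_cmult_right) simp
  then show ?thesis by (simp add: case_prod_unfold mult.assoc)
qed

text \<open>Osgood: expand in one variable at a time; the Taylor coefficients are Cauchy integrals, hence stay
  holomorphic in the remaining variables.\<close>

lemma separately_holomorphic_power_series:
  assumes f: "separately_holomorphic (ball a R) (ball b R) (ball c R) f" and R: "0 < \<rho>" "\<rho> < R"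
  shows "\<exists>C. \<forall>u\<in>ball a \<rho>. \<forall>v\<in>ball b \<rho>. \<forall>w\<in>ball c \<rho>.
     ((\<lambda>(i, j, k). C (i, j, k) * (u - a) ^ i * (v - b) ^ j * (w - c) ^ k) has_sum f (u, v, w)) (UNIV :: (nat \<times> nat \<times> nat) set)"
proof -
  define cA where "cA i v w = taylor_coeff (\<lambda>u. f (u, v, w)) a \<rho> i" for i v w
  define cB where "cB i j w = taylor_coeff (\<lambda>v. cA i v w) b \<rho> j" for i j w
  define cC where "cC i j k = taylor_coeff (\<lambda>w. cB i j w) c \<rho> k" for i j k
  have sub: "cball x \<rho> \<subseteq> ball x R" for x :: complex using R by auto
  have cont: "continuous_on (ball a R \<times> ball b R \<times> ball c R) f"
    and h1: "\<And>v w. v \<in> ball b R \<Longrightarrow> w \<in> ball c R \<Longrightarrow> (\<lambda>u. f (u, v, w)) holomorphic_on ball a R"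
    and h2: "\<And>u w. u \<in> ball a R \<Longrightarrow> w \<in> ball c R \<Longrightarrow> (\<lambda>v. f (u, v, w)) holomorphic_on ball b R"
    and h3: "\<And>u v. u \<in> ball a R \<Longrightarrow> v \<in> ball b R \<Longrightarrow> (\<lambda>w. f (u, v, w)) holomorphic_on ball c R"
    using f by (auto simp: separately_holomorphic_def)
  have "compact (cball a \<rho> \<times> cball b \<rho> \<times> cball c \<rho>)" by (intro compact_Times compact_cball)
  moreover have "continuous_on (cball a \<rho> \<times> cball b \<rho> \<times> cball c \<rho>) f"
    by (rule continuous_on_subset[OF cont]) (use sub in blast)
  ultimately obtain M where M: "\<And>p. p \<in> cball a \<rho> \<times> cball b \<rho> \<times> cball c \<rho> \<Longrightarrow> norm (f p) \<le> M"
    using continuous_bounded_on_compact by metis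
  have contA: "continuous_on (ball b R \<times> ball c R) (\<lambda>(v, w). cA i v w)" for i
  proof -
    have "continuous_on (ball b R \<times> ball c R) (\<lambda>y. taylor_coeff (\<lambda>u. f (u, fst y, snd y)) a \<rho> i)"
      by (rule taylor_coeff_continuous[OF _ R(1)])
        (use sub in \<open>auto simp: case_prod_unfold intro!: continuous_on_subset[OF cont]\<close>)
    then show ?thesis by (simp add: cA_def case_prod_unfold)
  qed
  have hA2: "(\<lambda>v. cA i v w) holomorphic_on ball b R" if w: "w \<in> ball c R" for i w
    unfolding cA_def
  proof (rule taylor_coeff_holomorphic[OF _ R(1) open_ball])
    have m: "continuous_on (cball a \<rho> \<times> ball b R) (\<lambda>p. (fst p, snd p, w))"
      "(\<lambda>p. (fst p, snd p, w)) ` (cball a \<rho> \<times> ball b R) \<subseteq> ball a R \<times> ball b R \<times> ball c R"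
      using R w by (auto intro!: continuous_intros)
    show "continuous_on (cball a \<rho> \<times> ball b R) (\<lambda>(u, v). f (u, v, w))"
      using continuous_on_compose2[OF cont m] by (simp add: case_prod_unfold)
  qed (use h2 sub w in blast)
  have hA3: "(\<lambda>w. cA i v w) holomorphic_on ball c R" if v: "v \<in> ball b R" for i v
    unfolding cA_def
  proof (rule taylor_coeff_holomorphic[OF _ R(1) open_ball])
    have m: "continuous_on (cball a \<rho> \<times> ball c R) (\<lambda>p. (fst p, v, snd p))"
      "(\<lambda>p. (fst p, v, snd p)) ` (cball a \<rho> \<times> ball c R) \<subseteq> ball a R \<times> ball b R \<times> ball c R"
      using R v by (auto intro!: continuous_intros)
    show "continuous_on (cball a \<rho> \<times> ball c R) (\<lambda>(u, w). f (u, v, w))"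
      using continuous_on_compose2[OF cont m] by (simp add: case_prod_unfold)
  qed (use h3 sub v in blast)
  have hB: "(\<lambda>w. cB i j w) holomorphic_on ball c R" for i j
    unfolding cB_def
    by (rule taylor_coeff_holomorphic[OF _ R(1) open_ball])
      (use R hA3 in \<open>auto intro!: continuous_on_subset[OF contA]\<close>)
  have bA: "norm (cA i v w) \<le> M / \<rho> ^ i" if "v \<in> cball b \<rho>" "w \<in> cball c \<rho>" for i v w
    unfolding cA_def
  proof (rule taylor_coeff_norm_le[OF _ R(1)])
    show "continuous_on (cball a \<rho>) (\<lambda>u. f (u, v, w))"
      using h1[of v w] that sub by (meson holomorphic_on_imp_continuous_on holomorphic_on_subset subsetD)
  qed (use M that in auto)
  have bB: "norm (cB i j w) \<le> M / \<rho> ^ i / \<rho> ^ j" if "w \<in> cball c \<rho>" for i j w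
    unfolding cB_def
  proof (rule taylor_coeff_norm_le[OF _ R(1)])
    show "continuous_on (cball b \<rho>) (\<lambda>v. cA i v w)"
      using hA2[of w i] that sub by (meson holomorphic_on_imp_continuous_on holomorphic_on_subset subsetD)
  qed (use bA that in auto)
  have bC: "norm (cC i j k) \<le> M / \<rho> ^ i / \<rho> ^ j / \<rho> ^ k" for i j k
    unfolding cC_def
  proof (rule taylor_coeff_norm_le[OF _ R(1)])
    show "continuous_on (cball c \<rho>) (\<lambda>w. cB i j w)"
      using hB[of i j] sub by (meson holomorphic_on_imp_continuous_on holomorphic_on_subset)
  qed (use bB in auto)
  have main: "((\<lambda>(i, j, k). cC i j k * (u - a) ^ i * (v - b) ^ j * (w - c) ^ k) has_sum f (u, v, w)) UNIV"
    if u: "u \<in> ball a \<rho>" and v: "v \<in> ball b \<rho>" and w: "w \<in> ball c \<rho>" for u v w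
  proof -
    \<comment> \<open>A common ratio below 1 for the three coordinates relative to \<rho>; with the
      Cauchy estimates it gives the majorant M q^(i + j + k).\<close>
    define q where "q = max (norm (u - a)) (max (norm (v - b)) (norm (w - c))) / \<rho>"
    have d: "norm (u - a) < \<rho>" "norm (v - b) < \<rho>" "norm (w - c) < \<rho>"
      using u v w by (simp_all add: dist_norm norm_minus_commute)
    have q: "0 \<le> q" "q < 1" using d R by (simp_all add: q_def le_max_iff_disj)
    have "q * \<rho> = max (norm (u - a)) (max (norm (v - b)) (norm (w - c)))" using R by (simp add: q_def)
    then have qb: "norm (u - a) \<le> q * \<rho>" "norm (v - b) \<le> q * \<rho>" "norm (w - c) \<le> q * \<rho>" by simp_all
    have "norm (f (a, b, c)) \<le> M" using M R by simp
    then have M0: "0 \<le> M" using norm_ge_zero order_trans by blast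
    have le: "norm (cC i j k * (u - a) ^ i * (v - b) ^ j * (w - c) ^ k) \<le> M * (q ^ i * q ^ j * q ^ k)" for i j k
    proof -
      have "norm (cC i j k * (u - a) ^ i * (v - b) ^ j * (w - c) ^ k)
        \<le> M / \<rho> ^ i / \<rho> ^ j / \<rho> ^ k * (q * \<rho>) ^ i * (q * \<rho>) ^ j * (q * \<rho>) ^ k"
        unfolding norm_mult norm_power using bC[of i j k] qb q R M0
        by (intro mult_mono power_mono) auto
      also have "\<dots> = M * (q ^ i * q ^ j * q ^ k)"
        using R by (simp add: power_mult_distrib)
      finally show ?thesis .
    qed
    let ?F = "\<lambda>(i, j, k). cC i j k * (u - a) ^ i * (v - b) ^ j * (w - c) ^ k"
    have "(\<lambda>p. norm (?F p)) summable_on UNIV"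
      by (rule summable_on_comparison_test[OF power_product_summable[OF q, of M]]) (use le in auto)
    then have summ: "?F summable_on UNIV" by (rule abs_summable_summable)
    then have summ': "?F summable_on (UNIV \<times> UNIV)" by simp
    have uB: "u \<in> ball a R" "v \<in> ball b R" "w \<in> ball c R" using u v w R by auto
    have hs: "(g has_sum S) UNIV" if "g sums S" "\<And>n. norm (g n) \<le> K * q ^ n" for g :: "nat \<Rightarrow> complex" and S K
    proof (rule norm_summable_imp_has_sum[OF _ that(1)])
      show "summable (\<lambda>n. norm (g n))"
        by (rule summable_comparison_test'[where g = "\<lambda>n. K * q ^ n" and N = 0])
          (use that(2) q in \<open>auto intro!: summable_mult summable_geometric\<close>)
    qed
    have eC: "((\<lambda>k. cC i j k * (w - c) ^ k) has_sum cB i j w) UNIV" for i j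
    proof (rule hs)
      show "(\<lambda>k. cC i j k * (w - c) ^ k) sums cB i j w"
        unfolding cC_def by (rule taylor_coeff_sums[OF hB R w])
      have "norm (cC i j k * (w - c) ^ k) \<le> M / \<rho> ^ i / \<rho> ^ j / \<rho> ^ k * (q * \<rho>) ^ k" for k
        unfolding norm_mult norm_power using bC[of i j k] qb q R M0 by (intro mult_mono power_mono) auto
      then show "norm (cC i j k * (w - c) ^ k) \<le> M / \<rho> ^ i / \<rho> ^ j * q ^ k" for k
        using R by (simp add: power_mult_distrib)
    qed
    have eB: "((\<lambda>j. cB i j w * (v - b) ^ j) has_sum cA i v w) UNIV" for i
    proof (rule hs)
      show "(\<lambda>j. cB i j w * (v - b) ^ j) sums cA i v w"
        unfolding cB_def by (rule taylor_coeff_sums[OF hA2[OF uB(3)] R v])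
      have "norm (cB i j w * (v - b) ^ j) \<le> M / \<rho> ^ i / \<rho> ^ j * (q * \<rho>) ^ j" for j
        unfolding norm_mult norm_power using bB[of w i j] w qb q R M0 by (intro mult_mono power_mono) auto
      then show "norm (cB i j w * (v - b) ^ j) \<le> M / \<rho> ^ i * q ^ j" for j
        using R by (simp add: power_mult_distrib)
    qed
    have eA: "((\<lambda>i. cA i v w * (u - a) ^ i) has_sum f (u, v, w)) UNIV"
    proof (rule hs)
      show "(\<lambda>i. cA i v w * (u - a) ^ i) sums f (u, v, w)"
        unfolding cA_def by (rule taylor_coeff_sums[OF h1[OF uB(2,3)] R u])
      have "norm (cA i v w * (u - a) ^ i) \<le> M / \<rho> ^ i * (q * \<rho>) ^ i" for i
        unfolding norm_mult norm_power using bA[of v w i] v w qb q R M0 by (intro mult_mono power_mono) auto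
      then show "norm (cA i v w * (u - a) ^ i) \<le> M * q ^ i" for i
        using R by (simp add: power_mult_distrib)
    qed
    \<comment> \<open>Absolute summability of the triple family allows the three one-variable
      expansions to be collected into a single sum over triples.\<close>
    have in2: "((\<lambda>p. ?F (i, p)) has_sum cA i v w * (u - a) ^ i) (UNIV \<times> UNIV)" for i
    proof (rule has_sum_SigmaI)
      show "((\<lambda>k. ?F (i, j, k)) has_sum cB i j w * (v - b) ^ j * (u - a) ^ i) UNIV" for j
        using has_sum_cmult_right[OF eC, of "(v - b) ^ j * (u - a) ^ i" i j] by (simp add: mult_ac)
      show "((\<lambda>j. cB i j w * (v - b) ^ j * (u - a) ^ i) has_sum cA i v w * (u - a) ^ i) UNIV"
        by (rule has_sum_cmult_left[OF eB])
      show "(\<lambda>p. ?F (i, p)) summable_on (UNIV \<times> UNIV)"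
        using summable_on_SigmaD1[OF summ', of i] by simp
    qed
    have "(?F has_sum f (u, v, w)) (UNIV \<times> UNIV)"
      by (rule has_sum_SigmaI[OF _ eA summ']) (use in2 in simp)
    then show ?thesis by simp
  qed
  show ?thesis by (rule exI[of _ "\<lambda>(i, j, k). cC i j k"]) (use main in auto)
qed

section \<open>The residue matrices\<close>

definition mk_mat :: "complex \<Rightarrow> complex \<Rightarrow> complex \<Rightarrow> complex \<Rightarrow> cmat" where
  "mk_mat a b c d = (\<chi> i j. if i = 1 then (if j = 1 then a else b) else (if j = 1 then c else d))"

lemma mk_mat_entry [simp]: "mk_mat a b c d $ 1 $ 1 = a" "mk_mat a b c d $ 1 $ 2 = b"
   "mk_mat a b c d $ 2 $ 1 = c" "mk_mat a b c d $ 2 $ 2 = d"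
  by (simp_all add: mk_mat_def)

lemma cmat_eq_iff: "A = (B :: cmat) \<longleftrightarrow> A$1$1 = B$1$1 \<and> A$1$2 = B$1$2 \<and> A$2$1 = B$2$1 \<and> A$2$2 = B$2$2"
  by (auto simp: vec_eq_iff forall_2)

text \<open>The residue matrices as rational functions of \<open>l = \<lambda>\<close>, \<open>k = cnj \<lambda>\<close>, \<open>r = |\<lambda>|\<close>, \<open>s = |1 - \<lambda>|\<close>, with these four
  treated as independent: this is the form that extends holomorphically.\<close>

definition dunkl_res :: "complex \<Rightarrow> complex \<Rightarrow> complex \<Rightarrow> complex \<Rightarrow> nat \<Rightarrow> cmat" where
  "dunkl_res l k r s i = (let m = 1 + r + s in
     if i = 1 then mk_mat 1 0 ((r + k) / (r * m)) 0
     else if i = 2 then mk_mat 0 ((r + l) / m) 0 1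
     else if i = 3 then mk_mat (1 - (m - r - k) / (s * m)) (- ((r * m - r - l) / (s * m)))
        (- ((m - r - k) / (s * m))) (1 - (r * m - r - l) / (s * m))
     else mk_mat (1 - l * (k * m - r - k) / (r * s * m)) (- (l * (r * m - k * (r + l)) / (r * s * m)))
        (- ((k * m - r - k) / (r * s * m))) (1 - (r * m - k * (r + l)) / (r * s * m)))"

lemma sum_rel:
  fixes r s l k :: complex
  assumes "r * r = l * k" "s * s = (1 - l) * (1 - k)"
  shows "l + k = 1 + r * r - s * s"
  using assms by (simp add: algebra_simps)

lemma mk_mat_sum:
  assumes "a + a' = 1" "b + b' = z" "c + c' = w" "d + d' = 1"
  shows "mk_mat 1 0 w 0 + mk_mat 0 z 0 1 + mk_mat (1 - a) (- b) (- c) (1 - d) + mk_mat (1 - a') (- b') (- c') (1 - d') = mat 2"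
proof -
  have "a' = 1 - a" "b' = z - b" "c' = w - c" "d' = 1 - d"
    using assms by (simp_all add: eq_diff_eq add.commute)
  then show ?thesis by (simp add: cmat_eq_iff mat_def)
qed

text \<open>The balance condition for the explicit residues, which follows from the two relations
  among l, k, r, s alone. The third and fourth matrix are added over the common denominator r s m,
  and the relations express l + k and l k through r and s.\<close>

lemma dunkl_res_sum:
  assumes rel: "r * r = l * k" "s * s = (1 - l) * (1 - k)" and nz: "r \<noteq> 0" "s \<noteq> 0" "1 + r + s \<noteq> 0"
  shows "dunkl_res l k r s 1 + dunkl_res l k r s 2 + dunkl_res l k r s 3 + dunkl_res l k r s 4 = mat 2"
proof -
  define m where "m = 1 + r + s"
  have m: "m \<noteq> 0" using nz by (simp add: m_def)
  have lk: "l + k = 1 + r * r - s * s" by (rule sum_rel[OF rel])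
  have c2: "x / (s * m) + y / (r * s * m) = z" if "r * x + y = z * (r * s * m)" for x y z
  proof -
    have "x / (s * m) + y / (r * s * m) = (r * x + y) / (r * s * m)"
      using nz m by (simp add: add_divide_distrib)
    then show ?thesis unfolding that using nz m by simp
  qed
  have e22: "(r * m - r - l) / (s * m) + (r * m - k * (r + l)) / (r * s * m) = 1"
  proof (rule c2)
    have "r * (r * m - r - l) + (r * m - k * (r + l)) = r * (r * m + m - r - l - k) - l * k" by (simp add: algebra_simps)
    also have "\<dots> = r * ((1 + r) * m - 2 * r - (l + k))" unfolding rel(1)[symmetric] by (simp add: algebra_simps)
    also have "\<dots> = 1 * (r * s * m)" unfolding lk m_def by (simp add: algebra_simps)
    finally show "r * (r * m - r - l) + (r * m - k * (r + l)) = 1 * (r * s * m)" .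
  qed
  have e11: "(m - r - k) / (s * m) + l * (k * m - r - k) / (r * s * m) = 1"
  proof (rule c2)
    have "r * (m - r - k) + l * (k * m - r - k) = r * (m - r - k - l) + (l * k) * (m - 1)" by (simp add: algebra_simps)
    also have "\<dots> = r * ((1 + r) * m - 2 * r - (l + k))" unfolding rel(1)[symmetric] by (simp add: algebra_simps)
    also have "\<dots> = 1 * (r * s * m)" unfolding lk m_def by (simp add: algebra_simps)
    finally show "r * (m - r - k) + l * (k * m - r - k) = 1 * (r * s * m)" .
  qed
  have e12: "(r * m - r - l) / (s * m) + l * (r * m - k * (r + l)) / (r * s * m) = (r + l) / m"
  proof (rule c2)
    have "r * (r * m - r - l) + l * (r * m - k * (r + l)) = r * ((r + l) * m - r - l) - (l * k) * (r + l)"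
      by (simp add: algebra_simps)
    also have "\<dots> = (r + l) * (r * s)" unfolding rel(1)[symmetric] by (simp add: algebra_simps m_def)
    also have "\<dots> = (r + l) / m * (r * s * m)" using m by simp
    finally show "r * (r * m - r - l) + l * (r * m - k * (r + l)) = (r + l) / m * (r * s * m)" .
  qed
  have e21: "(m - r - k) / (s * m) + (k * m - r - k) / (r * s * m) = (r + k) / (r * m)"
  proof (rule c2)
    have "r * (m - r - k) + (k * m - r - k) = (r + k) * s" by (simp add: algebra_simps m_def)
    also have "\<dots> = (r + k) / (r * m) * (r * s * m)" using m nz by simp
    finally show "r * (m - r - k) + (k * m - r - k) = (r + k) / (r * m) * (r * s * m)" .
  qed
  show ?thesis
    using mk_mat_sum[OF e11 e12 e21 e22] unfolding dunkl_res_def Let_def m_def[symmetric] by simp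
qed

text \<open>Orthogonal projections are insensitive to the scale of the metric, so computations may
  use \<open>bal_metric\<close>, whose entries are free of the normalising square root.\<close>

lemma compl_proj_cong:
  assumes "s \<noteq> 0" "\<And>i j. H' $ i $ j = H $ i $ j / s"
  shows "compl_proj H' u = compl_proj H u"
proof -
  have "herm_ip H' u u = herm_ip H u u / s"
    using assms(2) by (simp only: herm_ip_coord add_divide_distrib distrib_right times_divide_eq_left)
  moreover have "cnj (u$1) * H'$1$k + cnj (u$2) * H'$2$k = (cnj (u$1) * H$1$k + cnj (u$2) * H$2$k) / s" for k
    using assms(2) by (simp add: add_divide_distrib)
  ultimately show ?thesis using assms(1) by (simp add: compl_proj_def)
qed

context
  fixes lam :: complex assumes lam: "lam \<noteq> 0" "lam \<noteq> 1"
begin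

private abbreviation "r \<equiv> complex_of_real (norm lam)"
private abbreviation "s \<equiv> complex_of_real (norm (1 - lam))"

lemma nz: "r \<noteq> 0" "s \<noteq> 0" "1 + r + s \<noteq> 0"
proof -
  show "r \<noteq> 0" "s \<noteq> 0" using lam by auto
  have "1 + r + s = of_real (1 + norm lam + norm (1 - lam))" by simp
  moreover have "1 + norm lam + norm (1 - lam) \<noteq> 0"
    using norm_ge_zero[of lam] norm_ge_zero[of "1 - lam"] by linarith
  ultimately show "1 + r + s \<noteq> 0" by (metis of_real_eq_0_iff)
qed

lemma compl_proj_bal_metric:
  assumes "i \<in> {1..4}"
  shows "compl_proj (bal_metric lam) (line_vec lam i) = dunkl_res lam (cnj lam) r s i"
proof -
  define m where "m = 1 + r + s"
  have m: "m \<noteq> 0" using nz by (simp add: m_def)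
  have rel: "r * r = lam * cnj lam" "s * s = (1 - lam) * (1 - cnj lam)" by (rule norm_relations)+
  have lk: "lam + cnj lam = 1 + r * r - s * s" by (rule sum_rel[OF rel])
  have K: "bal_metric lam $ 1 $ 1 = m" "bal_metric lam $ 1 $ 2 = - (r + lam)"
    "bal_metric lam $ 2 $ 1 = - (r + cnj lam)" "bal_metric lam $ 2 $ 2 = r * m"
    by (simp_all add: bal_metric_entry m_def)
  \<comment> \<open>\<open>h3\<close> and \<open>h4\<close> are the squared lengths, for
    \<open>bal_metric\<close>, of the directions (1, 1) and (lam, 1). The relations factor them into
    s m and r s m, the denominators in \<open>dunkl_res\<close>.\<close>
  have h3: "m - (r + cnj lam) + (r * m - (r + lam)) = s * m"
  proof -
    have "m - (r + cnj lam) + (r * m - (r + lam)) = (1 + r) * m - 2 * r - (lam + cnj lam)" by (simp add: algebra_simps)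
    also have "\<dots> = s * m" unfolding lk m_def by (simp add: algebra_simps)
    finally show ?thesis .
  qed
  have h4: "(m * lam - (r + lam)) * cnj lam + (r * m - (r + cnj lam) * lam) = r * s * m"
  proof -
    have "(m * lam - (r + lam)) * cnj lam + (r * m - (r + cnj lam) * lam)
      = (lam * cnj lam) * (m - 2) - r * (lam + cnj lam) + r * m" by (simp add: algebra_simps)
    also have "\<dots> = r * s * m" unfolding rel(1)[symmetric] lk m_def by (simp add: algebra_simps)
    finally show ?thesis .
  qed
  consider "i = 1" | "i = 2" | "i = 3" | "i = 4" using assms by force
  then show ?thesis
  proof cases
    case 1
    then show ?thesis using m nz
      by (simp add: diff_divide_distrib add_divide_distrib cmat_eq_iff compl_proj_entry herm_ip_coord line_vec_def K dunkl_res_def Let_def m_def[symmetric])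
  next
    case 2
    then show ?thesis using m nz
      by (simp add: diff_divide_distrib add_divide_distrib cmat_eq_iff compl_proj_entry herm_ip_coord line_vec_def K dunkl_res_def Let_def m_def[symmetric])
  next
    case 3
    have h: "herm_ip (bal_metric lam) (line_vec lam 3) (line_vec lam 3) = s * m"
      using h3 by (simp add: herm_ip_coord line_vec_def K algebra_simps)
    then show ?thesis 
      unfolding 3 cmat_eq_iff compl_proj_entry h K dunkl_res_def Let_def m_def[symmetric]
      by (simp add: line_vec_def algebra_simps)
  next
    case 4
    have h: "herm_ip (bal_metric lam) (line_vec lam 4) (line_vec lam 4) = r * s * m"
      using h4 by (simp add: herm_ip_coord line_vec_def K algebra_simps)
    then show ?thesis
      unfolding 4 cmat_eq_iff compl_proj_entry h K dunkl_res_def Let_def m_def[symmetric]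
      by (simp add: line_vec_def algebra_simps)
  qed
qed

lemma proj_mat_balanced:
  assumes "i \<in> {1..4}"
  shows "proj_mat (balanced lam) lam i = dunkl_res lam (cnj lam) r s i"
proof -
  let ?q = "sqrt (2 * norm lam * norm (1 - lam) * (1 + norm lam + norm (1 - lam)))"
  have "0 < ?q" by (rule real_sqrt_gt_zero[OF scale_pos[OF lam]])
  then have "complex_of_real ?q \<noteq> 0" by (simp only: of_real_eq_0_iff)
  then have "compl_proj (balanced lam) (line_vec lam i) = compl_proj (bal_metric lam) (line_vec lam i)"
    by (rule compl_proj_cong) (simp only: balanced_def vec_lambda_beta)
  then show ?thesis
    using proj_mat_line[OF pos_def_balanced[OF lam]] compl_proj_bal_metric[OF assms] by simp
qed

lemma H_lam_eq: "H_lam lam = balanced lam"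
  unfolding H_lam_def
proof (rule the_equality)
  have "(\<Sum>i\<in>{1..4::nat}. proj_mat (balanced lam) lam i) = mat 2"
    unfolding sum_1_4 using dunkl_res_sum[OF norm_relations nz] by (simp add: proj_mat_balanced)
  then show *: "pos_def_herm (balanced lam) \<and> det (balanced lam) = 1 \<and>
      (\<exists>c. (\<Sum>i\<in>{1..4::nat}. proj_mat (balanced lam) lam i) = mat c)"
    using pos_def_balanced[OF lam] det_balanced[OF lam] by blast
  show "H = balanced lam" if "pos_def_herm H \<and> det H = 1 \<and> (\<exists>c. (\<Sum>i\<in>{1..4::nat}. proj_mat H lam i) = mat c)" for H
    using that * balanced_metric_unique by blast
qed

lemma A_mat_eq: "i \<in> {1..4} \<Longrightarrow> A_mat lam i = dunkl_res lam (cnj lam) r s i"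
  by (simp add: A_mat_def H_lam_eq proj_mat_balanced)

lemma A_mat_sum: "A_mat lam 1 + A_mat lam 2 + A_mat lam 3 + A_mat lam 4 = mat 2"
  using dunkl_res_sum[OF norm_relations nz] by (simp add: A_mat_eq)

text \<open>Orthogonal projections are self-adjoint for their metric. This later removes the
  adjoints from the equation of a parallel form.\<close>

lemma A_mat_adjoint:
  assumes "i \<in> {1..4}"
  shows "cmat_adj (A_mat lam i) ** bal_metric lam = bal_metric lam ** A_mat lam i"
proof -
  let ?K = "bal_metric lam" and ?u = "line_vec lam i"
  have adj: "cnj (?K $ i $ j) = ?K $ j $ i" for i j :: 2
    using exhaust_2[of i] exhaust_2[of j] by (auto simp: bal_metric_entry)
  then have adj': "cmat_adj ?K = ?K" by (simp add: vec_eq_iff)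
  have h: "cnj (herm_ip ?K ?u ?u) = herm_ip ?K ?u ?u" by (rule herm_ip_sym[OF adj', symmetric])
  have A: "A_mat lam i = compl_proj ?K ?u" 
    unfolding A_mat_eq[OF assms] compl_proj_bal_metric[OF assms] ..
  then show ?thesis
    unfolding A using h adj by (simp add: cmat_eq_iff matrix_matrix_mult_def sum_2 compl_proj_entry algebra_simps add_divide_distrib
        diff_divide_distrib)
qed

end

section \<open>A trace that does not vanish for nonreal parameters\<close>

text \<open>The three matrices are the identity minus the rank-one matrices w v^T, x y^T and z u^T.
  The identity parts drop out, and the trace of a product of three rank-one matrices is a cyclic
  product of pairings.\<close>

lemma trace_rank_one_commutator:
  fixes x1 x2 y1 y2 z1 z2 :: complex
  shows "trace (mk_mat (1 - w1 * v1) (- (w1 * v2)) (- (w2 * v1)) (1 - w2 * v2) **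
    (mk_mat (1 - x1 * y1) (- (x1 * y2)) (- (x2 * y1)) (1 - x2 * y2) ** mk_mat (1 - z1 * u1) (- (z1 * u2)) (- (z2 * u1)) (1 - z2 * u2)
    - mk_mat (1 - z1 * u1) (- (z1 * u2)) (- (z2 * u1)) (1 - z2 * u2) ** mk_mat (1 - x1 * y1) (- (x1 * y2)) (- (x2 * y1)) (1 - x2 * y2)))
   = (v1 * z1 + v2 * z2) * (u1 * x1 + u2 * x2) * (y1 * w1 + y2 * w2)
    - (v1 * x1 + v2 * x2) * (y1 * z1 + y2 * z2) * (u1 * w1 + u2 * w2)"
  by (simp add: trace_def sum_2 matrix_matrix_mult_def algebra_simps)

text \<open>The pairings of the rank-one parts, simplified by the two relations. The two products in
  the numerator are exchanged by swapping l and k; when k is the conjugate of l and r, s are real,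
  they are therefore conjugate to each other.\<close>

lemma triple_trace:
  assumes rel: "r * r = l * k" "s * s = (1 - l) * (1 - k)" and nz: "r \<noteq> 0" "s \<noteq> 0" "1 + r + s \<noteq> 0"
  shows "trace (dunkl_res l k r s 3 ** (dunkl_res l k r s 4 ** dunkl_res l k r s 1 - dunkl_res l k r s 1 ** dunkl_res l k r s 4))
    = ((k + r) * (1 + s - l) * (r * s + l * (k - 1)) - (l + r) * (1 + s - k) * (r * s + k * (l - 1)))
       / (r * s * (1 + r + s) ^ 3)"
proof -
  define m where "m = 1 + r + s"
  have m: "m \<noteq> 0" using nz by (simp add: m_def)
  let ?v1 = "(m - r - k) / (s * m)" and ?v2 = "(r * m - r - l) / (s * m)"
    and ?y1 = "(k * m - r - k) / (r * s * m)" and ?y2 = "(r * m - k * (r + l)) / (r * s * m)"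
    and ?u1 = "- ((r + k) / (r * m))"
  have A: "dunkl_res l k r s 3 = mk_mat (1 - 1 * ?v1) (- (1 * ?v2)) (- (1 * ?v1)) (1 - 1 * ?v2)"
     "dunkl_res l k r s 4 = mk_mat (1 - l * ?y1) (- (l * ?y2)) (- (1 * ?y1)) (1 - 1 * ?y2)"
     "dunkl_res l k r s 1 = mk_mat (1 - 0 * ?u1) (- (0 * 1)) (- (1 * ?u1)) (1 - 1 * 1)"
    by (simp_all add: dunkl_res_def Let_def m_def)
  have vz: "r * m - r - l = r * s + l * (k - 1)" and uw: "r * m - (r + k) = r * s + k * (l - 1)"
    using rel(1) by (simp_all add: m_def algebra_simps)
  have vx: "?v1 * l + ?v2 * 1 = (l + r) / m"
  proof -
    have "(m - r - k) * l + (r * m - r - l) = s * (l + r) + (r * r - l * k)" by (simp add: m_def algebra_simps)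
    then have "(m - r - k) * l + (r * m - r - l) = s * (l + r)" using rel(1) by simp
    moreover have "?v1 * l + ?v2 * 1 = ((m - r - k) * l + (r * m - r - l)) / (s * m)" by (simp add: add_divide_distrib)
    ultimately show ?thesis using nz by simp
  qed
  have yw: "?y1 * 1 + ?y2 * 1 = (k + r) / (r * m)"
  proof -
    have "(k * m - r - k) + (r * m - k * (r + l)) = s * (k + r) + (r * r - l * k)" by (simp add: m_def algebra_simps)
    then have "(k * m - r - k) + (r * m - k * (r + l)) = s * (k + r)" using rel(1) by simp
    moreover have "?y1 * 1 + ?y2 * 1 = ((k * m - r - k) + (r * m - k * (r + l))) / (r * s * m)" by (simp add: add_divide_distrib)
    ultimately show ?thesis using nz by simp
  qed
  have yz: "?y2 = (1 + s - k) / (s * m)"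
  proof -
    have "r * m - k * (r + l) = r * (1 + s - k) + (r * r - l * k)" by (simp add: m_def algebra_simps)
    then have "r * m - k * (r + l) = r * (1 + s - k)" using rel(1) by simp
    then show ?thesis using nz by simp
  qed
  have ux: "?u1 * l + 1 = (1 + s - l) / m"
  proof -
    have "r * m - (r + k) * l = r * (1 + s - l) + (r * r - l * k)" by (simp add: m_def algebra_simps)
    then have "r * m - (r + k) * l = r * (1 + s - l)" using rel(1) by simp
    moreover have "?u1 * l + 1 = (r * m - (r + k) * l) / (r * m)" using nz m by (simp add: diff_divide_distrib)
    ultimately show ?thesis using nz by simp
  qed
  have uw': "?u1 + 1 = (r * s + k * (l - 1)) / (r * m)"
    unfolding uw[symmetric] using nz m by (simp add: diff_divide_distrib add_divide_distrib)
  have frac: "a / (s * m) * (b / m) * (c / (r * m)) - d / m * (e / (s * m)) * (f / (r * m))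
      = (c * b * a - d * e * f) / (r * s * m ^ 3)" for a b c d e f
    by (simp add: power3_eq_cube diff_divide_distrib mult_ac)
  have "trace (dunkl_res l k r s 3 ** (dunkl_res l k r s 4 ** dunkl_res l k r s 1 - dunkl_res l k r s 1 ** dunkl_res l k r s 4))
    = ?v2 * (?u1 * l + 1) * (?y1 * 1 + ?y2 * 1) - (?v1 * l + ?v2 * 1) * ?y2 * (?u1 + 1)"
    unfolding A trace_rank_one_commutator by simp
  also have "\<dots> = (r * s + l * (k - 1)) / (s * m) * ((1 + s - l) / m) * ((k + r) / (r * m))
     - (l + r) / m * ((1 + s - k) / (s * m)) * ((r * s + k * (l - 1)) / (r * m))"
    by (subst vx, subst yw, subst ux, subst uw', subst yz, subst vz) (rule refl)
  also have "\<dots> = ((k + r) * (1 + s - l) * (r * s + l * (k - 1)) - (l + r) * (1 + s - k) * (r * s + k * (l - 1))) / (r * s * m ^ 3)"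
    by (rule frac)
  finally show ?thesis by (simp add: m_def)
qed

text \<open>Each squared factor splits into one of l, 1 - k, k (1 - l) times an expression symmetric
  in l and k, and these prefactors multiply to r^2 s^2. The square is thus symmetric in l and k,
  hence real when they are conjugate and r, s are real, and its sign can be read off.\<close>

lemma triple_product_square:
  fixes l k r s :: complex
  assumes rel: "r * r = l * k" "s * s = (1 - l) * (1 - k)"
  shows "((l + r) * (1 + s - k) * (r * s + k * (l - 1)))\<^sup>2
    = (r * r) * (s * s) * ((l + k + 2 * r) * (2 - (l + k) + 2 * s) * (l * (1 - k) + k * (1 - l) - 2 * r * s))"
proof -
  have a: "(l + r)\<^sup>2 = l * (l + k + 2 * r)"
    using rel by (simp add: power2_eq_square algebra_simps)
  have "(1 + s - k)\<^sup>2 = (1 - k)\<^sup>2 + 2 * s * (1 - k) + s * s" by (simp add: power2_eq_square algebra_simps)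
  then have b: "(1 + s - k)\<^sup>2 = (1 - k) * (2 - (l + k) + 2 * s)"
    unfolding rel by (simp add: power2_eq_square algebra_simps)
  have "(r * s + k * (l - 1))\<^sup>2 = (r * r) * (s * s) + 2 * r * s * k * (l - 1) + k * k * (l - 1) * (l - 1)"
    by (simp add: power2_eq_square algebra_simps)
  then have c: "(r * s + k * (l - 1))\<^sup>2 = k * (1 - l) * (l * (1 - k) + k * (1 - l) - 2 * r * s)"
    unfolding rel by (simp add: algebra_simps)
  show ?thesis unfolding power_mult_distrib a b c unfolding rel by (simp add: mult_ac)
qed

text \<open>The numerator of the trace is cnj P - P. The square of P is a negative real number: a
  nonreal number has modulus strictly above the absolute value of its real part, which makes two
  factors of the square positive and the third negative. So P is not real.\<close>

lemma trace_A_mat_nonzero: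
  assumes "Im lam \<noteq> 0"
  shows "trace (A_mat lam 3 ** (A_mat lam 4 ** A_mat lam 1 - A_mat lam 1 ** A_mat lam 4)) \<noteq> 0"
proof -
  have lam: "lam \<noteq> 0" "lam \<noteq> 1" using assms by auto
  define r where "r = norm lam"
  define s where "s = norm (1 - lam)"
  define P where "P = (lam + r) * (1 + s - cnj lam) * (complex_of_real r * s + cnj lam * (lam - 1))"
  have rel: "complex_of_real r * r = lam * cnj lam" "complex_of_real s * s = (1 - lam) * (1 - cnj lam)"
    unfolding r_def s_def by (rule norm_relations)+
  have nz: "complex_of_real r \<noteq> 0" "complex_of_real s \<noteq> 0" "1 + complex_of_real r + s \<noteq> 0"
    unfolding r_def s_def by (rule nz[OF lam])+
  have "(norm lam)\<^sup>2 = (Re lam)\<^sup>2 + (Im lam)\<^sup>2" by (rule cmod_power2)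
  then have "(Re lam)\<^sup>2 < r\<^sup>2" using assms by (simp add: r_def)
  then have r: "\<bar>Re lam\<bar> < r" using power2_less_imp_less[of "\<bar>Re lam\<bar>" "r"] by (simp add: r_def)
  have "(norm (1 - lam))\<^sup>2 = (Re (1 - lam))\<^sup>2 + (Im (1 - lam))\<^sup>2" by (rule cmod_power2)
  then have "(1 - Re lam)\<^sup>2 < s\<^sup>2" using assms by (simp add: s_def)
  then have s: "\<bar>1 - Re lam\<bar> < s" using power2_less_imp_less[of "\<bar>1 - Re lam\<bar>" "s"] by (simp add: s_def)
  let ?z = "lam * (1 - cnj lam)"
  have nzz: "norm ?z = r * s"
  proof -
    have "norm (1 - cnj lam) = s" unfolding s_def using complex_mod_cnj[of "1 - lam"] by simp
    then show ?thesis by (simp add: norm_mult r_def)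
  qed
  have "(norm ?z)\<^sup>2 = (Re ?z)\<^sup>2 + (Im ?z)\<^sup>2" by (rule cmod_power2)
  moreover have "Im ?z = Im lam" by (simp add: algebra_simps)
  ultimately have "(Re ?z)\<^sup>2 < (r * s)\<^sup>2" using assms unfolding nzz by simp
  then have z: "\<bar>Re ?z\<bar> < r * s" using power2_less_imp_less[of "\<bar>Re ?z\<bar>" "r * s"] by (simp add: s_def r_def)
  define X where "X = (r * r) * (s * s) * ((2 * Re lam + 2 * r) * (2 - 2 * Re lam + 2 * s) * (2 * Re ?z - 2 * r * s))"
  have lk: "lam + cnj lam = of_real (2 * Re lam)" by (simp add: complex_add_cnj)
  have zz: "lam * (1 - cnj lam) + cnj lam * (1 - lam) = of_real (2 * Re ?z)"
    using complex_add_cnj[of ?z] by simp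
  have "P\<^sup>2 = of_real X"
    using triple_product_square[OF rel] unfolding P_def X_def lk zz
    by (simp del: times_complex.sel minus_complex.sel)
  moreover have "X < 0"
    unfolding X_def
  proof (intro mult_pos_neg mult_pos_pos)
    show "0 < r" "0 < s" using lam by (auto simp: r_def s_def)
    then show "0 < r" "0 < s" .
  qed (use r s z in auto)
  ultimately have "P \<noteq> cnj P"
  proof -
    assume a: "P\<^sup>2 = of_real X" "X < 0"
    show ?thesis
    proof
      assume "P = cnj P"
      then have "P * P = of_real ((norm P)\<^sup>2)" using complex_norm_square[of P] by simp
      then have "complex_of_real X = of_real ((norm P)\<^sup>2)" using a(1) by (simp add: power2_eq_square)
      then have "X = (norm P)\<^sup>2" by (simp only: of_real_eq_iff)
      then show False using a(2) by (metis not_less zero_le_power2)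
    qed
  qed
  moreover have "cnj P = (cnj lam + r) * (1 + s - lam) * (complex_of_real r * s + lam * (cnj lam - 1))"
    by (simp add: P_def)
  ultimately show ?thesis
    using triple_trace[OF rel nz] nz
    by (simp add: A_mat_eq[OF lam] r_def[symmetric] s_def[symmetric] P_def)
qed

section \<open>Parallel Hermitian forms on plane domains\<close>

definition cscale :: "complex \<Rightarrow> cmat \<Rightarrow> cmat" where
  "cscale c A = (\<chi> i j. c * A $ i $ j)"

lemma cscale_entry [simp]: "cscale c A $ i $ j = c * A $ i $ j"
  by (simp add: cscale_def)

lemma cmat_mult_entry: "((A::cmat) ** B) $ i $ j = A$i$1 * B$1$j + A$i$2 * B$2$j"
  by (simp add: matrix_matrix_mult_def sum_2)

lemma cscale_mult: "A ** cscale c B = cscale c (A ** B)" "cscale c A ** B = cscale c (A ** B)"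
  by (simp_all add: cmat_eq_iff cmat_mult_entry algebra_simps)

lemma cmat_adj_mult: "cmat_adj (A ** B) = cmat_adj B ** cmat_adj A"
  by (simp add: cmat_eq_iff cmat_mult_entry mult.commute)

lemma cmat_adj_adj [simp]: "cmat_adj (cmat_adj A) = A"
  by (simp add: cmat_eq_iff)

lemma norm_cmat_adj_le: "norm (cmat_adj A) \<le> 4 * norm A"
  using norm_cmat_le[of "cmat_adj A"] norm_entry_le[of A 1 1] norm_entry_le[of A 1 2]
    norm_entry_le[of A 2 1] norm_entry_le[of A 2 2] by simp

lemma norm_cscale_le: "norm (cscale c A) \<le> 4 * norm c * norm A"
proof -
  have "norm c * norm (A $ i $ j) \<le> norm c * norm A" for i j
    by (intro mult_left_mono norm_entry_le) auto
  from this[of 1 1] this[of 1 2] this[of 2 1] this[of 2 2] show ?thesis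
    using norm_cmat_le[of "cscale c A"] by (simp add: norm_mult)
qed

lemma bounded_linear_cmat_adj: "bounded_linear cmat_adj"
proof
  show "\<exists>K. \<forall>x. norm (cmat_adj x) \<le> norm x * K"
    using norm_cmat_adj_le by (intro exI[of _ 4]) (simp add: mult.commute)
qed (auto simp: cmat_eq_iff)

lemma continuous_on_cmat:
  fixes F :: "'a::topological_space \<Rightarrow> cmat"
  assumes "\<And>i j. continuous_on S (\<lambda>x. F x $ i $ j)" shows "continuous_on S F"
proof -
  have "F = (\<lambda>x. \<chi> i j. F x $ i $ j)" by (simp add: fun_eq_iff vec_eq_iff)
  moreover have "continuous_on S (\<lambda>x. \<chi> i j. F x $ i $ j)"
    by (intro continuous_on_vec_lambda assms)
  ultimately show ?thesis by simp
qed

lemma has_derivative_cmat: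
  fixes F :: "'a::real_normed_vector \<Rightarrow> cmat"
  assumes "\<And>i j. ((\<lambda>x. F x $ i $ j) has_derivative (\<lambda>h. F' h $ i $ j)) (at x within S)"
  shows "(F has_derivative F') (at x within S)"
proof -
  have lin: "bounded_linear (\<lambda>h. F' h $ i $ j)" for i j using assms by (rule has_derivative_bounded_linear)
  have "bounded_linear F'"
  proof
    show "F' (a + b) = F' a + F' b" for a b
      using linear_simps(1)[OF lin] by (simp add: vec_eq_iff)
    show "F' (r *\<^sub>R a) = r *\<^sub>R F' a" for r a
      using linear_simps(5)[OF lin] by (simp add: vec_eq_iff)
    have "\<exists>K. \<forall>h. norm (F' h $ i $ j) \<le> norm h * K" for i j
      using bounded_linear.bounded[OF lin] .
    then obtain K where K: "\<And>i j h. norm (F' h $ i $ j) \<le> norm h * K i j" by metis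
    show "\<exists>K. \<forall>h. norm (F' h) \<le> norm h * K"
    proof (intro exI allI)
      fix h show "norm (F' h) \<le> norm h * (K 1 1 + K 1 2 + K 2 1 + K 2 2)"
        using norm_cmat_le[of "F' h"] K[of h 1 1] K[of h 1 2] K[of h 2 1] K[of h 2 2] by (simp add: algebra_simps)
    qed
  qed
  moreover have "((\<lambda>y. (F y - F x - F' (y - x)) /\<^sub>R norm (y - x)) \<longlongrightarrow> 0) (at x within S)"
  proof (intro vec_tendstoI)
    fix i j
    show "((\<lambda>y. ((F y - F x - F' (y - x)) /\<^sub>R norm (y - x)) $ i $ j) \<longlongrightarrow> 0 $ i $ j) (at x within S)"
      using assms[of i j] unfolding has_derivative_at_within by simp
  qed
  ultimately show ?thesis unfolding has_derivative_at_within by simp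
qed

text \<open>The function exp (- 2 C (s - a)) |\<phi> s|^2 is nonincreasing, by the Cauchy-Schwarz
  inequality.\<close>

lemma gronwall_norm:
  fixes \<phi> :: "real \<Rightarrow> 'a::real_inner"
  assumes d: "\<And>s. s \<in> {a..b} \<Longrightarrow> (\<phi> has_vector_derivative \<phi>' s) (at s within {a..b})"
    and bnd: "\<And>s. s \<in> {a..b} \<Longrightarrow> norm (\<phi>' s) \<le> C * norm (\<phi> s)" and s: "s \<in> {a..b}"
  shows "norm (\<phi> s) \<le> exp (C * (s - a)) * norm (\<phi> a)"
proof -
  define \<psi> where "\<psi> s = exp (- (2 * C * (s - a))) * (\<phi> s \<bullet> \<phi> s)" for s
  have "\<psi> s \<le> \<psi> a"
  proof (rule DERIV_nonpos_imp_decreasing_open[where f = \<psi> and a = a and b = s])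
    show "a \<le> s" using s by simp
    show "continuous_on {a..s} \<psi>"
    proof -
      have "continuous_on {a..b} \<phi>"
        unfolding continuous_on_eq_continuous_within using has_vector_derivative_continuous[OF d] by blast
      then have "continuous_on {a..s} \<phi>" using s by (auto intro: continuous_on_subset)
      then show ?thesis unfolding \<psi>_def by (intro continuous_intros)
    qed
    fix x assume x: "a < x" "x < s"
    then have "at x within {a..b} = at x" using s by (intro at_within_Icc_at) auto
    then have dx: "(\<phi> has_vector_derivative \<phi>' x) (at x)" using d[of x] x s by simp
    have "((\<lambda>x. \<phi> x \<bullet> \<phi> x) has_derivative (\<lambda>h. \<phi> x \<bullet> (h *\<^sub>R \<phi>' x) + (h *\<^sub>R \<phi>' x) \<bullet> \<phi> x)) (at x)"
      using dx unfolding has_vector_derivative_def by (intro has_derivative_inner)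
    then have "((\<lambda>x. \<phi> x \<bullet> \<phi> x) has_real_derivative 2 * (\<phi> x \<bullet> \<phi>' x)) (at x)"
      unfolding has_field_derivative_def
      by (rule has_derivative_eq_rhs) (simp add: fun_eq_iff inner_commute)
    then have "(\<psi> has_real_derivative exp (- (2 * C * (x - a))) * (2 * (\<phi> x \<bullet> \<phi>' x) - 2 * C * (\<phi> x \<bullet> \<phi> x))) (at x)"
      unfolding \<psi>_def by (auto intro!: derivative_eq_intros simp: algebra_simps)
    moreover have "\<phi> x \<bullet> \<phi>' x \<le> C * (\<phi> x \<bullet> \<phi> x)"
    proof -
      have "\<phi> x \<bullet> \<phi>' x \<le> norm (\<phi> x) * norm (\<phi>' x)" by (rule norm_cauchy_schwarz)
      also have "\<dots> \<le> norm (\<phi> x) * (C * norm (\<phi> x))" using bnd[of x] x s by (intro mult_left_mono) auto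
      finally show ?thesis by (simp add: dot_square_norm power2_eq_square algebra_simps)
    qed
    then have "exp (- (2 * C * (x - a))) * (2 * (\<phi> x \<bullet> \<phi>' x) - 2 * C * (\<phi> x \<bullet> \<phi> x)) \<le> 0"
      by (intro mult_nonneg_nonpos) auto
    ultimately show "\<exists>y. (\<psi> has_real_derivative y) (at x) \<and> y \<le> 0" by blast
  qed
  then have "exp (- (2 * C * (s - a))) * (norm (\<phi> s))\<^sup>2 \<le> (norm (\<phi> a))\<^sup>2"
    by (simp add: \<psi>_def dot_square_norm)
  then have "(norm (\<phi> s))\<^sup>2 \<le> exp (2 * C * (s - a)) * (norm (\<phi> a))\<^sup>2"
    by (simp add: exp_minus pos_divide_le_eq inverse_eq_divide mult.commute)
  also have "\<dots> = (exp (C * (s - a)) * norm (\<phi> a))\<^sup>2"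
    by (simp add: power_mult_distrib exp_double[symmetric] mult.assoc)
  finally show ?thesis by (rule power2_le_imp_le) auto
qed

text \<open>The equation of \<open>preserves_herm_form\<close> for a connection d - B dt in one
  complex variable. The derivative is the real one, since conjugates of the tangent vector
  occur.\<close>

definition parallel_on :: "complex set \<Rightarrow> (complex \<Rightarrow> cmat) \<Rightarrow> (complex \<Rightarrow> cmat) \<Rightarrow> bool" where
  "parallel_on S B g \<longleftrightarrow> (\<forall>t\<in>S. cmat_adj (g t) = g t \<and>
     (g has_derivative (\<lambda>v. - (g t ** cscale v (B t) + cmat_adj (cscale v (B t)) ** g t))) (at t))"

lemma parallel_on_subset: "parallel_on S B g \<Longrightarrow> T \<subseteq> S \<Longrightarrow> parallel_on T B g"
  by (auto simp: parallel_on_def)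

lemma parallel_on_segment_deriv:
  assumes "parallel_on S B g" "closed_segment x y \<subseteq> S" "s \<in> {0..1}"
  defines "z \<equiv> x + of_real s * (y - x)"
  shows "((\<lambda>s. g (x + of_real s * (y - x))) has_vector_derivative
     - (g z ** cscale (y - x) (B z) + cmat_adj (cscale (y - x) (B z)) ** g z)) (at s within {0..1})"
proof -
  have "z \<in> closed_segment x y"
    using assms(3) by (auto simp: z_def closed_segment_def algebra_simps scaleR_conv_of_real intro!: exI[of _ s])
  then have g: "(g has_derivative (\<lambda>v. - (g z ** cscale v (B z) + cmat_adj (cscale v (B z)) ** g z))) (at z)"
    using assms(1,2) by (auto simp: parallel_on_def)
  have "((\<lambda>s. x + of_real s * (y - x)) has_derivative (\<lambda>h. of_real h * (y - x))) (at s within {0..1})"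
    by (auto intro!: derivative_eq_intros)
  from has_derivative_compose[OF this] g
  have "((\<lambda>s. g (x + of_real s * (y - x))) has_derivative
      (\<lambda>h. - (g z ** cscale (of_real h * (y - x)) (B z) + cmat_adj (cscale (of_real h * (y - x)) (B z)) ** g z)))
     (at s within {0..1})"
    by (simp add: z_def)
  moreover have "- (g z ** cscale (of_real h * (y - x)) (B z) + cmat_adj (cscale (of_real h * (y - x)) (B z)) ** g z)
     = h *\<^sub>R - (g z ** cscale (y - x) (B z) + cmat_adj (cscale (y - x) (B z)) ** g z)" for h
    by (simp add: cmat_eq_iff cmat_mult_entry scaleR_conv_of_real[where 'a = complex] algebra_simps)
  ultimately show ?thesis by (simp add: has_vector_derivative_def)
qed

text \<open>The constant is (8 + 4 * 8) * 4: a factor 8 for each product, 4 for the adjoint and 4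
  for \<open>cscale\<close>.\<close>

lemma norm_conn_le:
  "norm (- (g ** cscale v B + cmat_adj (cscale v B) ** g)) \<le> (160 * norm v * norm B) * norm g"
proof -
  have "norm (- (g ** cscale v B + cmat_adj (cscale v B) ** g))
     \<le> norm g * norm (cscale v B) * 8 + norm (cmat_adj (cscale v B)) * norm g * 8"
    using norm_triangle_ineq[of "g ** cscale v B" "cmat_adj (cscale v B) ** g"]
      norm_cmat_mult_le[of g "cscale v B"] norm_cmat_mult_le[of "cmat_adj (cscale v B)" g]
    unfolding norm_minus_cancel by linarith
  also have "\<dots> \<le> norm g * norm (cscale v B) * 8 + 4 * norm (cscale v B) * norm g * 8"
    by (intro add_mono mult_right_mono norm_cmat_adj_le) auto
  also have "\<dots> = 40 * norm g * norm (cscale v B)" by simp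
  also have "\<dots> \<le> 40 * norm g * (4 * norm v * norm B)" by (intro mult_left_mono norm_cscale_le) auto
  finally show ?thesis by (simp add: algebra_simps)
qed

text \<open>Along the segment the difference of the two forms solves a homogeneous linear equation,
  so Gronwall's inequality preserves its initial value 0.\<close>

lemma parallel_on_unique:
  assumes g: "parallel_on S B g" "parallel_on S B g'" and seg: "closed_segment x y \<subseteq> S"
    and B: "continuous_on S B" and eq: "g x = g' x"
  shows "g y = g' y"
proof -
  define \<phi> where "\<phi> s = g (x + of_real s * (y - x)) - g' (x + of_real s * (y - x))" for s
  obtain \<beta> where \<beta>: "\<And>t. t \<in> closed_segment x y \<Longrightarrow> norm (B t) \<le> \<beta>"
    using continuous_bounded_on_compact[OF compact_segment continuous_on_subset[OF B seg]] by blast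
  let ?D = "\<lambda>s. - (\<phi> s ** cscale (y - x) (B (x + of_real s * (y - x)))
        + cmat_adj (cscale (y - x) (B (x + of_real s * (y - x)))) ** \<phi> s)"
  have "norm (\<phi> 1) \<le> exp (160 * norm (y - x) * \<beta> * (1 - 0)) * norm (\<phi> 0)"
  proof (rule gronwall_norm[where \<phi>' = ?D and a = 0 and b = 1])
    fix s :: real assume s: "s \<in> {0..1}"
    have "?D s = - (g (x + of_real s * (y - x)) ** cscale (y - x) (B (x + of_real s * (y - x)))
         + cmat_adj (cscale (y - x) (B (x + of_real s * (y - x)))) ** g (x + of_real s * (y - x)))
         - (- (g' (x + of_real s * (y - x)) ** cscale (y - x) (B (x + of_real s * (y - x)))
         + cmat_adj (cscale (y - x) (B (x + of_real s * (y - x)))) ** g' (x + of_real s * (y - x))))"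
      by (simp add: cmat_eq_iff cmat_mult_entry \<phi>_def algebra_simps)
    then show "(\<phi> has_vector_derivative ?D s) (at s within {0..1})"
      unfolding \<phi>_def
      using has_vector_derivative_diff[OF parallel_on_segment_deriv[OF g(1) seg s] parallel_on_segment_deriv[OF g(2) seg s]]
      by (simp add: \<phi>_def)
    have "x + of_real s * (y - x) \<in> closed_segment x y"
      using s by (auto simp: closed_segment_def algebra_simps scaleR_conv_of_real intro!: exI[of _ s])
    then have "norm (B (x + of_real s * (y - x))) \<le> \<beta>" by (rule \<beta>)
    then show "norm (?D s) \<le> 160 * norm (y - x) * \<beta> * norm (\<phi> s)"
      using order_trans[OF norm_conn_le] by (meson mult_left_mono mult_right_mono norm_ge_zero zero_le_mult_iff zero_le_numeral)
  qed simp
  moreover have "\<phi> 0 = 0" using eq by (simp add: \<phi>_def)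
  ultimately show ?thesis by (simp add: \<phi>_def)
qed

section \<open>Gluing along cuts\<close>

definition entrywise_holomorphic :: "(complex \<Rightarrow> cmat) \<Rightarrow> complex set \<Rightarrow> bool" where
  "entrywise_holomorphic B S \<longleftrightarrow> (\<forall>i j. (\<lambda>t. B t $ i $ j) holomorphic_on S)"

lemma entrywise_holomorphic_continuous: "entrywise_holomorphic B S \<Longrightarrow> continuous_on S B"
  by (intro continuous_on_cmat holomorphic_on_imp_continuous_on) (auto simp: entrywise_holomorphic_def)

text \<open>The transport along the segment from \<open>x\<close> to \<open>y\<close> of the equation \<open>N' = - N B\<close>.\<close>

definition seg_conn :: "(complex \<Rightarrow> cmat) \<Rightarrow> complex \<Rightarrow> complex \<Rightarrow> real \<Rightarrow> cmat" where
  "seg_conn B x y s = cscale (- (y - x)) (B (x + of_real s * (y - x)))"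

definition seg_transport :: "(complex \<Rightarrow> cmat) \<Rightarrow> complex \<Rightarrow> complex \<Rightarrow> cmat" where
  "seg_transport B x y = transport (seg_conn B x y) 1"

definition star_region :: "complex \<Rightarrow> complex set \<Rightarrow> complex set" where
  "star_region c X = {t. closed_segment c t \<subseteq> X}"

lemma segment_point: "s \<in> {0..1} \<Longrightarrow> x + of_real s * (y - x) \<in> closed_segment x y" for x y :: complex
  by (auto simp: closed_segment_def algebra_simps scaleR_conv_of_real intro!: exI[of _ s])

lemma star_region_open:
  assumes "open X" shows "open (star_region c X)"
  unfolding open_dist
proof (intro ballI)
  fix t assume "t \<in> star_region c X"
  then have sub: "closed_segment c t \<subseteq> X" by (simp add: star_region_def)
  obtain e where e: "e > 0" "(\<Union>x\<in>closed_segment c t. ball x e) \<subseteq> X"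
    using compact_subset_open_imp_ball_epsilon_subset[OF compact_segment assms sub] .
  show "\<exists>e>0. \<forall>y. dist y t < e \<longrightarrow> y \<in> star_region c X"
  proof (intro exI[of _ e] conjI allI impI e(1))
    fix y assume y: "dist y t < e"
    show "y \<in> star_region c X"
      unfolding star_region_def
    proof (intro CollectI subsetI)
      fix z assume "z \<in> closed_segment c y"
      then obtain s where s: "0 \<le> s" "s \<le> 1" "z = (1 - s) *\<^sub>R c + s *\<^sub>R y"
        by (auto simp: closed_segment_def)
      let ?z = "(1 - s) *\<^sub>R c + s *\<^sub>R t"
      have "?z \<in> closed_segment c t" using s by (auto simp: closed_segment_def)
      moreover have "dist ?z z = s * dist y t"
        using s by (simp add: dist_norm scaleR_diff_right[symmetric] norm_minus_commute)
      then have "dist ?z z \<le> 1 * dist y t" using s(2) by (metis mult_right_mono zero_le_dist)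
      then have "z \<in> ball ?z e" using y by simp
      ultimately show "z \<in> X" using e(2) by blast
    qed
  qed
qed

lemma star_region_subset: "star_region c X \<subseteq> X"
  by (auto simp: star_region_def)

lemma star_region_segment:
  assumes "t \<in> star_region c X" shows "closed_segment c t \<subseteq> star_region c X"
proof
  fix z assume z: "z \<in> closed_segment c t"
  then have "closed_segment c z \<subseteq> closed_segment c t" by (simp add: subset_closed_segment)
  then show "z \<in> star_region c X" using assms by (auto simp: star_region_def)
qed

lemma star_region_center: "c \<in> X \<Longrightarrow> c \<in> star_region c X"
  by (simp add: star_region_def)

lemma seg_conn_continuous:
  assumes B: "entrywise_holomorphic B X"
  shows "continuous_on (star_region c X \<times> {0..1}) (\<lambda>(t, s). seg_conn B c t s)"
proof -
  have m: "continuous_on (star_region c X \<times> {0..1}) (\<lambda>p. c + of_real (snd p) * (fst p - c))"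
    "(\<lambda>p. c + of_real (snd p) * (fst p - c)) ` (star_region c X \<times> {0..1}) \<subseteq> X"
    using segment_point by (auto simp: star_region_def intro!: continuous_intros)
  have "continuous_on (star_region c X \<times> {0..1}) (\<lambda>p. B (c + of_real (snd p) * (fst p - c)))"
    by (rule continuous_on_compose2[OF entrywise_holomorphic_continuous[OF B] m])
  then have "continuous_on (star_region c X \<times> {0..1}) (\<lambda>p. seg_conn B c (fst p) (snd p))"
    by (intro continuous_on_cmat) (auto simp: seg_conn_def intro!: continuous_intros)
  then show ?thesis by (simp add: case_prod_unfold)
qed

lemma seg_conn_continuous_segment:
  assumes "entrywise_holomorphic B X" "t \<in> star_region c X"
  shows "continuous_on {0..1} (seg_conn B c t)"
proof -
  have m: "continuous_on {0..1} (\<lambda>s::real. (t, s))" "(\<lambda>s. (t, s)) ` {0..1} \<subseteq> star_region c X \<times> {0..1}"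
    using assms(2) by (auto intro!: continuous_intros)
  show ?thesis using continuous_on_compose2[OF seg_conn_continuous[OF assms(1)] m] by simp
qed

lemma seg_transport_holomorphic:
  assumes B: "entrywise_holomorphic B X" and X: "open X"
  shows "entrywise_holomorphic (seg_transport B c) (star_region c X)"
  unfolding entrywise_holomorphic_def seg_transport_def
proof (intro allI transport_holomorphic[OF star_region_open[OF X] seg_conn_continuous[OF B]])
  fix s :: real and i j assume s: "s \<in> {0..1}"
  have "(\<lambda>t. c + of_real s * (t - c)) ` star_region c X \<subseteq> X"
    using segment_point[OF s] by (auto simp: star_region_def)
  moreover have "(\<lambda>t. c + of_real s * (t - c)) holomorphic_on star_region c X"
    by (intro holomorphic_intros)
  ultimately have "(\<lambda>t. B (c + of_real s * (t - c)) $ i $ j) holomorphic_on star_region c X"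
    using B holomorphic_on_compose_gen[of "\<lambda>t. c + of_real s * (t - c)" "star_region c X" "\<lambda>t. B t $ i $ j" X]
    by (auto simp: entrywise_holomorphic_def comp_def)
  then show "(\<lambda>t. seg_conn B c t s $ i $ j) holomorphic_on star_region c X"
    by (auto simp: seg_conn_def intro!: holomorphic_intros)
qed auto

lemma picard_rescale:
  assumes "0 \<le> \<sigma>" "\<sigma> \<le> 1"
  shows "picard (\<lambda>s. \<sigma> *\<^sub>R b (\<sigma> * s)) k s = picard b k (\<sigma> * s)"
proof (induction k arbitrary: s)
  case (Suc k)
  have "picard (\<lambda>s. \<sigma> *\<^sub>R b (\<sigma> * s)) (Suc k) s
    = s *\<^sub>R integral {0..1} (\<lambda>x. \<sigma> *\<^sub>R (picard b k (\<sigma> * s * x) ** b (\<sigma> * s * x)))"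
    by (simp add: Suc cmat_mult_scaleR mult.assoc)
  then show ?case by (simp add: mult.commute)
qed simp

text \<open>Rescaling the iterates converts the time of the differential equation into a movement of
  the endpoint along its ray; this supplies the radial derivative in
  \<open>seg_transport_deriv\<close>.\<close>

lemma seg_transport_radial:
  assumes "0 \<le> \<sigma>" "\<sigma> \<le> 1"
  shows "seg_transport B c (c + of_real \<sigma> * (t - c)) = transport (seg_conn B c t) \<sigma>"
proof -
  have "seg_conn B c (c + of_real \<sigma> * (t - c)) = (\<lambda>s. \<sigma> *\<^sub>R seg_conn B c t (\<sigma> * s))"
    by (simp add: fun_eq_iff seg_conn_def cmat_eq_iff scaleR_conv_of_real[where 'a = complex] algebra_simps)
  then show ?thesis
    by (simp add: seg_transport_def transport_def picard_rescale[OF assms])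
qed

lemma seg_transport_refl [simp]: "seg_transport B c c = mat 1"
  using seg_transport_radial[of 0 B c c] by simp

text \<open>Since the transport is holomorphic in its endpoint, its derivative is determined by the radial direction.\<close>

lemma seg_transport_deriv:
  assumes B: "entrywise_holomorphic B X" and X: "open X" and t: "t \<in> star_region c X"
  shows "((\<lambda>t. seg_transport B c t $ i $ j) has_field_derivative - ((seg_transport B c t ** B t) $ i $ j)) (at t)"
proof -
  let ?D = "star_region c X" and ?N = "seg_transport B c"
  have oD: "open ?D" by (rule star_region_open[OF X])
  have hol: "entrywise_holomorphic ?N ?D" by (rule seg_transport_holomorphic[OF B X])
  have N: "((\<lambda>t. ?N t $ i $ j) has_field_derivative deriv (\<lambda>t. ?N t $ i $ j) t) (at t)" if "t \<in> ?D" for t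
    using hol that oD by (intro holomorphic_derivI[of _ ?D]) (auto simp: entrywise_holomorphic_def)
  have off: "deriv (\<lambda>t. ?N t $ i $ j) t = - ((?N t ** B t) $ i $ j)" if t: "t \<in> ?D" "t \<noteq> c" for t
  proof -
    let ?p = "\<lambda>\<sigma>. c + of_real \<sigma> * (t - c)"
    have p: "(?p has_vector_derivative (t - c)) (at 1 within {0..1})"
      unfolding has_vector_derivative_def
      by (auto intro!: derivative_eq_intros simp: scaleR_conv_of_real)
    have "((\<lambda>t. ?N t $ i $ j) \<circ> ?p has_vector_derivative (t - c) * deriv (\<lambda>t. ?N t $ i $ j) t) (at 1 within {0..1})"
      using field_vector_diff_chain_within[OF p, of "\<lambda>t. ?N t $ i $ j"] has_field_derivative_at_within[OF N[OF t(1)]]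
      by simp
    then have d1: "((\<lambda>\<sigma>. ?N (?p \<sigma>) $ i $ j) has_vector_derivative (t - c) * deriv (\<lambda>t. ?N t $ i $ j) t) (at 1 within {0..1})"
      by (simp add: comp_def)
    have bl: "bounded_linear (\<lambda>A::cmat. A $ i $ j)"
      by (intro bounded_linear_compose[OF bounded_linear_vec_nth bounded_linear_vec_nth])
    have "(transport (seg_conn B c t) has_vector_derivative transport (seg_conn B c t) 1 ** seg_conn B c t 1) (at 1 within {0..1})"
      by (rule transport_ode[OF seg_conn_continuous_segment[OF B t(1)]]) simp
    from bounded_linear.has_vector_derivative[OF bl this]
    have "((\<lambda>\<sigma>. transport (seg_conn B c t) \<sigma> $ i $ j) has_vector_derivative (?N t ** seg_conn B c t 1) $ i $ j) (at 1 within {0..1})"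
      by (simp add: seg_transport_def)
    then have d2: "((\<lambda>\<sigma>. ?N (?p \<sigma>) $ i $ j) has_vector_derivative (?N t ** seg_conn B c t 1) $ i $ j) (at 1 within {0..1})"
      by (rule has_vector_derivative_transform[rotated 2]) (simp_all add: seg_transport_radial)
    have "at 1 within {0..1::real} \<noteq> bot" by (simp add: trivial_limit_within islimpt_Icc)
    from vector_derivative_unique_within[OF this d1 d2]
    have "(t - c) * deriv (\<lambda>t. ?N t $ i $ j) t = (?N t ** seg_conn B c t 1) $ i $ j" .
    also have "\<dots> = (t - c) * - ((?N t ** B t) $ i $ j)"
      by (simp add: seg_conn_def cmat_mult_entry algebra_simps)
    finally have eq: "(t - c) * deriv (\<lambda>t. ?N t $ i $ j) t = (t - c) * - ((?N t ** B t) $ i $ j)" .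
    show ?thesis by (rule mult_left_cancel[THEN iffD1, OF _ eq]) (use t(2) in simp)
  qed
  have "deriv (\<lambda>t. ?N t $ i $ j) t = - ((?N t ** B t) $ i $ j)"
  proof (cases "t = c")
    \<comment> \<open>At the centre there is no radial direction. Both sides are continuous there
      and agree at all other points nearby.\<close>
    case True
    have h1: "deriv (\<lambda>t. ?N t $ i $ j) holomorphic_on ?D"
      using hol oD by (intro holomorphic_deriv) (auto simp: entrywise_holomorphic_def)
    have h2: "(\<lambda>t. - ((?N t ** B t) $ i $ j)) holomorphic_on ?D"
      unfolding cmat_mult_entry using hol holomorphic_on_subset[OF _ star_region_subset] B
      by (intro holomorphic_intros) (auto simp: entrywise_holomorphic_def)
    have l1: "deriv (\<lambda>t. ?N t $ i $ j) \<midarrow>c\<rightarrow> deriv (\<lambda>t. ?N t $ i $ j) c"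
      and l2: "(\<lambda>t. - ((?N t ** B t) $ i $ j)) \<midarrow>c\<rightarrow> - ((?N c ** B c) $ i $ j)"
      using holomorphic_on_imp_continuous_on[OF h1] holomorphic_on_imp_continuous_on[OF h2] t True oD
      by (auto simp: continuous_on_eq_continuous_at isCont_def)
    have "\<forall>\<^sub>F t in at c. t \<in> ?D" using t True oD by (intro eventually_at_in_open') auto
    then have "\<forall>\<^sub>F t in at c. t \<in> ?D \<and> t \<noteq> c" by (simp add: eventually_conj_iff eventually_neq_at_within)
    then have "\<forall>\<^sub>F t in at c. deriv (\<lambda>t. ?N t $ i $ j) t = - ((?N t ** B t) $ i $ j)"
      by (rule eventually_mono) (use off in auto)
    from Lim_transform_eventually[OF l1 this] l2
    show ?thesis using True by (simp add: LIM_unique)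
  qed (use off t in auto)
  then show ?thesis using N[OF t] by simp
qed

text \<open>Differentiating N^* g0 N with N' = - N B produces exactly the two terms of the parallel
  equation.\<close>

lemma seg_transport_parallel:
  assumes B: "entrywise_holomorphic B X" and X: "open X" and g0: "cmat_adj g0 = g0"
  shows "parallel_on (star_region c X) B (\<lambda>t. cmat_adj (seg_transport B c t) ** g0 ** seg_transport B c t)"
  unfolding parallel_on_def
proof (intro ballI conjI)
  fix t assume t: "t \<in> star_region c X"
  let ?N = "seg_transport B c"
  show "cmat_adj (cmat_adj (?N t) ** g0 ** ?N t) = cmat_adj (?N t) ** g0 ** ?N t"
    by (simp add: cmat_adj_mult g0 matrix_mul_assoc)
  have N: "(?N has_derivative (\<lambda>v. - cscale v (?N t ** B t))) (at t)"
  proof (rule has_derivative_cmat)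
    fix i j
    show "((\<lambda>x. ?N x $ i $ j) has_derivative (\<lambda>h. (- cscale h (?N t ** B t)) $ i $ j)) (at t)"
      using seg_transport_deriv[OF B X t, of i j] unfolding has_field_derivative_def
      by (rule has_derivative_eq_rhs) (simp add: fun_eq_iff)
  qed
  have N': "((\<lambda>x. cmat_adj (?N x)) has_derivative (\<lambda>v. cmat_adj (- cscale v (?N t ** B t)))) (at t)"
    by (rule bounded_linear.has_derivative[OF bounded_linear_cmat_adj N])
  have "((\<lambda>x. cmat_adj (?N x) ** g0 ** ?N x) has_derivative
     (\<lambda>v. (cmat_adj (?N t) ** g0) ** (- cscale v (?N t ** B t))
        + (cmat_adj (?N t) ** 0 + cmat_adj (- cscale v (?N t ** B t)) ** g0) ** ?N t)) (at t)"
    by (intro bounded_bilinear.FDERIV[OF bounded_bilinear_cmat_mult] N N' has_derivative_const)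
  then show "((\<lambda>x. cmat_adj (?N x) ** g0 ** ?N x) has_derivative
     (\<lambda>v. - ((cmat_adj (?N t) ** g0 ** ?N t) ** cscale v (B t) + cmat_adj (cscale v (B t)) ** (cmat_adj (?N t) ** g0 ** ?N t)))) (at t)"
    by (rule has_derivative_eq_rhs)
       (simp add: fun_eq_iff cmat_eq_iff cmat_mult_entry algebra_simps)
qed

lemma parallel_on_transport:
  assumes B: "entrywise_holomorphic B X" and X: "open X" and g: "parallel_on X B g" and t: "closed_segment c t \<subseteq> X"
  shows "g t = cmat_adj (seg_transport B c t) ** g c ** seg_transport B c t"
proof (rule parallel_on_unique)
  have c: "c \<in> X" using t by auto
  show "parallel_on (star_region c X) B g" by (rule parallel_on_subset[OF g star_region_subset])
  show "parallel_on (star_region c X) B (\<lambda>t. cmat_adj (seg_transport B c t) ** g c ** seg_transport B c t)"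
    using g c by (intro seg_transport_parallel[OF B X]) (simp add: parallel_on_def)
  show "closed_segment c t \<subseteq> star_region c X" using t by (intro star_region_segment) (simp add: star_region_def)
  show "continuous_on (star_region c X) B"
    by (rule continuous_on_subset[OF entrywise_holomorphic_continuous[OF B] star_region_subset])
  show "g c = cmat_adj (seg_transport B c c) ** g c ** seg_transport B c c"
    by (simp add: cmat_eq_iff cmat_mult_entry mat_def)
qed

text \<open>Gluing across the cuts: \<open>c\<close> is a base point from which the points of \<open>P\<close> are seen in different directions, and the
  plane is cut along the rays behind the points of \<open>P\<close>. Each cut is crossed inside a narrow sector with apex in \<open>P\<close>.\<close>

definition sep_base :: "real \<Rightarrow> complex \<Rightarrow> complex set \<Rightarrow> bool" where
  "sep_base \<epsilon> c P \<longleftrightarrow> 0 < \<epsilon> \<and> c \<notin> P \<and>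
     (\<forall>p\<in>P. \<forall>p'\<in>P. p' \<noteq> p \<longrightarrow> \<epsilon> * Re ((p' - c) / (p - c)) < \<bar>Im ((p' - c) / (p - c))\<bar>)"

text \<open>In the affine coordinate that sends \<open>c\<close> to 0 and \<open>p\<close> to 1 this
  is the point 2 + i \<sigma>. Opposite signs of \<open>\<sigma>\<close> give points on the two
  sides of the cut behind \<open>p\<close>.\<close>

definition cut_point :: "complex \<Rightarrow> complex \<Rightarrow> real \<Rightarrow> complex" where
  "cut_point c p \<sigma> = c + (p - c) * Complex 2 \<sigma>"

text \<open>Continuing \<open>g0\<close> from \<open>c\<close> to \<open>q\<close> and then across
  the cut must give the same as continuing it directly to \<open>q'\<close>. This is invariance
  under one turn around \<open>p\<close>, expressed through transports along segments.\<close>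

definition glue_cond :: "(complex \<Rightarrow> cmat) \<Rightarrow> complex \<Rightarrow> real \<Rightarrow> complex \<Rightarrow> cmat \<Rightarrow> bool" where
  "glue_cond B c \<sigma> p g0 \<longleftrightarrow>
     (let q = cut_point c p \<sigma>; q' = cut_point c p (- \<sigma>); N = seg_transport B in
       cmat_adj (N c q ** N q q') ** g0 ** (N c q ** N q q') = cmat_adj (N c q') ** g0 ** N c q')"

text \<open>In the coordinate with \<open>c\<close> at 0 and \<open>p\<close> at 1, the sector of
  slope \<open>\<epsilon>\<close> with apex 1 around the ray behind \<open>p\<close>. The same
  \<open>\<epsilon>\<close> in \<open>sep_base\<close> keeps the other points of \<open>P\<close>
  and their cuts away from it.\<close>

definition cut_sector :: "real \<Rightarrow> complex \<Rightarrow> complex \<Rightarrow> complex set" where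
  "cut_sector \<epsilon> c p = {t. \<bar>Im ((t - c) / (p - c))\<bar> < \<epsilon> * (Re ((t - c) / (p - c)) - 1)}"

lemma affine_ratio:
  fixes c d x y :: complex
  assumes "u + v = 1"
  shows "(u *\<^sub>R x + v *\<^sub>R y - c) / d = u *\<^sub>R ((x - c) / d) + v *\<^sub>R ((y - c) / d)"
proof -
  have "u *\<^sub>R x + v *\<^sub>R y - c = u *\<^sub>R (x - c) + v *\<^sub>R (y - c)"
    using assms by (simp add: scaleR_diff_right scaleR_left_distrib[symmetric] algebra_simps)
  then show ?thesis by (simp add: add_divide_distrib scaleR_conv_of_real)
qed

lemma cut_sector_convex: "convex (cut_sector \<epsilon> c p)"
proof (rule convexI)
  fix x y and u v :: real
  assume xy: "x \<in> cut_sector \<epsilon> c p" "y \<in> cut_sector \<epsilon> c p" and uv: "0 \<le> u" "0 \<le> v" "u + v = 1"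
  define X where "X = (x - c) / (p - c)"
  define Y where "Y = (y - c) / (p - c)"
  have a: "\<bar>Im X\<bar> < \<epsilon> * (Re X - 1)" "\<bar>Im Y\<bar> < \<epsilon> * (Re Y - 1)"
    using xy by (auto simp: cut_sector_def X_def Y_def)
  have "\<bar>u * Im X + v * Im Y\<bar> \<le> u * \<bar>Im X\<bar> + v * \<bar>Im Y\<bar>"
    using uv abs_triangle_ineq[of "u * Im X" "v * Im Y"] by (simp add: abs_mult)
  also have "\<dots> < u * (\<epsilon> * (Re X - 1)) + v * (\<epsilon> * (Re Y - 1))"
  proof (cases "u = 0")
    case True then show ?thesis using uv a by simp
  next
    case False
    then show ?thesis using uv a by (intro add_less_le_mono mult_strict_left_mono mult_left_mono) auto
  qed
  also have "\<dots> = \<epsilon> * (u * Re X + v * Re Y - (u + v))" by (simp add: algebra_simps)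
  finally show "u *\<^sub>R x + v *\<^sub>R y \<in> cut_sector \<epsilon> c p"
    using uv(3) by (simp add: cut_sector_def affine_ratio X_def Y_def)
qed

lemma cut_sector_open:
  assumes "p \<noteq> c" shows "open (cut_sector \<epsilon> c p)"
  unfolding cut_sector_def using assms by (intro open_Collect_less continuous_intros) auto

lemma half_plane_convex:
  "convex {t. 0 < Im ((t - c) / (p - c))}" "convex {t. Im ((t - c) / (p - c)) < 0}"
proof -
  show "convex {t. 0 < Im ((t - c) / (p - c))}"
  proof (rule convexI)
    fix x y and u v :: real
    assume "x \<in> {t. 0 < Im ((t - c) / (p - c))}" "y \<in> {t. 0 < Im ((t - c) / (p - c))}" "0 \<le> u" "0 \<le> v" "u + v = 1"
    moreover from this have "0 < u * Im ((x - c) / (p - c)) + v * Im ((y - c) / (p - c))"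
      by (cases "u = 0") (auto intro!: add_pos_nonneg)
    ultimately show "u *\<^sub>R x + v *\<^sub>R y \<in> {t. 0 < Im ((t - c) / (p - c))}"
      by (simp add: affine_ratio del: Im_divide)
  qed
  show "convex {t. Im ((t - c) / (p - c)) < 0}"
  proof (rule convexI)
    fix x y and u v :: real
    assume "x \<in> {t. Im ((t - c) / (p - c)) < 0}" "y \<in> {t. Im ((t - c) / (p - c)) < 0}" "0 \<le> u" "0 \<le> v" "u + v = 1"
    moreover from this have "u * Im ((x - c) / (p - c)) + v * Im ((y - c) / (p - c)) < 0"
      by (cases "u = 0") (auto intro!: add_neg_nonpos mult_pos_neg mult_nonneg_nonpos)
    ultimately show "u *\<^sub>R x + v *\<^sub>R y \<in> {t. Im ((t - c) / (p - c)) < 0}"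
      by (simp add: affine_ratio del: Im_divide)
  qed
qed

context
  fixes \<epsilon> c P
  assumes sep: "sep_base \<epsilon> c P"
begin

lemma cut_sector_avoids:
  assumes "p \<in> P" shows "cut_sector \<epsilon> c p \<subseteq> - P"
proof
  fix t assume t: "t \<in> cut_sector \<epsilon> c p"
  show "t \<in> - P"
  proof
    assume "t \<in> P"
    show False
    proof (cases "t = p")
      case True
      then show False using t assms sep by (auto simp: cut_sector_def sep_base_def split: if_splits)
    next
      case False
      then have "\<epsilon> * Re ((t - c) / (p - c)) < \<bar>Im ((t - c) / (p - c))\<bar>"
        using sep assms \<open>t \<in> P\<close> by (simp add: sep_base_def del: Im_divide Re_divide)
      moreover have "\<bar>Im ((t - c) / (p - c))\<bar> < \<epsilon> * Re ((t - c) / (p - c)) - \<epsilon>"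
        using t by (simp add: cut_sector_def algebra_simps del: Im_divide Re_divide)
      ultimately show False using sep by (simp add: sep_base_def)
    qed
  qed
qed

lemma outside_star:
  assumes "t \<notin> star_region c (- P)" "t \<notin> P"
  obtains p s where "p \<in> P" "1 < s" "t = c + of_real s * (p - c)"
proof -
  obtain p where p: "p \<in> P" "p \<in> closed_segment c t" using assms by (auto simp: star_region_def)
  then obtain u where u: "0 \<le> u" "u \<le> 1" "p = (1 - u) *\<^sub>R c + u *\<^sub>R t" by (auto simp: closed_segment_def)
  have c: "c \<notin> P" using sep by (simp add: sep_base_def)
  have "u \<noteq> 0" using u p c by auto
  moreover have "u \<noteq> 1" using u p assms by auto
  ultimately have u1: "0 < u" "u < 1" using u by auto
  have "p - c = of_real u * (t - c)" using u(3) by (simp add: scaleR_conv_of_real algebra_simps)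
  then have "t = c + of_real (1 / u) * (p - c)" using u1 by simp
  then show ?thesis using that[of p "1 / u"] p(1) u1 by simp
qed

text \<open>The inequality in \<open>sep_base\<close> is homogeneous along rays from
  \<open>c\<close>, and the sector with apex \<open>p\<close> lies in the sector of the same slope
  with apex \<open>c\<close>. Hence the sector of \<open>p\<close> meets no cut but its own.\<close>

lemma sector_ray_unique:
  assumes "p \<in> P" "p' \<in> P" "t \<in> cut_sector \<epsilon> c p" "t = c + of_real s * (p' - c)" "0 < s"
  shows "p' = p"
proof (rule ccontr)
  assume "p' \<noteq> p"
  define \<eta> where "\<eta> = (p' - c) / (p - c)"
  have \<eta>: "\<epsilon> * Re \<eta> < \<bar>Im \<eta>\<bar>" using sep assms \<open>p' \<noteq> p\<close> by (simp add: sep_base_def \<eta>_def del: Im_divide Re_divide)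
  have "(t - c) / (p - c) = of_real s * \<eta>" by (simp add: assms(4) \<eta>_def)
  then have "s * \<bar>Im \<eta>\<bar> < \<epsilon> * (s * Re \<eta> - 1)"
    using assms(3,5) by (simp add: cut_sector_def abs_mult del: Im_divide Re_divide)
  also have "\<dots> < s * (\<epsilon> * Re \<eta>)" using sep by (simp add: sep_base_def algebra_simps)
  finally show False using \<eta> assms(5) by simp
qed

lemma sector_in_star:
  assumes p: "p \<in> P" and t: "t \<in> cut_sector \<epsilon> c p"
  shows "t \<in> star_region c (- P) \<longleftrightarrow> Im ((t - c) / (p - c)) \<noteq> 0"
proof
  have pc: "p \<noteq> c" using sep p by (auto simp: sep_base_def)
  assume st: "t \<in> star_region c (- P)"
  show "Im ((t - c) / (p - c)) \<noteq> 0"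
  proof
    assume im: "Im ((t - c) / (p - c)) = 0"
    define s where "s = Re ((t - c) / (p - c))"
    have "(t - c) / (p - c) = of_real s" using im by (simp add: complex_eq_iff s_def del: Im_divide Re_divide)
    then have tc: "t = c + of_real s * (p - c)" using pc by (simp add: field_simps)
    have "0 < \<epsilon> * (s - 1)" using t im by (simp add: cut_sector_def s_def del: Im_divide Re_divide)
    then have s: "1 < s" using sep by (simp add: sep_base_def zero_less_mult_iff)
    have "p \<in> closed_segment c t"
      unfolding closed_segment_def using s
      by (intro CollectI exI[of _ "1 / s"]) (simp add: tc scaleR_conv_of_real algebra_simps)
    then show False using st p by (auto simp: star_region_def)
  qed
next
  assume im: "Im ((t - c) / (p - c)) \<noteq> 0"
  have pc: "p \<noteq> c" using sep p by (auto simp: sep_base_def)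
  show "t \<in> star_region c (- P)"
  proof (rule ccontr)
    assume "t \<notin> star_region c (- P)"
    moreover have "t \<notin> P" using cut_sector_avoids[OF p] t by auto
    ultimately obtain p' s where p': "p' \<in> P" "1 < s" "t = c + of_real s * (p' - c)" by (rule outside_star)
    then have "p' = p" using sector_ray_unique[OF p p'(1) t p'(3)] by simp
    then have "(t - c) / (p - c) = of_real s" using p'(3) pc by simp
    then show False using im by (simp del: Im_divide)
  qed
qed

lemma ray_in_sector:
  assumes "p \<in> P" "1 < s" shows "c + of_real s * (p - c) \<in> cut_sector \<epsilon> c p"
  using assms sep by (auto simp: cut_sector_def sep_base_def)

lemma cut_point_ratio: "p \<in> P \<Longrightarrow> (cut_point c p \<sigma> - c) / (p - c) = Complex 2 \<sigma>"
  using sep by (auto simp: cut_point_def sep_base_def)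

lemma cut_point_in_sector:
  assumes "p \<in> P" "\<bar>\<sigma>\<bar> < \<epsilon>" shows "cut_point c p \<sigma> \<in> cut_sector \<epsilon> c p"
  using assms by (simp add: cut_sector_def cut_point_ratio del: Im_divide Re_divide)

lemma cut_point_in_star:
  assumes "p \<in> P" "\<bar>\<sigma>\<bar> < \<epsilon>" "\<sigma> \<noteq> 0" shows "cut_point c p \<sigma> \<in> star_region c (- P)"
  using sector_in_star[OF assms(1) cut_point_in_sector[OF assms(1,2)]] assms
  by (simp add: cut_point_ratio del: Im_divide)

lemma sector_segment:
  assumes "p \<in> P" "x \<in> cut_sector \<epsilon> c p" "y \<in> cut_sector \<epsilon> c p"
  shows "closed_segment x y \<subseteq> cut_sector \<epsilon> c p" "closed_segment x y \<subseteq> - P"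
  using closed_segment_subset[OF assms(2,3) cut_sector_convex] cut_sector_avoids[OF assms(1)] by auto

text \<open>A point off the cuts is visible from \<open>c\<close>; a point on a cut is visible from
  a cut point of its sector, which in turn is visible from \<open>c\<close>. A parallel form that
  vanishes at \<open>c\<close> therefore vanishes everywhere.\<close>

lemma parallel_nonzero_base:
  assumes fin: "finite P" and B: "entrywise_holomorphic B (- P)" and g: "parallel_on (- P) B g" and t: "t \<in> - P" "g t \<noteq> 0"
  shows "g c \<noteq> 0"
proof
  have X: "open (- P)" using fin by (simp add: finite_imp_closed open_Compl)
  have \<epsilon>: "0 < \<epsilon>" using sep by (simp add: sep_base_def)
  note tr = parallel_on_transport[OF B X g]
  assume c0: "g c = 0"
  have D0: "g t = 0" if "t \<in> star_region c (- P)" for t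
    using tr[of c t] that c0 by (simp add: star_region_def cmat_eq_iff cmat_mult_entry)
  show False
  proof (cases "t \<in> star_region c (- P)")
    case False
    then obtain p s where p: "p \<in> P" "1 < s" "t = c + of_real s * (p - c)" using outside_star t(1) by auto
    let ?q = "cut_point c p (\<epsilon> / 2)"
    have "t \<in> cut_sector \<epsilon> c p" using ray_in_sector p by simp
    moreover have "?q \<in> cut_sector \<epsilon> c p" "?q \<in> star_region c (- P)"
      using cut_point_in_sector[OF p(1)] cut_point_in_star[OF p(1)] \<epsilon> by auto
    ultimately have "closed_segment ?q t \<subseteq> - P" "g ?q = 0" using sector_segment(2)[OF p(1)] D0 by auto
    from tr[OF this(1)] this(2) show False using t(2) by (simp add: cmat_eq_iff cmat_mult_entry)
  qed (use D0 t in auto)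
qed

text \<open>For the converse, the form transported from \<open>c\<close> over the star region is
  glued to forms transported from the points \<open>?q p\<close> over the sectors. Each half of a
  sector is convex and contains one of the two cut points; there the two forms agree, by
  construction on one side and by \<open>glue_cond\<close> on the other, and uniqueness spreads the
  agreement over the half.\<close>

lemma parallel_iff_glue:
  assumes fin: "finite P" and B: "entrywise_holomorphic B (- P)" and \<sigma>: "0 < \<sigma>" "\<sigma> < \<epsilon>"
  shows "(\<exists>g. parallel_on (- P) B g \<and> (\<exists>t\<in>- P. g t \<noteq> 0)) \<longleftrightarrow>
    (\<exists>g0. cmat_adj g0 = g0 \<and> g0 \<noteq> 0 \<and> (\<forall>p\<in>P. glue_cond B c \<sigma> p g0))"
proof
  have X: "open (- P)" using fin by (simp add: finite_imp_closed open_Compl)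
  have cX: "c \<in> - P" using sep by (simp add: sep_base_def)
  let ?q = "\<lambda>p. cut_point c p \<sigma>" and ?q' = "\<lambda>p. cut_point c p (- \<sigma>)" and ?N = "seg_transport B"
  let ?D = "star_region c (- P)" and ?U = "cut_sector \<epsilon> c"
  have q: "?q p \<in> ?D" "?q p \<in> ?U p" "?q' p \<in> ?D" "?q' p \<in> ?U p" if "p \<in> P" for p
    using \<sigma> cut_point_in_star[OF that] cut_point_in_sector[OF that] by auto
  {
    assume "\<exists>g. parallel_on (- P) B g \<and> (\<exists>t\<in>- P. g t \<noteq> 0)"
    then obtain g t where g: "parallel_on (- P) B g" and t: "t \<in> - P" "g t \<noteq> 0" by blast
    note tr = parallel_on_transport[OF B X g]
    have "g c \<noteq> 0" by (rule parallel_nonzero_base[OF fin B g t])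
    moreover have "glue_cond B c \<sigma> p (g c)" if p: "p \<in> P" for p
    proof -
      have "g (?q p) = cmat_adj (?N c (?q p)) ** g c ** ?N c (?q p)"
        using q(1)[OF p] by (intro tr) (simp add: star_region_def)
      moreover have "g (?q' p) = cmat_adj (?N c (?q' p)) ** g c ** ?N c (?q' p)"
        using q(3)[OF p] by (intro tr) (simp add: star_region_def)
      moreover have "g (?q' p) = cmat_adj (?N (?q p) (?q' p)) ** g (?q p) ** ?N (?q p) (?q' p)"
        by (intro tr sector_segment(2)[OF p q(2)[OF p] q(4)[OF p]])
      ultimately show ?thesis by (simp add: glue_cond_def Let_def cmat_adj_mult matrix_mul_assoc)
    qed
    moreover have "cmat_adj (g c) = g c" using g cX by (simp add: parallel_on_def)
    ultimately show "\<exists>g0. cmat_adj g0 = g0 \<and> g0 \<noteq> 0 \<and> (\<forall>p\<in>P. glue_cond B c \<sigma> p g0)" by blast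
  }
  {
    assume "\<exists>g0. cmat_adj g0 = g0 \<and> g0 \<noteq> 0 \<and> (\<forall>p\<in>P. glue_cond B c \<sigma> p g0)"
    then obtain g0 where g0: "cmat_adj g0 = g0" "g0 \<noteq> 0" and gl: "\<And>p. p \<in> P \<Longrightarrow> glue_cond B c \<sigma> p g0" by blast
    define gc where "gc t = cmat_adj (?N c t) ** g0 ** ?N c t" for t
    define gq where "gq p t = cmat_adj (?N (?q p) t) ** gc (?q p) ** ?N (?q p) t" for p t
    \<comment> \<open>A point off \<open>P\<close> and outside the star region lies in exactly one
      sector, so the choice of \<open>p\<close> is unambiguous.\<close>
    define g where "g t = (if t \<in> ?D then gc t else gq (SOME p. p \<in> P \<and> t \<in> ?U p) t)" for t
    have gc: "parallel_on ?D B gc" unfolding gc_def by (rule seg_transport_parallel[OF B X g0(1)])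
    have gq: "parallel_on (?U p) B (gq p)" if p: "p \<in> P" for p
    proof (rule parallel_on_subset)
      show "parallel_on (star_region (?q p) (- P)) B (gq p)"
        unfolding gq_def using gc q(1)[OF p] by (intro seg_transport_parallel[OF B X]) (simp add: parallel_on_def)
      show "?U p \<subseteq> star_region (?q p) (- P)"
        using sector_segment(2)[OF p q(2)[OF p]] by (auto simp: star_region_def)
    qed
    have refl: "gq p (?q p) = gc (?q p)" for p
      by (simp add: gq_def cmat_eq_iff cmat_mult_entry mat_def)
    have refl': "gq p (?q' p) = gc (?q' p)" if "p \<in> P" for p
      using gl[OF that] by (simp add: gq_def gc_def glue_cond_def Let_def cmat_adj_mult matrix_mul_assoc)
    have agree: "gc t = gq p t" if p: "p \<in> P" and t: "t \<in> ?D" "t \<in> ?U p" for p t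
    proof -
      have Bc: "continuous_on S B" if "S \<subseteq> - P" for S
        by (rule continuous_on_subset[OF entrywise_holomorphic_continuous[OF B] that])
      have UP: "?U p \<subseteq> - P" by (rule cut_sector_avoids[OF p])
      have "Im ((t - c) / (p - c)) \<noteq> 0" using sector_in_star[OF p t(2)] t(1) by simp
      then consider "0 < Im ((t - c) / (p - c))" | "Im ((t - c) / (p - c)) < 0" by linarith
      then show ?thesis
      proof cases
        case 1
        let ?S = "?U p \<inter> {t. 0 < Im ((t - c) / (p - c))}"
        have SD: "?S \<subseteq> ?D" using sector_in_star[OF p] by force
        have "?q p \<in> ?S" using q(2)[OF p] \<sigma> by (simp add: cut_point_ratio[OF p] del: Im_divide)
        then have "closed_segment (?q p) t \<subseteq> ?S"
          using t 1 by (intro closed_segment_subset convex_Int cut_sector_convex half_plane_convex) auto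
        moreover have "?S \<subseteq> - P" using UP by blast
        ultimately show ?thesis
          by (intro parallel_on_unique[OF parallel_on_subset[OF gc SD] parallel_on_subset[OF gq[OF p] Int_lower1] _ Bc
              refl[symmetric]])
      next
        case 2
        let ?S = "?U p \<inter> {t. Im ((t - c) / (p - c)) < 0}"
        have SD: "?S \<subseteq> ?D" using sector_in_star[OF p] by force
        have "?q' p \<in> ?S" using q(4)[OF p] \<sigma> by (simp add: cut_point_ratio[OF p] del: Im_divide)
        then have "closed_segment (?q' p) t \<subseteq> ?S"
          using t 2 by (intro closed_segment_subset convex_Int cut_sector_convex half_plane_convex) auto
        moreover have "?S \<subseteq> - P" using UP by blast
        ultimately show ?thesis
          by (intro parallel_on_unique[OF parallel_on_subset[OF gc SD] parallel_on_subset[OF gq[OF p] Int_lower1] _ Bc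
              refl'[OF p, symmetric]])
      qed
    qed
    have gU: "g t = gq p t" if p: "p \<in> P" and t: "t \<in> ?U p" for p t
    proof (cases "t \<in> ?D")
      case False
      have "p' = p" if "p' \<in> P" "t \<in> ?U p'" for p'
      proof -
        have "t \<notin> P" using cut_sector_avoids[OF p] t by auto
        then obtain p'' s where s: "p'' \<in> P" "1 < s" "t = c + of_real s * (p'' - c)" using outside_star False by blast
        then have "p'' = p" "p'' = p'"
          using sector_ray_unique[OF p s(1) t s(3)] sector_ray_unique[OF that(1) s(1) that(2) s(3)] by auto
        then show ?thesis by simp
      qed
      then have "(SOME p. p \<in> P \<and> t \<in> ?U p) = p" using p t by (intro some_equality) (blast, blast)
      then show ?thesis using False by (simp add: g_def)
    next
      case True
      have "g t = gc t" using True by (simp add: g_def)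
      then show ?thesis using agree[OF p True t] by (rule trans)
    qed
    have loc: "cmat_adj (g t) = g t \<and>
        (g has_derivative (\<lambda>v. - (g t ** cscale v (B t) + cmat_adj (cscale v (B t)) ** g t))) (at t)"
      if S: "open S" "t \<in> S" "parallel_on S B k" "\<And>t. t \<in> S \<Longrightarrow> k t = g t" for S k t
    proof -
      have "(k has_derivative (\<lambda>v. - (k t ** cscale v (B t) + cmat_adj (cscale v (B t)) ** k t))) (at t)"
        using S by (auto simp: parallel_on_def)
      then have "(g has_derivative (\<lambda>v. - (k t ** cscale v (B t) + cmat_adj (cscale v (B t)) ** k t))) (at t)"
        by (rule has_derivative_transform_within_open[OF _ S(1,2,4)])
      then show ?thesis using S by (auto simp: parallel_on_def)
    qed
    have "parallel_on (- P) B g"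
      unfolding parallel_on_def
    proof
      fix t assume t: "t \<in> - P"
      show "cmat_adj (g t) = g t \<and>
        (g has_derivative (\<lambda>v. - (g t ** cscale v (B t) + cmat_adj (cscale v (B t)) ** g t))) (at t)"
      proof (cases "t \<in> ?D")
        case True
        then show ?thesis by (intro loc[OF star_region_open[OF X] _ gc]) (auto simp: g_def)
      next
        case False
        then obtain p s where p: "p \<in> P" "1 < s" "t = c + of_real s * (p - c)" using outside_star t by auto
        have pc: "p \<noteq> c" using p(1) cX by auto
        show ?thesis
          using ray_in_sector[OF p(1,2)] p(3) by (intro loc[OF cut_sector_open[OF pc] _ gq[OF p(1)]]) (auto simp: gU[OF p(1)])
      qed
    qed
    moreover have "g c \<noteq> 0"
      using g0(2) star_region_center[OF cX] by (simp add: g_def gc_def cmat_eq_iff cmat_mult_entry mat_def)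
    ultimately show "\<exists>g. parallel_on (- P) B g \<and> (\<exists>t\<in>- P. g t \<noteq> 0)" using cX by blast
  }
qed

end

section \<open>Reduction to one variable\<close>

lemma parallel_onD:
  assumes "parallel_on S B g" "t \<in> S"
  shows "cmat_adj (g t) = g t"
    "(g has_derivative (\<lambda>v. - (g t ** cscale v (B t) + cmat_adj (cscale v (B t)) ** g t))) (at t)"
  using bspec[OF assms(1)[unfolded parallel_on_def] assms(2)] by (rule conjunct1, rule conjunct2)

lemma cscale_mat_1: "A ** cscale k (mat 1) = cscale k A" "cmat_adj (cscale k (mat 1)) ** A = cscale (cnj k) A"
  by (simp_all add: cmat_eq_iff cmat_mult_entry mat_def)

lemma cscale_add_cnj: "cscale k A + cscale (cnj k) A = (2 * Re k) *\<^sub>R A"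
proof -
  have "k * z + cnj k * z = (2 * Re k) *\<^sub>R z" for z
    unfolding distrib_right[symmetric] complex_add_cnj by (rule scaleR_conv_of_real[symmetric])
  then show ?thesis by (simp add: cmat_eq_iff)
qed

lemma cscale_0: "cscale 0 A = 0"
  by (simp add: cmat_eq_iff)

text \<open>The line w = 0 corresponds to t = \<infinity>, which is why \<open>A_mat lam 2\<close>
  is absent: it has been eliminated through the balance condition.\<close>

definition pole_conn :: "complex \<Rightarrow> real \<Rightarrow> complex \<Rightarrow> cmat" where
  "pole_conn lam a t = cscale (of_real a) (cscale (1 / t) (A_mat lam 1) + cscale (1 / (t - 1)) (A_mat lam 3)
      + cscale (1 / (t - lam)) (A_mat lam 4))"

lemma arr_compl_iff:
  "x \<in> arr_compl lam \<longleftrightarrow> x$1 \<noteq> 0 \<and> x$2 \<noteq> 0 \<and> x$2 - x$1 \<noteq> 0 \<and> x$1 - lam * x$2 \<noteq> 0"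
proof -
  have "{1..4::nat} = {1, 2, 3, 4}" by auto
  then show ?thesis by (simp add: arr_compl_def ell_def)
qed

lemma arr_compl_ratio:
  assumes "x \<in> arr_compl lam" shows "x$1 / x$2 \<in> - {0, 1, lam}"
  using assms by (auto simp: arr_compl_iff field_simps)

text \<open>With t = z / w each form dl/l is dt / (t - p) + dw / w, where p is the value of t on the
  line, and it is dw / w for the line w = 0. Since the residues add up to 2, the dw / w part is
  scalar with coefficient 2 a.\<close>

lemma dunkl_form_split:
  assumes lam: "lam \<in> M04" and x: "x \<in> arr_compl lam"
  shows "dunkl_form lam a x v = cscale ((v$1 - x$1 / x$2 * v$2) / x$2) (pole_conn lam a (x$1 / x$2))
     + cscale (2 * of_real a * v$2 / x$2) (mat 1)"
proof -
  have nz: "x$1 \<noteq> 0" "x$2 \<noteq> 0" "x$2 - x$1 \<noteq> 0" "x$1 - lam * x$2 \<noteq> 0" using x by (auto simp: arr_compl_iff)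
  define t where "t = x$1 / x$2"
  define \<tau> where "\<tau> = (v$1 - t * v$2) / x$2"
  have e1: "v$1 / x$1 = \<tau> / t + v$2 / x$2"
    using nz by (simp add: t_def \<tau>_def field_simps)
  have e3: "(v$2 - v$1) / (x$2 - x$1) = \<tau> / (t - 1) + v$2 / x$2"
  proof -
    have "t - 1 = - ((x$2 - x$1) / x$2)" using nz by (simp add: t_def field_simps)
    then have "\<tau> / (t - 1) = - (\<tau> / ((x$2 - x$1) / x$2))" by (simp only: divide_minus_right)
    also have "\<tau> / ((x$2 - x$1) / x$2) = (v$1 - t * v$2) / (x$2 - x$1)" using nz by (simp add: \<tau>_def)
    also have "(v$1 - t * v$2) / (x$2 - x$1) = (v$1 * x$2 - x$1 * v$2) / (x$2 * (x$2 - x$1))"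
      using nz by (simp add: t_def field_simps)
    finally have a0: "\<tau> / (t - 1) = - ((v$1 * x$2 - x$1 * v$2) / (x$2 * (x$2 - x$1)))" .
    have v: "v$2 / x$2 = v$2 * (x$2 - x$1) / (x$2 * (x$2 - x$1))" using nz by simp
    have "\<tau> / (t - 1) + v$2 / x$2 = (- (v$1 * x$2 - x$1 * v$2) + v$2 * (x$2 - x$1)) / (x$2 * (x$2 - x$1))"
      unfolding a0 v add_divide_distrib minus_divide_left ..
    also have "- (v$1 * x$2 - x$1 * v$2) + v$2 * (x$2 - x$1) = x$2 * (v$2 - v$1)" by (simp add: algebra_simps)
    finally show ?thesis using nz by simp
  qed
  have e4: "(v$1 - lam * v$2) / (x$1 - lam * x$2) = \<tau> / (t - lam) + v$2 / x$2"
  proof -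
    have "t - lam = (x$1 - lam * x$2) / x$2" using nz by (simp add: t_def field_simps)
    then have "\<tau> / (t - lam) = (v$1 - t * v$2) / (x$1 - lam * x$2)" using nz by (simp add: \<tau>_def)
    also have "\<dots> = (v$1 * x$2 - x$1 * v$2) / (x$2 * (x$1 - lam * x$2))" using nz by (simp add: t_def field_simps)
    finally have a: "\<tau> / (t - lam) + v$2 / x$2 = ((v$1 * x$2 - x$1 * v$2) + v$2 * (x$1 - lam * x$2)) / (x$2 * (x$1 - lam * x$2))"
      using nz by (simp add: add_divide_distrib)
    also have "(v$1 * x$2 - x$1 * v$2) + v$2 * (x$1 - lam * x$2) = x$2 * (v$1 - lam * v$2)" by (simp add: algebra_simps)
    finally show ?thesis using nz by simp
  qed
  have m: "(mat c ** A) $ i $ j = c * A $ i $ j" for c and A :: cmat and i j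
    using exhaust_2[of i] by (auto simp: cmat_mult_entry mat_def)
  have lam': "lam \<noteq> 0" "lam \<noteq> 1" using lam by (auto simp: M04_def)
  have "dunkl_form lam a x v $ i $ j = (cscale \<tau> (pole_conn lam a t) + cscale (2 * of_real a * v$2 / x$2) (mat 1)) $ i $ j" for i j
  proof -
    have "A_mat lam 2 $ i $ j = (mat 2 :: cmat) $ i $ j - A_mat lam 1 $ i $ j - A_mat lam 3 $ i $ j - A_mat lam 4 $ i $ j"
      using arg_cong[OF A_mat_sum[OF lam'], of "\<lambda>A. A $ i $ j"] by (simp add: algebra_simps)
    moreover have "(mat 2 :: cmat) $ i $ j = 2 * (mat 1 :: cmat) $ i $ j" by (simp add: mat_def)
    ultimately have A2: "A_mat lam 2 $ i $ j = 2 * (mat 1 :: cmat) $ i $ j - A_mat lam 1 $ i $ j - A_mat lam 3 $ i $ j - A_mat lam 4 $ i $ j"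
      by simp
    have "dunkl_form lam a x v $ i $ j = of_real a * (v$1 / x$1) * A_mat lam 1 $ i $ j + of_real a * (v$2 / x$2) * A_mat lam 2 $ i $ j
       + of_real a * ((v$2 - v$1) / (x$2 - x$1)) * A_mat lam 3 $ i $ j
       + of_real a * ((v$1 - lam * v$2) / (x$1 - lam * x$2)) * A_mat lam 4 $ i $ j"
      unfolding dunkl_form_def sum_1_4 by (simp add: m ell_def)
    also have "\<dots> = (cscale \<tau> (pole_conn lam a t) + cscale (2 * of_real a * v$2 / x$2) (mat 1)) $ i $ j"
      unfolding e1 e3 e4 A2 by (simp add: pole_conn_def ring_distribs mult_ac)
    finally show ?thesis .
  qed
  then show ?thesis by (simp add: vec_eq_iff t_def \<tau>_def)
qed

lemma vector_2_in_arr: "t \<in> - {0, 1, lam} \<Longrightarrow> vector [t, 1] \<in> arr_compl lam"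
  by (auto simp: arr_compl_iff)

lemma exp_scale_path_deriv:
  "((\<lambda>s::real. exp (of_real (1 - s) * \<mu>) *s x) has_derivative (\<lambda>h. of_real h *s (- \<mu> *s (exp (of_real (1 - s) * \<mu>) *s x))))
     (at s within S)" for x :: "complex^2"
proof -
  have bl: "bounded_linear (\<lambda>c. c *s x)"
  proof
    show "\<exists>K. \<forall>c. norm (c *s x) \<le> norm c * K"
      using norm_vec2_le[of "c *s x" for c]
      by (intro exI[of _ "norm (x$1) + norm (x$2)"]) (simp add: norm_mult algebra_simps)
  qed (simp_all add: vec_eq_iff algebra_simps scaleR_conv_of_real[where 'a = complex])
  have "((\<lambda>s::real. of_real (1 - s) * \<mu>) has_derivative (\<lambda>h. of_real h * (- \<mu>))) (at s within S)"
    by (auto intro!: derivative_eq_intros)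
  from has_derivative_compose[OF this DERIV_exp[unfolded has_field_derivative_def]]
  have "((\<lambda>s::real. exp (of_real (1 - s) * \<mu>)) has_derivative (\<lambda>h. of_real h * (- \<mu> * exp (of_real (1 - s) * \<mu>)))) (at s within S)"
    by (rule has_derivative_eq_rhs) (simp add: fun_eq_iff mult_ac)
  from bounded_linear.has_derivative[OF bl this] show ?thesis
    by (rule has_derivative_eq_rhs) (simp add: fun_eq_iff vec_eq_iff mult.assoc)
qed

text \<open>The form is restricted to w = 1. The restriction is not zero, because along the complex
  line through a point the form solves a scalar linear equation and cannot become zero on the way to
  w = 1.\<close>

lemma preserves_imp_parallel:
  assumes lam: "lam \<in> M04" and pres: "preserves_herm_form lam a"
  shows "\<exists>g. parallel_on (- {0, 1, lam}) (pole_conn lam a) g \<and> (\<exists>t\<in>- {0, 1, lam}. g t \<noteq> 0)"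
proof -
  obtain G x where G: "\<And>x. x \<in> arr_compl lam \<Longrightarrow> cmat_adj (G x) = G x"
      "\<And>x. x \<in> arr_compl lam \<Longrightarrow> (G has_derivative
            (\<lambda>v. - (G x ** dunkl_form lam a x v + cmat_adj (dunkl_form lam a x v) ** G x))) (at x)"
    and x: "x \<in> arr_compl lam" "G x \<noteq> 0"
    using pres unfolding preserves_herm_form_def by blast
  define g where "g t = G (vector [t, 1])" for t
  have "parallel_on (- {0, 1, lam}) (pole_conn lam a) g"
    unfolding parallel_on_def
  proof (intro ballI conjI)
    fix t assume "t \<in> - {0, 1, lam}"
    then have t: "vector [t, 1] \<in> arr_compl lam" by (rule vector_2_in_arr)
    show "cmat_adj (g t) = g t" using G(1)[OF t] by (simp add: g_def)
    have bl: "bounded_linear (\<lambda>t. vector [t, 0] :: complex^2)"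
    proof
      show "\<exists>K. \<forall>t. norm (vector [t, 0] :: complex^2) \<le> norm t * K"
        using norm_vec2_le[of "vector [t, 0] :: complex^2" for t] by (intro exI[of _ 1]) simp
    qed (simp_all add: vec_eq_iff forall_2)
    have "((\<lambda>t. vector [t, 0] + vector [0, 1] :: complex^2) has_derivative (\<lambda>v. vector [v, 0] + 0)) (at t)"
      by (intro has_derivative_add bounded_linear_imp_has_derivative[OF bl] has_derivative_const)
    moreover have "vector [t, 0] + vector [0, 1] = (vector [t, 1] :: complex^2)" for t :: complex
      by (simp add: vec_eq_iff forall_2)
    ultimately have "((\<lambda>t. vector [t, 1] :: complex^2) has_derivative (\<lambda>v. vector [v, 0])) (at t)" by simp
    from has_derivative_compose[OF this G(2)[OF t]]
    show "(g has_derivative (\<lambda>v. - (g t ** cscale v (pole_conn lam a t) + cmat_adj (cscale v (pole_conn lam a t)) ** g t))) (at t)"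
      unfolding g_def dunkl_form_split[OF lam t] by (simp add: cscale_0)
  qed
  moreover have "g (x$1 / x$2) \<noteq> 0"
  proof
    assume z: "g (x$1 / x$2) = 0"
    have nz: "x$2 \<noteq> 0" using x by (simp add: arr_compl_iff)
    \<comment> \<open>The path \<open>y\<close> scales (t, 1) at time 0 to \<open>x\<close> at time
      1, where t = x$1 / x$2: at time 0 the factor is exp \<mu> = 1 / x$2.\<close>
    define \<mu> where "\<mu> = - Ln (x$2)"
    define y where "y s = exp (of_real (1 - s) * \<mu>) *s x" for s :: real
    have y: "y s \<in> arr_compl lam" for s
      using x(1) by (simp add: arr_compl_iff y_def right_diff_distrib[symmetric] mult.left_commute[of lam])
    have y0: "y 0 = vector [x$1 / x$2, 1]" and y1: "y 1 = x"
      using nz by (simp_all add: y_def \<mu>_def vec_eq_iff forall_2 exp_minus field_simps)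
    have "norm (G (y 1)) \<le> exp (\<bar>4 * a * Re \<mu>\<bar> * (1 - 0)) * norm (G (y 0))"
    proof (rule gronwall_norm[where \<phi> = "\<lambda>s. G (y s)" and \<phi>' = "\<lambda>s. (4 * a * Re \<mu>) *\<^sub>R G (y s)" and a = 0 and b = 1])
      fix s :: real assume "s \<in> {0..1}"
      have yd: "(y has_derivative (\<lambda>h. of_real h *s (- \<mu> *s y s))) (at s within {0..1})"
        unfolding y_def by (rule exp_scale_path_deriv)
      \<comment> \<open>The tangent vector is radial, so dt vanishes on it and only the scalar part
        of \<open>dunkl_form_split\<close> remains.\<close>
      have df: "dunkl_form lam a (y s) (of_real h *s (- \<mu> *s y s)) = cscale (- (2 * of_real a * of_real h * \<mu>)) (mat 1)" for h
        using y[of s] unfolding dunkl_form_split[OF lam y] by (simp add: cmat_eq_iff arr_compl_iff)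
      show "((\<lambda>s. G (y s)) has_vector_derivative (4 * a * Re \<mu>) *\<^sub>R G (y s)) (at s within {0..1})"
        unfolding has_vector_derivative_def
      proof (rule has_derivative_eq_rhs[OF has_derivative_compose[OF yd G(2)[OF y]]])
        have "- (G (y s) ** cscale (- (2 * of_real a * of_real h * \<mu>)) (mat 1) +
           cmat_adj (cscale (- (2 * of_real a * of_real h * \<mu>)) (mat 1)) ** G (y s)) = h *\<^sub>R (4 * a * Re \<mu>) *\<^sub>R G (y s)" for h
          unfolding cscale_mat_1 cscale_add_cnj by (simp add: scaleR_minus_left[symmetric] mult_ac del: scaleR_minus_left)
        then show "(\<lambda>h. - (G (y s) ** dunkl_form lam a (y s) (of_real h *s (- \<mu> *s y s)) +
              cmat_adj (dunkl_form lam a (y s) (of_real h *s (- \<mu> *s y s))) ** G (y s))) = (\<lambda>h. h *\<^sub>R (4 * a * Re \<mu>) *\<^sub>R G (y s))"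
          unfolding df by (simp add: fun_eq_iff)
      qed
    qed simp_all
    then have "G x = 0" using z by (simp add: y0 y1 g_def)
    then show False using x by simp
  qed
  ultimately show ?thesis using arr_compl_ratio[OF x(1)] by blast
qed

lemma parallel_imp_preserves:
  assumes lam: "lam \<in> M04" and g: "parallel_on (- {0, 1, lam}) (pole_conn lam a) g" and t0: "t0 \<in> - {0, 1, lam}" "g t0 \<noteq> 0"
  shows "preserves_herm_form lam a"
proof -
  \<comment> \<open>The scalar part 2 a dw / w of the connection, together with its conjugate,
    integrates to the factor |w|^(- 4 a).\<close>
  define G where "G x = (norm (x$2) powr (- 4 * a)) *\<^sub>R g (x$1 / x$2)" for x :: "complex^2"
  have "cmat_adj (G x) = G x" if x: "x \<in> arr_compl lam" for x
  proof -
    have "cmat_adj (g (x$1 / x$2)) = g (x$1 / x$2)" by (rule parallel_onD(1)[OF g arr_compl_ratio[OF x]])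
    then show ?thesis unfolding G_def using linear_simps(5)[OF bounded_linear_cmat_adj] by simp
  qed
  moreover have "(G has_derivative (\<lambda>v. - (G x ** dunkl_form lam a x v + cmat_adj (dunkl_form lam a x v) ** G x))) (at x)"
    if x: "x \<in> arr_compl lam" for x
  proof -
    have nz: "x$2 \<noteq> 0" using x by (simp add: arr_compl_iff)
    define t where "t = x$1 / x$2"
    define \<tau> where "\<tau> v = (v$1 - t * v$2) / x$2" for v :: "complex^2"
    let ?B = "pole_conn lam a t" and ?n = "norm (x$2) powr (- 4 * a)"
    have dn: "((\<lambda>x. x $ i) has_derivative (\<lambda>v. v $ i)) (at x)" for i
      by (rule bounded_linear_imp_has_derivative[OF bounded_linear_vec_nth])
    have "((\<lambda>x. x$1 / x$2) has_derivative (\<lambda>v. (v$1 * x$2 - x$1 * v$2) / (x$2 * x$2))) (at x)"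
      by (rule has_derivative_divide'[OF dn dn nz])
    then have r: "((\<lambda>x. x$1 / x$2) has_derivative \<tau>) (at x)"
      by (rule has_derivative_eq_rhs) (use nz in \<open>simp add: \<tau>_def t_def fun_eq_iff field_simps\<close>)
    have "(g has_derivative (\<lambda>v. - (g t ** cscale v ?B + cmat_adj (cscale v ?B) ** g t))) (at t)"
      unfolding t_def by (rule parallel_onD(2)[OF g arr_compl_ratio[OF x]])
    from has_derivative_compose[OF r this[unfolded t_def]]
    have dg: "((\<lambda>x. g (x$1 / x$2)) has_derivative (\<lambda>v. - (g t ** cscale (\<tau> v) ?B + cmat_adj (cscale (\<tau> v) ?B) ** g t))) (at x)"
      by (simp add: t_def)
    have "((\<lambda>x. norm (x$2)) has_derivative (\<lambda>v. v$2 \<bullet> sgn (x$2))) (at x)"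
      by (rule has_derivative_compose[OF dn has_derivative_norm[OF nz]])
    then have p0: "((\<lambda>x. norm (x$2) powr (- 4 * a)) has_derivative
        (\<lambda>v. ?n * (0 * ln (norm (x$2)) + (v$2 \<bullet> sgn (x$2)) * (- 4 * a) / norm (x$2)))) (at x)"
      by (rule has_derivative_powr[OF _ has_derivative_const]) (use nz in auto)
    have q: "(v$2 \<bullet> sgn (x$2)) / norm (x$2) = Re (v$2 / x$2)" for v :: "complex^2"
    proof -
      have "(v$2 \<bullet> sgn (x$2)) / norm (x$2) = (v$2 \<bullet> x$2) / (norm (x$2))\<^sup>2"
        by (simp add: sgn_div_norm power2_eq_square divide_inverse)
      also have "v$2 \<bullet> x$2 = Re (v$2) * Re (x$2) + Im (v$2) * Im (x$2)" by (simp add: inner_complex_def)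
      also have "(norm (x$2))\<^sup>2 = (Re (x$2))\<^sup>2 + (Im (x$2))\<^sup>2" by (rule cmod_power2)
      finally show ?thesis by (simp add: Re_divide)
    qed
    have dp: "((\<lambda>x. norm (x$2) powr (- 4 * a)) has_derivative (\<lambda>v. ?n * (- 4 * a * Re (v$2 / x$2)))) (at x)"
      unfolding q[symmetric] by (rule has_derivative_eq_rhs[OF p0]) (simp add: fun_eq_iff)
    have "(G has_derivative (\<lambda>v. ?n *\<^sub>R (- (g t ** cscale (\<tau> v) ?B + cmat_adj (cscale (\<tau> v) ?B) ** g t))
        + (?n * (- 4 * a * Re (v$2 / x$2))) *\<^sub>R g t)) (at x)"
      unfolding G_def using has_derivative_scaleR[OF dp dg] by (simp add: t_def)
    then show ?thesis
    proof (rule has_derivative_eq_rhs, intro ext)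
      fix v :: "complex^2"
      define c where "c = v$2 / x$2"
      have D: "dunkl_form lam a x v = cscale (\<tau> v) ?B + cscale (2 * of_real a * c) (mat 1)"
        unfolding dunkl_form_split[OF lam x] by (simp add: \<tau>_def t_def c_def)
      show "?n *\<^sub>R (- (g t ** cscale (\<tau> v) ?B + cmat_adj (cscale (\<tau> v) ?B) ** g t))
        + (?n * (- 4 * a * Re (v$2 / x$2))) *\<^sub>R g t
        = - (G x ** dunkl_form lam a x v + cmat_adj (dunkl_form lam a x v) ** G x)"
      proof -
        have "(?n *\<^sub>R g t) ** (cscale (\<tau> v) ?B + cscale (2 * of_real a * c) (mat 1))
          + cmat_adj (cscale (\<tau> v) ?B + cscale (2 * of_real a * c) (mat 1)) ** (?n *\<^sub>R g t)
          = ?n *\<^sub>R (g t ** cscale (\<tau> v) ?B + cmat_adj (cscale (\<tau> v) ?B) ** g t)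
          + ?n *\<^sub>R (g t ** cscale (2 * of_real a * c) (mat 1) + cmat_adj (cscale (2 * of_real a * c) (mat 1)) ** g t)"
          by (simp only: linear_simps(1)[OF bounded_linear_cmat_adj] matrix_add_ldistrib cmat_mult_scaleR
              bounded_bilinear.add_left[OF bounded_bilinear_cmat_mult] scaleR_add_right add_ac)
        also have "g t ** cscale (2 * of_real a * c) (mat 1) + cmat_adj (cscale (2 * of_real a * c) (mat 1)) ** g t
          = (4 * a * Re c) *\<^sub>R g t" unfolding cscale_mat_1 cscale_add_cnj by simp
        finally show ?thesis
          unfolding D G_def t_def[symmetric] c_def[symmetric] by (simp add: scaleR_add_right scaleR_diff_right)
      qed
    qed
  qed
  moreover have "G (vector [t0, 1]) \<noteq> 0" using t0 by (simp add: G_def)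
  ultimately show ?thesis unfolding preserves_herm_form_def using vector_2_in_arr[OF t0(1)] by blast
qed

lemma preserves_iff_parallel:
  assumes "lam \<in> M04"
  shows "preserves_herm_form lam a \<longleftrightarrow>
    (\<exists>g. parallel_on (- {0, 1, lam}) (pole_conn lam a) g \<and> (\<exists>t\<in>- {0, 1, lam}. g t \<noteq> 0))"
  using preserves_imp_parallel[OF assms] parallel_imp_preserves[OF assms] by blast

lemma pole_conn_holomorphic: "entrywise_holomorphic (pole_conn lam a) (- {0, 1, lam})"
  unfolding entrywise_holomorphic_def pole_conn_def by (auto intro!: holomorphic_intros)

section \<open>The limit of small parameters\<close>

lemma trace_add: "trace (A + B) = trace A + trace (B :: cmat)"
  by (simp add: trace_def sum_2)

lemma trace_2: "trace (A :: cmat) = A$1$1 + A$2$2"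
  by (simp add: trace_def sum_2)

lemma commute_entries:
  assumes "G ** P = P ** (G :: cmat)"
  shows "G$1$1 * P$1$1 + G$1$2 * P$2$1 = P$1$1 * G$1$1 + P$1$2 * G$2$1"
    "G$1$1 * P$1$2 + G$1$2 * P$2$2 = P$1$1 * G$1$2 + P$1$2 * G$2$2"
    "G$2$1 * P$1$1 + G$2$2 * P$2$1 = P$2$1 * G$1$1 + P$2$2 * G$2$1"
    "G$2$1 * P$1$2 + G$2$2 * P$2$2 = P$2$1 * G$1$2 + P$2$2 * G$2$2"
  using arg_cong[OF assms, of "\<lambda>A. A$1$1"] arg_cong[OF assms, of "\<lambda>A. A$1$2"]
    arg_cong[OF assms, of "\<lambda>A. A$2$1"] arg_cong[OF assms, of "\<lambda>A. A$2$2"]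
  unfolding cmat_mult_entry by -

text \<open>Two 2x2 matrices commute iff the triples formed by the off-diagonal entries and the
  difference of the diagonal entries are linearly dependent. If the triple of G were nonzero, those
  of P and Q would both be multiples of it, and P and Q would commute.\<close>

lemma commuting_scalar:
  fixes G P Q :: cmat
  assumes "G ** P = P ** G" "G ** Q = Q ** G" "P ** Q \<noteq> Q ** P"
  shows "G = cscale (G$1$1) (mat 1)"
proof (rule ccontr)
  assume ne: "G \<noteq> cscale (G$1$1) (mat 1)"
  define a b d where "a = G$1$2" "b = G$2$1" "d = G$1$1 - G$2$2"
  define p1 p2 p3 where "p1 = P$1$2" "p2 = P$2$1" "p3 = P$1$1 - P$2$2"
  define q1 q2 q3 where "q1 = Q$1$2" "q2 = Q$2$1" "q3 = Q$1$1 - Q$2$2"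
  note defs = a_b_d_def p1_p2_p3_def q1_q2_q3_def
  have gp: "a * p2 = b * p1" "a * p3 = d * p1" "b * p3 = d * p2"
    using commute_entries[OF assms(1)] unfolding defs by algebra+
  have gq: "a * q2 = b * q1" "a * q3 = d * q1" "b * q3 = d * q2"
    using commute_entries[OF assms(2)] unfolding defs by algebra+
  have "a \<noteq> 0 \<or> b \<noteq> 0 \<or> d \<noteq> 0" using ne by (auto simp: cmat_eq_iff mat_def defs)
  then have "p1 * q2 = p2 * q1 \<and> p1 * q3 = p3 * q1 \<and> p2 * q3 = p3 * q2"
  proof (elim disjE)
    assume n: "a \<noteq> 0"
    have "a * (p1 * q2) = a * (p2 * q1)" "a * (p1 * q3) = a * (p3 * q1)" "a * (p2 * q3) = a * (p3 * q2)"
      using gp gq by algebra+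
    then show ?thesis using n by simp
  next
    assume n: "b \<noteq> 0"
    have "b * (p1 * q2) = b * (p2 * q1)" "b * (p1 * q3) = b * (p3 * q1)" "b * (p2 * q3) = b * (p3 * q2)"
      using gp gq by algebra+
    then show ?thesis using n by simp
  next
    assume n: "d \<noteq> 0"
    have "d * (p1 * q2) = d * (p2 * q1)" "d * (p1 * q3) = d * (p3 * q1)" "d * (p2 * q3) = d * (p3 * q2)"
      using gp gq by algebra+
    then show ?thesis using n by simp
  qed
  then have k: "p1 * q2 = p2 * q1" "p1 * q3 = p3 * q1" "p2 * q3 = p3 * q2" by auto
  have "P ** Q = Q ** P"
    unfolding cmat_eq_iff cmat_mult_entry using k unfolding defs by (intro conjI; algebra)
  then show False using assms(3) by simp
qed

text \<open>With \<open>\<Gamma> = H^-1 g\<close> the equation of a parallel Hermitian form becomes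
  \<open>d\<Gamma> = - a (\<Gamma> W + W* \<Gamma>)\<close> with \<open>W = \<Sum> A_j dt / (t - p_j)\<close> and \<open>W* = \<Sum> A_j cnj (dt / (t - p_j))\<close>.\<close>

definition pole_form :: "(complex \<times> cmat) \<times> (complex \<times> cmat) \<times> (complex \<times> cmat) \<Rightarrow> complex \<Rightarrow> complex \<Rightarrow> cmat" where
  "pole_form D t v = (case D of ((p, P), (q, Q), (r, R)) \<Rightarrow>
     cscale (v / (t - p)) P + cscale (v / (t - q)) Q + cscale (v / (t - r)) R)"

definition pole_form_cnj :: "(complex \<times> cmat) \<times> (complex \<times> cmat) \<times> (complex \<times> cmat) \<Rightarrow> complex \<Rightarrow> complex \<Rightarrow> cmat" where
  "pole_form_cnj D t v = (case D of ((p, P), (q, Q), (r, R)) \<Rightarrow>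
     cscale (cnj (v / (t - p))) P + cscale (cnj (v / (t - q))) Q + cscale (cnj (v / (t - r))) R)"

definition pert_form :: "(complex \<times> cmat) \<times> (complex \<times> cmat) \<times> (complex \<times> cmat) \<Rightarrow> cmat \<Rightarrow> complex \<Rightarrow> complex \<Rightarrow> cmat" where
  "pert_form D G t v = G ** pole_form D t v + pole_form_cnj D t v ** G"

definition pole_set :: "(complex \<times> cmat) \<times> (complex \<times> cmat) \<times> (complex \<times> cmat) \<Rightarrow> complex set" where
  "pole_set D = {fst (fst D), fst (fst (snd D)), fst (snd (snd D))}"

definition pert_sol :: "(complex \<times> cmat) \<times> (complex \<times> cmat) \<times> (complex \<times> cmat) \<Rightarrow> real \<Rightarrow> (complex \<Rightarrow> cmat) \<Rightarrow> bool" where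
  "pert_sol D a \<Gamma> \<longleftrightarrow> (\<forall>t\<in>- pole_set D. (\<Gamma> has_derivative (\<lambda>v. - (a *\<^sub>R pert_form D (\<Gamma> t) t v))) (at t))"

text \<open>A single-valued primitive of \<open>pert_form D (mat 1)\<close>. To first order in
  \<open>a\<close>, a solution close to the scalar \<kappa> is a constant matrix minus a \<kappa>
  \<open>log_pot D\<close>.\<close>

definition log_pot :: "(complex \<times> cmat) \<times> (complex \<times> cmat) \<times> (complex \<times> cmat) \<Rightarrow> complex \<Rightarrow> cmat" where
  "log_pot D t = (case D of ((p, P), (q, Q), (r, R)) \<Rightarrow>
     (2 * ln (norm (t - p))) *\<^sub>R P + (2 * ln (norm (t - q))) *\<^sub>R Q + (2 * ln (norm (t - r))) *\<^sub>R R)"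

lemma pert_solD:
  assumes "pert_sol D a \<Gamma>" "t \<in> - pole_set D"
  shows "(\<Gamma> has_derivative (\<lambda>v. - (a *\<^sub>R pert_form D (\<Gamma> t) t v))) (at t)"
  by (rule bspec[OF assms(1)[unfolded pert_sol_def] assms(2)])

lemma pert_form_linear:
  "pert_form D (G + G') t v = pert_form D G t v + pert_form D G' t v"
  "pert_form D (G - G') t v = pert_form D G t v - pert_form D G' t v"
  "pert_form D (x *\<^sub>R G) t v = x *\<^sub>R pert_form D G t v"
  by (simp_all add: pert_form_def cmat_mult_scaleR scaleR_add_right
      bounded_bilinear.add_left[OF bounded_bilinear_cmat_mult] bounded_bilinear.add_right[OF bounded_bilinear_cmat_mult]
      bounded_bilinear.diff_left[OF bounded_bilinear_cmat_mult] bounded_bilinear.diff_right[OF bounded_bilinear_cmat_mult])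

lemma norm_pert_form_le:
  "norm (pert_form D G t v) \<le> 8 * (norm (pole_form D t v) + norm (pole_form_cnj D t v)) * norm G"
  using norm_triangle_ineq[of "G ** pole_form D t v" "pole_form_cnj D t v ** G"]
    norm_cmat_mult_le[of G "pole_form D t v"] norm_cmat_mult_le[of "pole_form_cnj D t v" G]
  unfolding pert_form_def by (simp add: algebra_simps)

lemma pole_form_continuous:
  assumes "continuous_on S \<eta>" "continuous_on S \<eta>'" "\<eta> ` S \<subseteq> - pole_set D"
  shows "continuous_on S (\<lambda>s. pole_form D (\<eta> s) (\<eta>' s))" "continuous_on S (\<lambda>s. pole_form_cnj D (\<eta> s) (\<eta>' s))"
proof -
  obtain p P q Q r R where D: "D = ((p, P), (q, Q), (r, R))" by (metis prod.exhaust)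
  have c: "continuous_on S (\<lambda>s. \<eta>' s / (\<eta> s - z))" if z: "z \<in> {p, q, r}" for z
  proof (intro continuous_on_divide continuous_on_diff continuous_on_const assms(1,2) ballI)
    fix s assume "s \<in> S"
    then show "\<eta> s - z \<noteq> 0" using assms(3) z by (auto simp: D pole_set_def)
  qed
  have c: "continuous_on S (\<lambda>s. \<eta>' s / (\<eta> s - p))" "continuous_on S (\<lambda>s. \<eta>' s / (\<eta> s - q))"
    "continuous_on S (\<lambda>s. \<eta>' s / (\<eta> s - r))"
    by (rule c, simp)+
  show "continuous_on S (\<lambda>s. pole_form D (\<eta> s) (\<eta>' s))" "continuous_on S (\<lambda>s. pole_form_cnj D (\<eta> s) (\<eta>' s))"
    unfolding pole_form_def pole_form_cnj_def D prod.case
    by (rule continuous_on_cmat, unfold vector_add_component cscale_entry,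
        intro continuous_on_add continuous_on_mult continuous_on_const continuous_on_cnj c)+
qed

lemma log_pot_deriv:
  assumes "t \<in> - pole_set D"
  shows "(log_pot D has_derivative (\<lambda>v. pert_form D (mat 1) t v)) (at t)"
proof -
  have l: "((\<lambda>t. (2 * ln (norm (t - p))) *\<^sub>R A) has_derivative (\<lambda>v. cscale (v / (t - p)) A + cscale (cnj (v / (t - p))) A)) (at t)"
    if "t \<noteq> p" for p and A :: cmat
  proof -
    have n: "((\<lambda>t. norm (t - p)) has_derivative (\<lambda>v. v \<bullet> sgn (t - p))) (at t)"
      using that by (intro has_derivative_compose[OF _ has_derivative_norm]) (auto intro!: derivative_eq_intros)
    have "((\<lambda>t. ln (norm (t - p))) has_derivative (\<lambda>v. (v \<bullet> sgn (t - p)) * inverse (norm (t - p)))) (at t)"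
      using that by (intro has_derivative_ln n) auto
    then have d: "((\<lambda>t. (2 * ln (norm (t - p))) *\<^sub>R A) has_derivative (\<lambda>v. (2 * ((v \<bullet> sgn (t - p)) * inverse (norm (t - p)))) *\<^sub>R A)) (at t)"
      by (intro has_derivative_scaleR_left has_derivative_mult_right)
    have r: "(v \<bullet> sgn (t - p)) * inverse (norm (t - p)) = Re (v / (t - p))" for v
    proof -
      have "(v \<bullet> sgn (t - p)) * inverse (norm (t - p)) = (v \<bullet> (t - p)) / (norm (t - p))\<^sup>2"
        by (simp add: sgn_div_norm power2_eq_square divide_inverse)
      also have "v \<bullet> (t - p) = Re v * Re (t - p) + Im v * Im (t - p)" by (simp only: inner_complex_def)
      also have "(norm (t - p))\<^sup>2 = (Re (t - p))\<^sup>2 + (Im (t - p))\<^sup>2" by (rule cmod_power2)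
      finally show ?thesis by (simp add: Re_divide)
    qed
    have c: "cscale k A + cscale (cnj k) A = (2 * Re k) *\<^sub>R A" for k
    proof -
      have "k * z + cnj k * z = (2 * Re k) *\<^sub>R z" for z
        unfolding distrib_right[symmetric] complex_add_cnj by (rule scaleR_conv_of_real[symmetric])
      then show ?thesis by (simp add: cmat_eq_iff)
    qed
    show ?thesis using d unfolding r c .
  qed
  obtain p P q Q r R where D: "D = ((p, P), (q, Q), (r, R))" by (metis prod.exhaust)
  have "((\<lambda>t. (2 * ln (norm (t - p))) *\<^sub>R P + (2 * ln (norm (t - q))) *\<^sub>R Q + (2 * ln (norm (t - r))) *\<^sub>R R) has_derivative
    (\<lambda>v. (cscale (v / (t - p)) P + cscale (cnj (v / (t - p))) P) + (cscale (v / (t - q)) Q + cscale (cnj (v / (t - q))) Q)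
       + (cscale (v / (t - r)) R + cscale (cnj (v / (t - r))) R))) (at t)"
    using assms by (intro has_derivative_add l) (auto simp: D pole_set_def)
  moreover have "log_pot D = (\<lambda>t. (2 * ln (norm (t - p))) *\<^sub>R P + (2 * ln (norm (t - q))) *\<^sub>R Q + (2 * ln (norm (t - r))) *\<^sub>R R)"
    by (simp add: D log_pot_def fun_eq_iff)
  ultimately show ?thesis
    by (simp add: D pert_form_def pole_form_def pole_form_cnj_def add_ac)
qed

lemma deriv_along_path:
  assumes F: "(F has_derivative F') (at (\<eta> s))" and \<eta>: "(\<eta> has_vector_derivative \<eta>' s) (at s within S)"
  shows "((\<lambda>s. F (\<eta> s)) has_vector_derivative F' (\<eta>' s)) (at s within S)"
proof -
  have "((\<lambda>s. F (\<eta> s)) has_derivative (\<lambda>h. F' (h *\<^sub>R \<eta>' s))) (at s within S)"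
    by (rule has_derivative_compose[OF \<eta>[unfolded has_vector_derivative_def] F])
  then show ?thesis
    using linear_simps(5)[OF has_derivative_bounded_linear[OF F]] by (simp add: has_vector_derivative_def)
qed

lemma increment_bound:
  fixes f :: "real \<Rightarrow> 'a::real_normed_vector"
  assumes "\<And>s. s \<in> {0..1} \<Longrightarrow> (f has_vector_derivative f' s) (at s within {0..1})"
    "\<And>s. s \<in> {0..1} \<Longrightarrow> norm (f' s) \<le> B" "s \<in> {0..1}"
  shows "norm (f s - f 0) \<le> B"
proof -
  have B: "0 \<le> B" using assms(2)[of 0] norm_ge_zero[of "f' 0"] by (smt (verit) atLeastAtMost_iff zero_le_one)
  have "norm (f s - f 0) \<le> B * norm (s - 0)"
  proof (rule differentiable_bound[of "{0..1}"])
    show "(f has_derivative (\<lambda>h. h *\<^sub>R f' x)) (at x within {0..1})" if "x \<in> {0..1}" for x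
      using assms(1)[OF that] by (simp add: has_vector_derivative_def)
    show "onorm (\<lambda>h. h *\<^sub>R f' x) \<le> B" if "x \<in> {0..1}" for x
    proof (rule onorm_bound[OF B])
      fix h :: real
      show "norm (h *\<^sub>R f' x) \<le> B * norm h"
        using mult_left_mono[OF assms(2)[OF that], of "\<bar>h\<bar>"] by (simp add: mult.commute)
    qed
  qed (use assms(3) in auto)
  also have "\<dots> \<le> B * 1" using assms(3) B by (intro mult_left_mono) auto
  finally show ?thesis by simp
qed

text \<open>Propagation along a path of the two limits \<open>\<Gamma>\<^sub>n \<rightarrow> \<gamma>\<close> and \<open>(\<Gamma>\<^sub>n - C\<^sub>n) / a\<^sub>n + \<kappa> log_pot \<rightarrow> 0\<close>.\<close>

lemma pert_path_limits:
  assumes \<eta>: "\<And>s. s \<in> {0..1} \<Longrightarrow> (\<eta> has_vector_derivative \<eta>' s) (at s within {0..1})"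
    and \<eta>': "continuous_on {0..1} \<eta>'" and X: "\<eta> ` {0..1} \<subseteq> - pole_set D"
    and sol: "\<And>n. pert_sol D (a n) (\<Gamma> n)" and a0: "a \<longlonglongrightarrow> 0" and nz: "\<And>n. a n \<noteq> 0"
    and lim: "(\<lambda>n. \<Gamma> n (\<eta> 0)) \<longlonglongrightarrow> \<gamma>"
  shows "uniform_limit {0..1} (\<lambda>n s. \<Gamma> n (\<eta> s)) (\<lambda>s. \<gamma>) sequentially"
    and "\<gamma> = \<kappa> *\<^sub>R mat 1 \<Longrightarrow> (\<lambda>n. (\<Gamma> n (\<eta> 0) - C n) /\<^sub>R a n + \<kappa> *\<^sub>R log_pot D (\<eta> 0)) \<longlonglongrightarrow> \<zeta> \<Longrightarrow>
      uniform_limit {0..1} (\<lambda>n s. (\<Gamma> n (\<eta> s) - C n) /\<^sub>R a n + \<kappa> *\<^sub>R log_pot D (\<eta> s)) (\<lambda>s. \<zeta>) sequentially"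
proof -
  have c\<eta>: "continuous_on {0..1} \<eta>"
    unfolding continuous_on_eq_continuous_within using has_vector_derivative_continuous[OF \<eta>] by blast
  obtain M1 where M1: "\<And>s. s \<in> {0..1} \<Longrightarrow> norm (pole_form D (\<eta> s) (\<eta>' s)) \<le> M1"
    using continuous_bounded_on_compact[OF compact_Icc pole_form_continuous(1)[OF c\<eta> \<eta>' X]] by blast
  obtain M2 where M2: "\<And>s. s \<in> {0..1} \<Longrightarrow> norm (pole_form_cnj D (\<eta> s) (\<eta>' s)) \<le> M2"
    using continuous_bounded_on_compact[OF compact_Icc pole_form_continuous(2)[OF c\<eta> \<eta>' X]] by blast
  define M where "M = 8 * (M1 + M2)"
  have M: "norm (pert_form D G (\<eta> s) (\<eta>' s)) \<le> M * norm G" if "s \<in> {0..1}" for s G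
  proof -
    have "8 * (norm (pole_form D (\<eta> s) (\<eta>' s)) + norm (pole_form_cnj D (\<eta> s) (\<eta>' s))) * norm G \<le> M * norm G"
      using M1[OF that] M2[OF that] by (intro mult_right_mono) (auto simp: M_def)
    then show ?thesis by (rule order_trans[OF norm_pert_form_le])
  qed
  have M0: "0 \<le> M"
  proof -
    have "0 \<le> M1" "0 \<le> M2" using order_trans[OF norm_ge_zero M1[of 0]] order_trans[OF norm_ge_zero M2[of 0]] by simp_all
    then show ?thesis by (simp add: M_def)
  qed
  have d\<Gamma>: "((\<lambda>s. \<Gamma> n (\<eta> s)) has_vector_derivative - (a n *\<^sub>R pert_form D (\<Gamma> n (\<eta> s)) (\<eta> s) (\<eta>' s))) (at s within {0..1})"
    if s: "s \<in> {0..1}" for n s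
  proof -
    have "\<eta> s \<in> - pole_set D" using X s by blast
    from deriv_along_path[where \<eta> = \<eta> and \<eta>' = \<eta>' and F = "\<Gamma> n", OF pert_solD[OF sol this] \<eta>[OF s]]
    show ?thesis .
  qed
  have bound: "norm (\<Gamma> n (\<eta> s)) \<le> exp (\<bar>a n\<bar> * M) * norm (\<Gamma> n (\<eta> 0))" if s: "s \<in> {0..1}" for n s
  proof -
    have "norm (\<Gamma> n (\<eta> s)) \<le> exp (\<bar>a n\<bar> * M * (s - 0)) * norm (\<Gamma> n (\<eta> 0))"
    proof (rule gronwall_norm[OF d\<Gamma> _ s])
      fix s :: real assume "s \<in> {0..1}"
      then have "\<bar>a n\<bar> * norm (pert_form D (\<Gamma> n (\<eta> s)) (\<eta> s) (\<eta>' s)) \<le> \<bar>a n\<bar> * (M * norm (\<Gamma> n (\<eta> s)))"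
        by (intro mult_left_mono M) auto
      then show "norm (- (a n *\<^sub>R pert_form D (\<Gamma> n (\<eta> s)) (\<eta> s) (\<eta>' s))) \<le> \<bar>a n\<bar> * M * norm (\<Gamma> n (\<eta> s))"
        by (simp add: mult.assoc)
    qed
    also have "\<dots> \<le> exp (\<bar>a n\<bar> * M) * norm (\<Gamma> n (\<eta> 0))"
      using s M0 by (intro mult_right_mono) (auto simp: mult_left_le)
    finally show ?thesis .
  qed
  define b where "b n = \<bar>a n\<bar> * (M * (exp (\<bar>a n\<bar> * M) * norm (\<Gamma> n (\<eta> 0)))) + norm (\<Gamma> n (\<eta> 0) - \<gamma>)" for n
  have close: "norm (\<Gamma> n (\<eta> s) - \<gamma>) \<le> b n" if s: "s \<in> {0..1}" for n s
  proof -
    have "norm (\<Gamma> n (\<eta> s) - \<Gamma> n (\<eta> 0)) \<le> \<bar>a n\<bar> * (M * (exp (\<bar>a n\<bar> * M) * norm (\<Gamma> n (\<eta> 0))))"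
    proof (rule increment_bound[OF d\<Gamma> _ s])
      fix s :: real assume s: "s \<in> {0..1}"
      have "norm (pert_form D (\<Gamma> n (\<eta> s)) (\<eta> s) (\<eta>' s)) \<le> M * norm (\<Gamma> n (\<eta> s))" by (rule M[OF s])
      also have "\<dots> \<le> M * (exp (\<bar>a n\<bar> * M) * norm (\<Gamma> n (\<eta> 0)))" by (intro mult_left_mono bound s M0)
      finally show "norm (- (a n *\<^sub>R pert_form D (\<Gamma> n (\<eta> s)) (\<eta> s) (\<eta>' s))) \<le> \<bar>a n\<bar> * (M * (exp (\<bar>a n\<bar> * M) * norm (\<Gamma> n (\<eta> 0))))"
        by (simp add: mult_left_mono)
    qed
    then show ?thesis
      using norm_triangle_ineq[of "\<Gamma> n (\<eta> s) - \<Gamma> n (\<eta> 0)" "\<Gamma> n (\<eta> 0) - \<gamma>"] by (simp add: b_def)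
  qed
  have "b \<longlonglongrightarrow> \<bar>0\<bar> * (M * (exp (\<bar>0\<bar> * M) * norm \<gamma>)) + norm (\<gamma> - \<gamma>)"
    unfolding b_def by (intro tendsto_intros a0 lim)
  then have b0: "b \<longlonglongrightarrow> 0" by simp
  have ulim: "uniform_limit {0..1} f (\<lambda>s. l) sequentially"
    if "\<And>n s. s \<in> {0..1} \<Longrightarrow> norm (f n s - l) \<le> e n" "e \<longlonglongrightarrow> 0" for f :: "nat \<Rightarrow> real \<Rightarrow> cmat" and l e
    unfolding uniform_limit_iff
  proof (intro allI impI)
    fix \<delta> :: real assume "0 < \<delta>"
    with that(2) have "\<forall>\<^sub>F n in sequentially. e n < \<delta>" by (rule order_tendstoD(2))
    then show "\<forall>\<^sub>F n in sequentially. \<forall>s\<in>{0..1}. dist (f n s) l < \<delta>"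
    proof (rule eventually_mono)
      fix n assume "e n < \<delta>"
      then show "\<forall>s\<in>{0..1}. dist (f n s) l < \<delta>"
        unfolding dist_norm using le_less_trans[OF that(1)] by blast
    qed
  qed
  show "uniform_limit {0..1} (\<lambda>n s. \<Gamma> n (\<eta> s)) (\<lambda>s. \<gamma>) sequentially"
    by (rule ulim[OF close b0])
  assume \<gamma>: "\<gamma> = \<kappa> *\<^sub>R mat 1"
    and l0: "(\<lambda>n. (\<Gamma> n (\<eta> 0) - C n) /\<^sub>R a n + \<kappa> *\<^sub>R log_pot D (\<eta> 0)) \<longlonglongrightarrow> \<zeta>"
  define h where "h n s = (\<Gamma> n (\<eta> s) - C n) /\<^sub>R a n + \<kappa> *\<^sub>R log_pot D (\<eta> s)" for n s
  \<comment> \<open>The division by \<open>a n\<close> does no harm: \<Gamma>' / a is - pert_form of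
    \<Gamma>, while \<kappa> \<open>log_pot\<close> has derivative pert_form of \<gamma>. Only the
    difference of \<Gamma> and \<gamma> survives, and it tends to 0.\<close>
  have dh: "(h n has_vector_derivative - pert_form D (\<Gamma> n (\<eta> s) - \<gamma>) (\<eta> s) (\<eta>' s)) (at s within {0..1})"
    if s: "s \<in> {0..1}" for n s
  proof -
    have "((\<lambda>s. log_pot D (\<eta> s)) has_vector_derivative pert_form D (mat 1) (\<eta> s) (\<eta>' s)) (at s within {0..1})"
    proof -
      have "\<eta> s \<in> - pole_set D" using X s by blast
      from deriv_along_path[where \<eta> = \<eta> and \<eta>' = \<eta>' and F = "log_pot D", OF log_pot_deriv[OF this] \<eta>[OF s]]
      show ?thesis .
    qed
    from has_vector_derivative_scaleR[OF DERIV_const this, of \<kappa>]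
    have l: "((\<lambda>s. \<kappa> *\<^sub>R log_pot D (\<eta> s)) has_vector_derivative \<kappa> *\<^sub>R pert_form D (mat 1) (\<eta> s) (\<eta>' s)) (at s within {0..1})"
      by simp
    have "((\<lambda>s. inverse (a n) *\<^sub>R (\<Gamma> n (\<eta> s) - C n)) has_vector_derivative
       inverse (a n) *\<^sub>R - (a n *\<^sub>R pert_form D (\<Gamma> n (\<eta> s)) (\<eta> s) (\<eta>' s))) (at s within {0..1})"
      using has_vector_derivative_scaleR[OF DERIV_const has_vector_derivative_diff[OF d\<Gamma>[OF s] has_vector_derivative_const], of "inverse (a n)"]
      by simp
    from has_vector_derivative_add[OF this l] show ?thesis
      unfolding h_def \<gamma> using nz[of n] by (simp add: pert_form_linear)
  qed
  have inc: "norm (h n s - h n 0) \<le> M * b n" if s: "s \<in> {0..1}" for n s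
  proof (rule increment_bound[OF dh _ s])
    fix s :: real assume s: "s \<in> {0..1}"
    have "norm (pert_form D (\<Gamma> n (\<eta> s) - \<gamma>) (\<eta> s) (\<eta>' s)) \<le> M * norm (\<Gamma> n (\<eta> s) - \<gamma>)" by (rule M[OF s])
    also have "\<dots> \<le> M * b n" by (intro mult_left_mono close s M0)
    finally show "norm (- pert_form D (\<Gamma> n (\<eta> s) - \<gamma>) (\<eta> s) (\<eta>' s)) \<le> M * b n" by simp
  qed
  have "uniform_limit {0..1} h (\<lambda>s. \<zeta>) sequentially"
  proof (rule ulim)
    show "norm (h n s - \<zeta>) \<le> M * b n + norm (h n 0 - \<zeta>)" if "s \<in> {0..1}" for n s
      using inc[OF that, of n] norm_triangle_ineq[of "h n s - h n 0" "h n 0 - \<zeta>"] by simp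
    have "(\<lambda>n. M * b n + norm (h n 0 - \<zeta>)) \<longlonglongrightarrow> M * 0 + norm (\<zeta> - \<zeta>)"
      using l0 unfolding h_def by (intro tendsto_intros b0)
    then show "(\<lambda>n. M * b n + norm (h n 0 - \<zeta>)) \<longlonglongrightarrow> 0" by simp
  qed
  then show "uniform_limit {0..1} (\<lambda>n s. (\<Gamma> n (\<eta> s) - C n) /\<^sub>R a n + \<kappa> *\<^sub>R log_pot D (\<eta> s)) (\<lambda>s. \<zeta>) sequentially"
    unfolding h_def .
qed

section \<open>Loop integrals around a pole\<close>

definition circ :: "complex \<Rightarrow> real \<Rightarrow> real \<Rightarrow> complex" where
  "circ p \<epsilon> s = p + of_real \<epsilon> * exp (2 * of_real pi * \<i> * of_real s)"

definition circ_vel :: "complex \<Rightarrow> real \<Rightarrow> real \<Rightarrow> complex" where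
  "circ_vel p \<epsilon> s = 2 * of_real pi * \<i> * (circ p \<epsilon> s - p)"

lemma circ_deriv: "(circ p \<epsilon> has_vector_derivative circ_vel p \<epsilon> s) (at s within S)"
proof -
  have "(circlepath p \<epsilon> has_vector_derivative (2 * pi * \<i> * \<epsilon> * exp (2 * of_real pi * \<i> * s))) (at s within S)"
    by (rule has_vector_derivative_circlepath)
  moreover have "circlepath p \<epsilon> = circ p \<epsilon>" by (simp add: circlepath circ_def fun_eq_iff)
  ultimately show ?thesis by (simp add: circ_vel_def circ_def mult.assoc)
qed

lemma circ_continuous: "continuous_on S (circ p \<epsilon>)" "continuous_on S (circ_vel p \<epsilon>)"
  unfolding circ_def circ_vel_def by (intro continuous_intros)+

lemma circ_dist: "0 \<le> \<epsilon> \<Longrightarrow> norm (circ p \<epsilon> s - p) = \<epsilon>"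
  by (simp add: circ_def norm_mult)

lemma circ_closed: "circ p \<epsilon> 1 = circ p \<epsilon> 0"
  by (simp add: circ_def exp_two_pi_i mult.commute)

lemma circ_integral_outside:
  assumes "0 < \<epsilon>" "\<epsilon> < norm (q - p)"
  shows "((\<lambda>s. circ_vel p \<epsilon> s / (circ p \<epsilon> s - q)) has_integral 0) {0..1}"
proof -
  have "q \<notin> cball p \<epsilon>" using assms by (simp add: dist_norm norm_minus_commute)
  then have "(\<lambda>w. 1 / (w - q)) holomorphic_on cball p \<epsilon>" by (auto intro!: holomorphic_intros)
  then have "((\<lambda>w. 1 / (w - q)) has_contour_integral 0) (circlepath p \<epsilon>)"
    using assms by (intro Cauchy_theorem_convex_simple[of _ "cball p \<epsilon>"]) auto
  then have "((\<lambda>s. 1 / (circlepath p \<epsilon> s - q) * vector_derivative (circlepath p \<epsilon>) (at s within {0..1})) has_integral 0) {0..1}"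
    by (simp add: has_contour_integral_def)
  then show ?thesis
    by (rule has_integral_eq[rotated])
       (simp add: vector_derivative_circlepath01, simp add: circlepath circ_def circ_vel_def)
qed

definition loop_int :: "(complex \<times> cmat) \<times> (complex \<times> cmat) \<times> (complex \<times> cmat) \<Rightarrow> complex \<Rightarrow> real \<Rightarrow> (real \<Rightarrow> cmat) \<Rightarrow> cmat" where
  "loop_int D p \<epsilon> F = integral {0..1} (\<lambda>s. pert_form D (F s) (circ p \<epsilon> s) (circ_vel p \<epsilon> s))"

lemma pert_form_path_continuous:
  assumes "continuous_on S \<eta>" "continuous_on S \<eta>'" "\<eta> ` S \<subseteq> - pole_set D" "continuous_on S F"
  shows "continuous_on S (\<lambda>s. pert_form D (F s) (\<eta> s) (\<eta>' s))"
  unfolding pert_form_def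
  by (intro continuous_on_add continuous_on_cmat_mult assms(4) pole_form_continuous[OF assms(1-3)])

context
  fixes D :: "(complex \<times> cmat) \<times> (complex \<times> cmat) \<times> (complex \<times> cmat)" and p :: complex and \<epsilon> :: real
  assumes avoid: "circ p \<epsilon> ` {0..1} \<subseteq> - pole_set D"
begin

lemma loop_int_integrable:
  "continuous_on {0..1} F \<Longrightarrow> (\<lambda>s. pert_form D (F s) (circ p \<epsilon> s) (circ_vel p \<epsilon> s)) integrable_on {0..1}"
  by (intro integrable_continuous_interval pert_form_path_continuous circ_continuous avoid)

lemma loop_int_linear:
  assumes "continuous_on {0..1} F" "continuous_on {0..1} G"
  shows "loop_int D p \<epsilon> (\<lambda>s. F s + G s) = loop_int D p \<epsilon> F + loop_int D p \<epsilon> G"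
    "loop_int D p \<epsilon> (\<lambda>s. F s - G s) = loop_int D p \<epsilon> F - loop_int D p \<epsilon> G"
    "loop_int D p \<epsilon> (\<lambda>s. x *\<^sub>R F s) = x *\<^sub>R loop_int D p \<epsilon> F"
  using loop_int_integrable[OF assms(1)] loop_int_integrable[OF assms(2)]
  by (simp_all add: loop_int_def pert_form_linear integral_add integral_diff)

text \<open>The solution is single-valued, so its derivative integrates to 0 over the closed circle,
  and the factor \<open>a\<close> can be divided out.\<close>

lemma loop_int_sol:
  assumes "pert_sol D a \<Gamma>" "a \<noteq> 0"
  shows "loop_int D p \<epsilon> (\<lambda>s. \<Gamma> (circ p \<epsilon> s)) = 0"
proof -
  have "((\<lambda>s. - (a *\<^sub>R pert_form D (\<Gamma> (circ p \<epsilon> s)) (circ p \<epsilon> s) (circ_vel p \<epsilon> s))) has_integral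
     \<Gamma> (circ p \<epsilon> 1) - \<Gamma> (circ p \<epsilon> 0)) {0..1}"
  proof (rule fundamental_theorem_of_calculus)
    fix s :: real assume "s \<in> {0..1}"
    then have "circ p \<epsilon> s \<in> - pole_set D" using avoid by blast
    from deriv_along_path[where \<eta> = "circ p \<epsilon>" and \<eta>' = "circ_vel p \<epsilon>" and F = \<Gamma>, OF pert_solD[OF assms(1) this] circ_deriv]
    show "((\<lambda>s. \<Gamma> (circ p \<epsilon> s)) has_vector_derivative - (a *\<^sub>R pert_form D (\<Gamma> (circ p \<epsilon> s)) (circ p \<epsilon> s) (circ_vel p \<epsilon> s))) (at s within {0..1})" .
  qed simp
  from has_integral_cmul[OF this, of "- inverse a"] assms(2)
  have "((\<lambda>s. pert_form D (\<Gamma> (circ p \<epsilon> s)) (circ p \<epsilon> s) (circ_vel p \<epsilon> s)) has_integral 0) {0..1}"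
    by (simp add: circ_closed)
  then show ?thesis by (simp add: loop_int_def integral_unique)
qed

lemma loop_int_tendsto:
  assumes F: "\<And>n. continuous_on {0..1} (F n)" and u: "uniform_limit {0..1} F (\<lambda>s. C) sequentially"
  shows "(\<lambda>n. loop_int D p \<epsilon> (F n)) \<longlonglongrightarrow> loop_int D p \<epsilon> (\<lambda>s. C)"
proof -
  obtain M1 where M1: "\<And>s. s \<in> {0..1} \<Longrightarrow> norm (pole_form D (circ p \<epsilon> s) (circ_vel p \<epsilon> s)) \<le> M1"
    using continuous_bounded_on_compact[OF compact_Icc pole_form_continuous(1)[OF circ_continuous avoid]] by blast
  obtain M2 where M2: "\<And>s. s \<in> {0..1} \<Longrightarrow> norm (pole_form_cnj D (circ p \<epsilon> s) (circ_vel p \<epsilon> s)) \<le> M2"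
    using continuous_bounded_on_compact[OF compact_Icc pole_form_continuous(2)[OF circ_continuous avoid]] by blast
  define M where "M = 8 * (\<bar>M1\<bar> + \<bar>M2\<bar>) + 1"
  have M: "norm (pert_form D G (circ p \<epsilon> s) (circ_vel p \<epsilon> s)) \<le> M * norm G" if "s \<in> {0..1}" for s G
  proof (rule order_trans[OF norm_pert_form_le])
    show "8 * (norm (pole_form D (circ p \<epsilon> s) (circ_vel p \<epsilon> s)) + norm (pole_form_cnj D (circ p \<epsilon> s) (circ_vel p \<epsilon> s))) * norm G \<le> M * norm G"
      using M1[OF that] M2[OF that] by (intro mult_right_mono) (auto simp: M_def)
  qed
  have M0: "0 < M" by (simp add: M_def)
  have u': "uniform_limit {0..1} (\<lambda>n s. pert_form D (F n s) (circ p \<epsilon> s) (circ_vel p \<epsilon> s))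
     (\<lambda>s. pert_form D C (circ p \<epsilon> s) (circ_vel p \<epsilon> s)) sequentially"
    unfolding uniform_limit_iff
  proof (intro allI impI)
    fix e :: real assume "0 < e"
    then have "0 < e / M" using M0 by simp
    from uniform_limitD[OF u this]
    show "\<forall>\<^sub>F n in sequentially. \<forall>s\<in>{0..1}. dist (pert_form D (F n s) (circ p \<epsilon> s) (circ_vel p \<epsilon> s)) (pert_form D C (circ p \<epsilon> s) (circ_vel p \<epsilon> s)) < e"
    proof (rule eventually_mono, intro ballI)
      fix n and s :: real assume n: "\<forall>s\<in>{0..1}. dist (F n s) C < e / M" and s: "s \<in> {0..1}"
      have "dist (pert_form D (F n s) (circ p \<epsilon> s) (circ_vel p \<epsilon> s)) (pert_form D C (circ p \<epsilon> s) (circ_vel p \<epsilon> s)) \<le> M * norm (F n s - C)"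
        unfolding dist_norm pert_form_linear(2)[symmetric] by (rule M[OF s])
      also have "\<dots> < e" using bspec[OF n s] M0 by (simp add: dist_norm pos_less_divide_eq mult.commute)
      finally show "dist (pert_form D (F n s) (circ p \<epsilon> s) (circ_vel p \<epsilon> s)) (pert_form D C (circ p \<epsilon> s) (circ_vel p \<epsilon> s)) < e" .
    qed
  qed
  obtain I J where IJ: "\<And>n. ((\<lambda>s. pert_form D (F n s) (circ p \<epsilon> s) (circ_vel p \<epsilon> s)) has_integral I n) {0..1}"
      "((\<lambda>s. pert_form D C (circ p \<epsilon> s) (circ_vel p \<epsilon> s)) has_integral J) {0..1}" "I \<longlonglongrightarrow> J"
    by (rule uniform_limit_integral[OF u' pert_form_path_continuous[OF circ_continuous avoid F] sequentially_bot]) auto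
  then show ?thesis by (simp add: loop_int_def integral_unique[OF IJ(1)] integral_unique[OF IJ(2)])
qed

end

text \<open>Only the residue at p contributes. The conjugated form contributes with - 2 pi i instead
  of 2 pi i, which turns the sum into a commutator.\<close>

lemma loop_int_const:
  assumes D: "D = ((p, P), (q, Q), (r, R))" and \<epsilon>: "0 < \<epsilon>" "\<epsilon> < norm (q - p)" "\<epsilon> < norm (r - p)"
  shows "loop_int D p \<epsilon> (\<lambda>s. C) = cscale (2 * of_real pi * \<i>) (C ** P - P ** C)"
proof -
  have h1: "((\<lambda>s. circ_vel p \<epsilon> s / (circ p \<epsilon> s - p)) has_integral 2 * of_real pi * \<i>) {0..1}"
  proof -
    have "circ p \<epsilon> s \<noteq> p" for s using circ_dist[of \<epsilon> p s] \<epsilon> by auto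
    then have "circ_vel p \<epsilon> s / (circ p \<epsilon> s - p) = 2 * of_real pi * \<i>" for s by (simp add: circ_vel_def)
    then show ?thesis using has_integral_const_real[of "2 * of_real pi * \<i>" 0 1] by simp
  qed
  have h2: "((\<lambda>s. circ_vel p \<epsilon> s / (circ p \<epsilon> s - q)) has_integral 0) {0..1}"
    by (rule circ_integral_outside[OF \<epsilon>(1,2)])
  have h3: "((\<lambda>s. circ_vel p \<epsilon> s / (circ p \<epsilon> s - r)) has_integral 0) {0..1}"
    by (rule circ_integral_outside[OF \<epsilon>(1,3)])
  have bl: "bounded_linear (\<lambda>z. C ** cscale z A + cscale (cnj z) A ** C)" for A
  proof
    show "\<exists>K. \<forall>z. norm (C ** cscale z A + cscale (cnj z) A ** C) \<le> norm z * K"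
    proof (intro exI allI)
      fix z
      have "norm (C ** cscale z A + cscale (cnj z) A ** C) \<le> norm C * norm (cscale z A) * 8 + norm (cscale (cnj z) A) * norm C * 8"
        using norm_triangle_ineq[of "C ** cscale z A" "cscale (cnj z) A ** C"] norm_cmat_mult_le[of C "cscale z A"]
          norm_cmat_mult_le[of "cscale (cnj z) A" C] by linarith
      also have "\<dots> \<le> norm C * (4 * norm z * norm A) * 8 + (4 * norm (cnj z) * norm A) * norm C * 8"
        by (intro add_mono mult_right_mono mult_left_mono norm_cscale_le) auto
      also have "\<dots> = norm z * (64 * norm C * norm A)" by simp
      finally show "norm (C ** cscale z A + cscale (cnj z) A ** C) \<le> norm z * (64 * norm C * norm A)" .
    qed
  qed (simp_all add: cmat_eq_iff cmat_mult_entry scaleR_conv_of_real[where 'a = complex] algebra_simps)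
  have "((\<lambda>s. pert_form D C (circ p \<epsilon> s) (circ_vel p \<epsilon> s)) has_integral
      (C ** cscale (2 * of_real pi * \<i>) P + cscale (cnj (2 * of_real pi * \<i>)) P ** C) + (C ** cscale 0 Q + cscale (cnj 0) Q ** C)
       + (C ** cscale 0 R + cscale (cnj 0) R ** C)) {0..1}"
    using has_integral_add[OF has_integral_add[OF has_integral_linear[OF h1 bl[of P]] has_integral_linear[OF h2 bl[of Q]]]
         has_integral_linear[OF h3 bl[of R]]]
    by (simp add: D comp_def pert_form_def pole_form_def pole_form_cnj_def matrix_add_ldistrib
        bounded_bilinear.add_left[OF bounded_bilinear_cmat_mult] add_ac)
  then have "loop_int D p \<epsilon> (\<lambda>s. C) = (C ** cscale (2 * of_real pi * \<i>) P + cscale (cnj (2 * of_real pi * \<i>)) P ** C) + (C ** cscale 0 Q + cscale (cnj 0) Q ** C)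
       + (C ** cscale 0 R + cscale (cnj 0) R ** C)"
    unfolding loop_int_def by (rule integral_unique)
  then show ?thesis by (simp add: cmat_eq_iff cmat_mult_entry algebra_simps)
qed

lemma mult_ln_tendsto: "((\<lambda>t. (t - p) * of_real (ln (norm (t - p)))) \<longlongrightarrow> 0) (at (p::complex))"
proof -
  have "((\<lambda>x::real. x * ln x) \<longlongrightarrow> 0) (at_right 0)" by real_asymp
  moreover have "filterlim (\<lambda>t. norm (t - p)) (at_right 0) (at p)"
    unfolding filterlim_at
    by (intro conjI tendsto_eq_intros refl eventually_at_filter[THEN iffD2])
       (auto intro!: tendsto_eq_intros eventually_at_topological[THEN iffD2] exI[of _ UNIV])
  ultimately have "((\<lambda>t. norm (t - p) * ln (norm (t - p))) \<longlongrightarrow> 0) (at p)"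
    by (rule filterlim_compose)
  then have "((\<lambda>t. norm ((t - p) * of_real (ln (norm (t - p))))) \<longlongrightarrow> 0) (at p)"
    by (intro tendsto_norm_zero_cancel[where f = "\<lambda>t. norm ((t - p) * of_real (ln (norm (t - p))))"])
       (auto simp: norm_mult abs_mult dest: tendsto_rabs_zero)
  then show ?thesis by (rule tendsto_norm_zero_cancel)
qed

text \<open>As the loop around \<open>p\<close> shrinks, only the pole at \<open>p\<close> and the value at \<open>p\<close> of the other logarithms survive.\<close>

lemma loop_integrand_limit:
  assumes D: "D = ((p, P), (q, Q), (r, R))" and ne: "p \<noteq> q" "p \<noteq> r"
  shows "((\<lambda>t. trace (Q ** pert_form D (log_pot D t) t (2 * of_real pi * \<i> * (t - p)))) \<longlongrightarrow>
     2 * of_real pi * \<i> * of_real (2 * ln (norm (p - r))) * trace (Q ** (R ** P - P ** R))) (at p)"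
proof -
  define c where "c = 2 * of_real pi * \<i>"
  define lp where "lp t = complex_of_real (2 * ln (norm (t - p)))" for t
  define lq where "lq t = complex_of_real (2 * ln (norm (t - q)))" for t
  define lr where "lr t = complex_of_real (2 * ln (norm (t - r)))" for t
  define wq where "wq t = c * (t - p) / (t - q)" for t
  define wr where "wr t = c * (t - p) / (t - r)" for t
  have tq: "(lq \<longlongrightarrow> lq p) (at p)" unfolding lq_def using ne by (auto intro!: tendsto_eq_intros)
  have tr: "(lr \<longlongrightarrow> lr p) (at p)" unfolding lr_def using ne by (auto intro!: tendsto_eq_intros)
  have twq: "(wq \<longlongrightarrow> 0) (at p)" unfolding wq_def using ne by (auto intro!: tendsto_eq_intros)
  have twr: "(wr \<longlongrightarrow> 0) (at p)" unfolding wr_def using ne by (auto intro!: tendsto_eq_intros)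
  have lpw: "((\<lambda>t. lp t * (c * (t - p) / (t - z))) \<longlongrightarrow> 0) (at p)" if "p \<noteq> z" for z
  proof -
    have "((\<lambda>t. (2 * c / (t - z)) * ((t - p) * of_real (ln (norm (t - p))))) \<longlongrightarrow> (2 * c / (p - z)) * 0) (at p)"
      using that by (intro tendsto_mult mult_ln_tendsto tendsto_divide tendsto_intros) auto
    then show ?thesis by (simp add: lp_def mult_ac)
  qed
  have lpw': "((\<lambda>t. lp t * cnj (c * (t - p) / (t - z))) \<longlongrightarrow> 0) (at p)" if "p \<noteq> z" for z
  proof -
    have "((\<lambda>t. cnj (lp t * (c * (t - p) / (t - z)))) \<longlongrightarrow> cnj 0) (at p)" by (intro tendsto_cnj lpw that)
    then show ?thesis by (simp add: lp_def)
  qed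
  define k where "k X Y = trace (Q ** (X ** Y))" for X Y :: cmat
  have kl: "k (A + B) Y = k A Y + k B Y" "k Y (A + B) = k Y A + k Y B" "k (cscale z A) Y = z * k A Y" "k Y (cscale z A) = z * k Y A"
    for A B Y z
    by (simp_all add: k_def trace_2 cmat_mult_entry algebra_simps)
  have sc: "x *\<^sub>R A = cscale (of_real x) A" for x and A :: cmat
    by (simp add: cmat_eq_iff scaleR_conv_of_real[where 'a = complex])
  have lp: "log_pot D t = cscale (lp t) P + cscale (lq t) Q + cscale (lr t) R" for t
    by (simp only: D log_pot_def prod.case sc lp_def lq_def lr_def)
  \<comment> \<open>The divergent product of \<open>lp\<close> with the residue at p cancels because
    cnj c = - c, and the corresponding \<open>lq\<close> terms cancel because trace (Q Q P) = trace
    (Q P Q). This is the reason for pairing with Q; of the terms with the factor \<open>c\<close>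
    only the one with \<open>lr\<close> survives.\<close>
  let ?f = "\<lambda>t. lr t * c * (k R P - k P R)
     + ((lp t * wq t) * k P Q + (lp t * wr t) * k P R + lq t * wq t * k Q Q + lq t * wr t * k Q R + lr t * wq t * k R Q + lr t * wr t * k R R
     + (lp t * cnj (wq t)) * k Q P + (lp t * cnj (wr t)) * k R P + lq t * cnj (wq t) * k Q Q + lq t * cnj (wr t) * k R Q
     + lr t * cnj (wq t) * k Q R + lr t * cnj (wr t) * k R R)"
  have eq: "trace (Q ** pert_form D (log_pot D t) t (c * (t - p))) = ?f t" if "t \<noteq> p" for t
  proof -
    have cc: "cnj c = - c" by (simp add: c_def)
    have w: "c * (t - p) / (t - p) = c" using that by simp
    have QP: "k Q P = k P Q" by (simp add: k_def trace_2 cmat_mult_entry algebra_simps)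
    have "trace (Q ** pert_form D (log_pot D t) t (c * (t - p)))
      = k (log_pot D t) (cscale c P + cscale (wq t) Q + cscale (wr t) R)
      + k (cscale (cnj c) P + cscale (cnj (wq t)) Q + cscale (cnj (wr t)) R) (log_pot D t)"
      by (simp add: pert_form_def pole_form_def pole_form_cnj_def D w wq_def[symmetric] wr_def[symmetric] k_def
          matrix_add_ldistrib trace_add del: complex_cnj_divide)
    also have "\<dots> = ?f t" unfolding lp kl cc using QP by (simp add: algebra_simps)
    finally show ?thesis .
  qed
  have "(?f \<longlongrightarrow> lr p * c * (k R P - k P R)
     + (0 * k P Q + 0 * k P R + lq p * 0 * k Q Q + lq p * 0 * k Q R + lr p * 0 * k R Q + lr p * 0 * k R R
     + 0 * k Q P + 0 * k R P + lq p * cnj 0 * k Q Q + lq p * cnj 0 * k R Q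
     + lr p * cnj 0 * k Q R + lr p * cnj 0 * k R R)) (at p)"
    using lpw[OF ne(1)] lpw[OF ne(2)] lpw'[OF ne(1)] lpw'[OF ne(2)]
    by (intro tendsto_intros tq tr twq twr) (simp_all only: wq_def wr_def)
  then have "(?f \<longlongrightarrow> lr p * c * (k R P - k P R)) (at p)" by simp
  then have "((\<lambda>t. trace (Q ** pert_form D (log_pot D t) t (c * (t - p)))) \<longlongrightarrow> lr p * c * (k R P - k P R)) (at p)"
    by (rule Lim_transform_eventually) (auto simp: eventually_at_filter eq)
  moreover have "k R P - k P R = trace (Q ** (R ** P - P ** R))"
    by (simp add: k_def trace_2 cmat_mult_entry algebra_simps)
  ultimately show ?thesis by (simp add: c_def lr_def mult_ac)
qed

lemma circle_average_limit:
  fixes f :: "complex \<Rightarrow> complex"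
  assumes lim: "(f \<longlongrightarrow> l) (at p)" and int: "\<And>\<epsilon>. 0 < \<epsilon> \<Longrightarrow> \<epsilon> < \<epsilon>0 \<Longrightarrow> (\<lambda>s. f (circ p \<epsilon> s)) integrable_on {0..1}"
    and \<epsilon>0: "0 < \<epsilon>0"
  shows "((\<lambda>\<epsilon>. integral {0..1} (\<lambda>s. f (circ p \<epsilon> s))) \<longlongrightarrow> l) (at_right 0)"
proof (rule tendstoI)
  fix e :: real assume e: "0 < e"
  then obtain d where d: "0 < d" "\<And>t. t \<noteq> p \<Longrightarrow> norm (t - p) < d \<Longrightarrow> norm (f t - l) < e / 2"
    using lim unfolding LIM_eq by (metis half_gt_zero)
  have "\<forall>\<^sub>F \<epsilon> in at_right (0::real). \<epsilon> < min d \<epsilon>0 \<and> 0 < \<epsilon>"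
    using d \<epsilon>0 by (intro eventually_conj eventually_at_right_less)
      (auto intro!: eventually_at_right_field[THEN iffD2] exI[of _ "min d \<epsilon>0"])
  then show "\<forall>\<^sub>F \<epsilon> in at_right 0. dist (integral {0..1} (\<lambda>s. f (circ p \<epsilon> s))) l < e"
  proof (rule eventually_mono)
    fix \<epsilon> :: real assume \<epsilon>: "\<epsilon> < min d \<epsilon>0 \<and> 0 < \<epsilon>"
    have ne: "circ p \<epsilon> s \<noteq> p" for s using circ_dist[of \<epsilon> p s] \<epsilon> by auto
    have "norm (integral {0..1} (\<lambda>s. f (circ p \<epsilon> s) - l)) \<le> integral {0..1} (\<lambda>s::real. e / 2)"
    proof (rule integral_norm_bound_integral)
      show "(\<lambda>s. f (circ p \<epsilon> s) - l) integrable_on {0..1}"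
        using int \<epsilon> by (intro integrable_diff) auto
      show "norm (f (circ p \<epsilon> s) - l) \<le> e / 2" for s
        using d(2)[OF ne[of s]] circ_dist[of \<epsilon> p s] \<epsilon> by simp
    qed auto
    moreover have "integral {0..1} (\<lambda>s. f (circ p \<epsilon> s) - l) = integral {0..1} (\<lambda>s. f (circ p \<epsilon> s)) - l"
      using int \<epsilon> by (subst integral_diff) auto
    ultimately show "dist (integral {0..1} (\<lambda>s. f (circ p \<epsilon> s))) l < e" using e by (simp add: dist_norm)
  qed
qed

text \<open>The loop lemmas treat the first pole of the triple; the symmetry transfers them to the
  second.\<close>

lemma pole_swap:
  "pert_form (x, y, z) = pert_form (y, x, z)" "pole_set (x, y, z) = pole_set (y, x, z)"
  "log_pot (x, y, z) = log_pot (y, x, z)"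
  by (cases x; cases y; cases z; simp add: fun_eq_iff pert_form_def pole_form_def pole_form_cnj_def pole_set_def log_pot_def
      add_ac insert_commute)+

lemma circ_avoids:
  assumes D: "D = ((p, P), (q, Q), (r, R))" and \<epsilon>: "0 < \<epsilon>" "\<epsilon> < norm (q - p)" "\<epsilon> < norm (r - p)"
  shows "circ p \<epsilon> ` S \<subseteq> - pole_set D"
proof -
  have "circ p \<epsilon> s \<noteq> z" if "z \<in> {p, q, r}" for s z
    using circ_dist[of \<epsilon> p s] \<epsilon> that by (auto simp: norm_minus_commute)
  then show ?thesis by (auto simp: D pole_set_def)
qed

lemma linear_path_deriv: "((\<lambda>s::real. c + of_real s * (d - c)) has_vector_derivative (d - c)) (at s within S)" for c d :: complex
  unfolding has_vector_derivative_def
  by (auto intro!: derivative_eq_intros simp: scaleR_conv_of_real)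

text \<open>The loop integral of each solution is 0. Its limit gives the first claim. For the
  second, the loop integral of the rescaled difference is evaluated in two ways: by linearity, where
  the solution itself drops out, and through its constant limit.\<close>

lemma loop_limits:
  assumes D: "D = ((p, P), (q, Q), (r, R))" and \<epsilon>: "0 < \<epsilon>" "\<epsilon> < norm (q - p)" "\<epsilon> < norm (r - p)"
    and seg: "closed_segment c (p + of_real \<epsilon>) \<subseteq> - pole_set D"
    and sol: "\<And>n. pert_sol D (a n) (\<Gamma> n)" and a0: "a \<longlonglongrightarrow> 0" and nz: "\<And>n. a n \<noteq> 0"
    and lim: "(\<lambda>n. \<Gamma> n c) \<longlonglongrightarrow> \<gamma>"
  shows "\<gamma> ** P = P ** \<gamma>"
    and "\<gamma> = \<kappa> *\<^sub>R mat 1 \<Longrightarrow> (\<lambda>n. \<kappa> *\<^sub>R loop_int D p \<epsilon> (\<lambda>s. log_pot D (circ p \<epsilon> s))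
        - cscale (2 * of_real pi * \<i>) (\<Gamma> n c ** P - P ** \<Gamma> n c) /\<^sub>R a n)
      \<longlonglongrightarrow> cscale (2 * of_real pi * \<i>) ((\<kappa> *\<^sub>R log_pot D c) ** P - P ** (\<kappa> *\<^sub>R log_pot D c))"
proof -
  let ?\<eta> = "\<lambda>s::real. c + of_real s * (p + of_real \<epsilon> - c)"
  have img: "?\<eta> ` {0..1} \<subseteq> - pole_set D"
    using segment_point[of _ c "p + of_real \<epsilon>"] seg by blast
  have av: "circ p \<epsilon> ` {0..1} \<subseteq> - pole_set D" by (rule circ_avoids[OF D \<epsilon>])
  have st: "?\<eta> 1 = circ p \<epsilon> 0" "?\<eta> 0 = c" by (simp_all add: circ_def)
  note p1 = pert_path_limits[where \<eta> = ?\<eta> and \<eta>' = "\<lambda>s. p + of_real \<epsilon> - c", OF linear_path_deriv continuous_on_const img sol a0 nz]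
  note p2 = pert_path_limits[where \<eta> = "circ p \<epsilon>" and \<eta>' = "circ_vel p \<epsilon>", OF circ_deriv circ_continuous(2) av sol a0 nz]
  have "uniform_limit {0..1} (\<lambda>n s. \<Gamma> n (?\<eta> s)) (\<lambda>s. \<gamma>) sequentially"
    by (rule p1(1)) (use lim in simp)
  from tendsto_uniform_limitI[OF this, of 1] have l1: "(\<lambda>n. \<Gamma> n (circ p \<epsilon> 0)) \<longlonglongrightarrow> \<gamma>" unfolding st by simp
  have c\<Gamma>: "continuous_on {0..1} (\<lambda>s. \<Gamma> n (circ p \<epsilon> s))" for n
  proof -
    have "continuous_on (- pole_set D) (\<Gamma> n)"
      unfolding continuous_on_eq_continuous_within
      using has_derivative_continuous[OF pert_solD[OF sol]] continuous_at_imp_continuous_at_within by blast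
    then show ?thesis using av by (rule continuous_on_compose2[OF _ circ_continuous(1)])
  qed
  have cL: "continuous_on {0..1} (\<lambda>s. log_pot D (circ p \<epsilon> s))"
  proof -
    have "continuous_on (- pole_set D) (log_pot D)"
      unfolding continuous_on_eq_continuous_within
      using has_derivative_continuous[OF log_pot_deriv] continuous_at_imp_continuous_at_within by blast
    then show ?thesis using av by (rule continuous_on_compose2[OF _ circ_continuous(1)])
  qed
  have "(\<lambda>n. loop_int D p \<epsilon> (\<lambda>s. \<Gamma> n (circ p \<epsilon> s))) \<longlonglongrightarrow> loop_int D p \<epsilon> (\<lambda>s. \<gamma>)"
    by (rule loop_int_tendsto[OF av c\<Gamma> p2(1)[OF l1]])
  then have "(\<lambda>n. 0) \<longlonglongrightarrow> loop_int D p \<epsilon> (\<lambda>s. \<gamma>)"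
    unfolding loop_int_sol[OF av sol nz] .
  then have "cscale (2 * of_real pi * \<i>) (\<gamma> ** P - P ** \<gamma>) = 0"
    unfolding loop_int_const[OF D \<epsilon>] using LIMSEQ_unique[OF tendsto_const] by metis
  then show "\<gamma> ** P = P ** \<gamma>" by (simp add: cmat_eq_iff)
  assume \<gamma>: "\<gamma> = \<kappa> *\<^sub>R mat 1"
  \<comment> \<open>The constant subtracted is the value at \<open>c\<close>, so that at
    \<open>c\<close> this expression equals \<kappa> \<open>log_pot D c\<close> for every n;
    \<open>pert_path_limits\<close> then moves the limit first to the circle and then around
    it.\<close>
  let ?h = "\<lambda>n t. (\<Gamma> n t - \<Gamma> n c) /\<^sub>R a n + \<kappa> *\<^sub>R log_pot D t"
  have "uniform_limit {0..1} (\<lambda>n s. ?h n (?\<eta> s)) (\<lambda>s. \<kappa> *\<^sub>R log_pot D c) sequentially"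
    by (rule p1(2)) (use lim \<gamma> in simp_all)
  from tendsto_uniform_limitI[OF this, of 1] have l2: "(\<lambda>n. ?h n (circ p \<epsilon> 0)) \<longlonglongrightarrow> \<kappa> *\<^sub>R log_pot D c"
    unfolding st by simp
  have u: "uniform_limit {0..1} (\<lambda>n s. ?h n (circ p \<epsilon> s)) (\<lambda>s. \<kappa> *\<^sub>R log_pot D c) sequentially"
    by (rule p2(2)[OF l1 \<gamma> l2])
  have "(\<lambda>n. loop_int D p \<epsilon> (\<lambda>s. ?h n (circ p \<epsilon> s))) \<longlonglongrightarrow> loop_int D p \<epsilon> (\<lambda>s. \<kappa> *\<^sub>R log_pot D c)"
    by (rule loop_int_tendsto[OF av _ u]) (intro continuous_intros c\<Gamma> cL)
  moreover have "loop_int D p \<epsilon> (\<lambda>s. ?h n (circ p \<epsilon> s)) = \<kappa> *\<^sub>R loop_int D p \<epsilon> (\<lambda>s. log_pot D (circ p \<epsilon> s))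
        - cscale (2 * of_real pi * \<i>) (\<Gamma> n c ** P - P ** \<Gamma> n c) /\<^sub>R a n" for n
  proof -
    have "loop_int D p \<epsilon> (\<lambda>s. ?h n (circ p \<epsilon> s))
      = loop_int D p \<epsilon> (\<lambda>s. inverse (a n) *\<^sub>R (\<Gamma> n (circ p \<epsilon> s) - \<Gamma> n c)) + loop_int D p \<epsilon> (\<lambda>s. \<kappa> *\<^sub>R log_pot D (circ p \<epsilon> s))"
      by (rule loop_int_linear(1)[OF av]) (intro continuous_intros c\<Gamma> cL)+
    also have "loop_int D p \<epsilon> (\<lambda>s. \<kappa> *\<^sub>R log_pot D (circ p \<epsilon> s)) = \<kappa> *\<^sub>R loop_int D p \<epsilon> (\<lambda>s. log_pot D (circ p \<epsilon> s))"
      by (rule loop_int_linear(3)[OF av cL cL])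
    also have "loop_int D p \<epsilon> (\<lambda>s. inverse (a n) *\<^sub>R (\<Gamma> n (circ p \<epsilon> s) - \<Gamma> n c))
      = inverse (a n) *\<^sub>R loop_int D p \<epsilon> (\<lambda>s. \<Gamma> n (circ p \<epsilon> s) - \<Gamma> n c)"
      by (rule loop_int_linear(3)[OF av _ cL]) (intro continuous_intros c\<Gamma>)
    also have "loop_int D p \<epsilon> (\<lambda>s. \<Gamma> n (circ p \<epsilon> s) - \<Gamma> n c) = loop_int D p \<epsilon> (\<lambda>s. \<Gamma> n (circ p \<epsilon> s)) - loop_int D p \<epsilon> (\<lambda>s. \<Gamma> n c)"
      by (rule loop_int_linear(2)[OF av c\<Gamma> continuous_on_const])
    finally show ?thesis by (simp add: loop_int_sol[OF av sol nz] loop_int_const[OF D \<epsilon>])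
  qed
  ultimately show "(\<lambda>n. \<kappa> *\<^sub>R loop_int D p \<epsilon> (\<lambda>s. log_pot D (circ p \<epsilon> s))
        - cscale (2 * of_real pi * \<i>) (\<Gamma> n c ** P - P ** \<Gamma> n c) /\<^sub>R a n)
      \<longlonglongrightarrow> cscale (2 * of_real pi * \<i>) ((\<kappa> *\<^sub>R log_pot D c) ** P - P ** (\<kappa> *\<^sub>R log_pot D c))"
    unfolding loop_int_const[OF D \<epsilon>] by simp
qed

lemma trace_mult_bounded_linear: "bounded_linear (\<lambda>A::cmat. trace ((Q::cmat) ** A))"
proof
  show "\<exists>K. \<forall>A::cmat. norm (trace (Q ** A)) \<le> norm A * K"
  proof (intro exI allI)
    fix A :: cmat
    have "norm (trace (Q ** A)) \<le> norm ((Q ** A)$1$1) + norm ((Q ** A)$2$2)"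
      unfolding trace_2 by (rule norm_triangle_ineq)
    also have "\<dots> \<le> 2 * norm (Q ** A)" using norm_entry_le[of "Q ** A" 1 1] norm_entry_le[of "Q ** A" 2 2] by simp
    also have "\<dots> \<le> 2 * (norm Q * norm A * 8)" by (intro mult_left_mono norm_cmat_mult_le) auto
    finally show "norm (trace (Q ** A)) \<le> norm A * (16 * norm Q)" by (simp add: mult_ac)
  qed
qed (simp_all add: trace_2 cmat_mult_entry scaleR_conv_of_real[where 'a = complex] algebra_simps)

text \<open>On the circle \<open>circ_vel\<close> is 2 pi i (t - p), so the loop integral is an
  average over the circle of the function treated in \<open>loop_integrand_limit\<close>.\<close>

lemma loop_trace_limit:
  assumes D: "D = ((p, P), (q, Q), (r, R))" and ne: "p \<noteq> q" "p \<noteq> r"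
  shows "((\<lambda>\<epsilon>. trace (Q ** loop_int D p \<epsilon> (\<lambda>s. log_pot D (circ p \<epsilon> s)))) \<longlongrightarrow>
     2 * of_real pi * \<i> * of_real (2 * ln (norm (p - r))) * trace (Q ** (R ** P - P ** R))) (at_right 0)"
proof -
  let ?f = "\<lambda>t. trace (Q ** pert_form D (log_pot D t) t (2 * of_real pi * \<i> * (t - p)))"
  define \<epsilon>0 where "\<epsilon>0 = min (norm (q - p)) (norm (r - p))"
  have e0: "0 < \<epsilon>0" using ne by (simp add: \<epsilon>0_def)
  have cL: "continuous_on (- pole_set D) (log_pot D)"
    unfolding continuous_on_eq_continuous_within
    using has_derivative_continuous[OF log_pot_deriv] continuous_at_imp_continuous_at_within by blast
  have int: "(\<lambda>s. pert_form D (log_pot D (circ p \<epsilon> s)) (circ p \<epsilon> s) (circ_vel p \<epsilon> s)) integrable_on {0..1}"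
    if "0 < \<epsilon>" "\<epsilon> < \<epsilon>0" for \<epsilon>
  proof -
    have av: "circ p \<epsilon> ` {0..1} \<subseteq> - pole_set D" using that by (intro circ_avoids[OF D]) (auto simp: \<epsilon>0_def)
    show ?thesis by (rule loop_int_integrable[OF av continuous_on_compose2[OF cL circ_continuous(1) av]])
  qed
  have lin: "(\<lambda>s. ?f (circ p \<epsilon> s)) = (\<lambda>A. trace (Q ** A)) \<circ> (\<lambda>s. pert_form D (log_pot D (circ p \<epsilon> s)) (circ p \<epsilon> s) (circ_vel p \<epsilon> s))" for \<epsilon>
    by (simp add: comp_def circ_vel_def)
  have "((\<lambda>\<epsilon>. integral {0..1} (\<lambda>s. ?f (circ p \<epsilon> s))) \<longlongrightarrow>
     2 * of_real pi * \<i> * of_real (2 * ln (norm (p - r))) * trace (Q ** (R ** P - P ** R))) (at_right 0)"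
  proof (rule circle_average_limit[OF loop_integrand_limit[OF D ne] _ e0])
    fix \<epsilon> :: real assume "0 < \<epsilon>" "\<epsilon> < \<epsilon>0"
    from integrable_linear[OF int[OF this] trace_mult_bounded_linear[of Q]]
    show "(\<lambda>s. ?f (circ p \<epsilon> s)) integrable_on {0..1}" unfolding lin .
  qed
  moreover have "\<forall>\<^sub>F \<epsilon> in at_right 0. integral {0..1} (\<lambda>s. ?f (circ p \<epsilon> s)) = trace (Q ** loop_int D p \<epsilon> (\<lambda>s. log_pot D (circ p \<epsilon> s)))"
  proof -
    have "\<forall>\<^sub>F \<epsilon> in at_right (0::real). 0 < \<epsilon> \<and> \<epsilon> < \<epsilon>0"
      using e0 by (auto intro!: eventually_at_right_field[THEN iffD2] exI[of _ "\<epsilon>0"])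
    then show ?thesis
    proof (rule eventually_mono)
      fix \<epsilon> :: real assume "0 < \<epsilon> \<and> \<epsilon> < \<epsilon>0"
      then show "integral {0..1} (\<lambda>s. ?f (circ p \<epsilon> s)) = trace (Q ** loop_int D p \<epsilon> (\<lambda>s. log_pot D (circ p \<epsilon> s)))"
        unfolding lin loop_int_def using integral_linear[OF int trace_mult_bounded_linear[of Q]] by blast
    qed
  qed
  ultimately show ?thesis by (rule Lim_transform_eventually)
qed

lemma trace_commutator_antisym:
  fixes G P Q :: cmat
  shows "trace (Q ** cscale z (G ** P - P ** G)) + trace (P ** cscale z (G ** Q - Q ** G)) = 0"
  by (simp add: trace_2 cmat_mult_entry algebra_simps)

text \<open>The terms (\<Gamma> P - P \<Gamma>) / a in \<open>loop_limits\<close> come without a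
  bound of their own. Pairing the relation around p with Q and the relation around q with P and
  adding them cancels these terms exactly, by cyclicity of the trace. The two paired loop integrals
  of \<open>log_pot\<close> thus add up to 0 for all small circles; as the circles shrink, their sum
  tends to 4 pi i (ln |p - r| - ln |q - r|) trace (Q (R P - P R)).\<close>

lemma pert_obstruction:
  assumes D: "D = ((p, P), (q, Q), (r, R))" and ne: "p \<noteq> q" "p \<noteq> r" "q \<noteq> r"
    and sol: "\<And>n. pert_sol D (a n) (\<Gamma> n)" and a0: "a \<longlonglongrightarrow> 0" and nz: "\<And>n. a n \<noteq> 0"
    and lim: "(\<lambda>n. \<Gamma> n c) \<longlonglongrightarrow> \<gamma>" and \<epsilon>0: "0 < \<epsilon>0"
    and seg: "\<And>\<epsilon> z. 0 < \<epsilon> \<Longrightarrow> \<epsilon> < \<epsilon>0 \<Longrightarrow> z \<in> {p, q} \<Longrightarrow> closed_segment c (z + of_real \<epsilon>) \<subseteq> - pole_set D"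
  shows "\<gamma> ** P = P ** \<gamma>" "\<gamma> ** Q = Q ** \<gamma>"
    and "\<gamma> = \<kappa> *\<^sub>R mat 1 \<Longrightarrow> \<kappa> \<noteq> 0 \<Longrightarrow> trace (Q ** (R ** P - P ** R)) \<noteq> 0 \<Longrightarrow> norm (p - r) = norm (q - r)"
proof -
  define D' where "D' = ((q, Q), (p, P), (r, R))"
  have sw: "pert_form D' = pert_form D" "pole_set D' = pole_set D" "log_pot D' = log_pot D"
    unfolding D D'_def by (rule pole_swap)+
  have sol': "pert_sol D' (a n) (\<Gamma> n)" for n using sol[of n] unfolding pert_sol_def sw .
  define \<epsilon>1 where "\<epsilon>1 = min \<epsilon>0 (min (norm (q - p)) (min (norm (r - p)) (norm (r - q))))"
  have e1: "0 < \<epsilon>1" using ne \<epsilon>0 by (simp add: \<epsilon>1_def)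
  have cond: "0 < \<epsilon>" "\<epsilon> < norm (q - p)" "\<epsilon> < norm (r - p)" "\<epsilon> < norm (p - q)" "\<epsilon> < norm (r - q)"
     "closed_segment c (p + of_real \<epsilon>) \<subseteq> - pole_set D" "closed_segment c (q + of_real \<epsilon>) \<subseteq> - pole_set D'"
    if "0 < \<epsilon>" "\<epsilon> < \<epsilon>1" for \<epsilon>
    using that seg[of \<epsilon> p] seg[of \<epsilon> q] by (auto simp: \<epsilon>1_def sw norm_minus_commute)
  have LP1: "\<gamma> ** P = P ** \<gamma>" if "0 < \<epsilon>" "\<epsilon> < \<epsilon>1" for \<epsilon>
    by (rule loop_limits(1)[OF D cond(1,2,3,6)[OF that] sol a0 nz lim])
  have LP2: "\<gamma> = \<kappa> *\<^sub>R mat 1 \<Longrightarrow> (\<lambda>n. \<kappa> *\<^sub>R loop_int D p \<epsilon> (\<lambda>s. log_pot D (circ p \<epsilon> s))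
        - cscale (2 * of_real pi * \<i>) (\<Gamma> n c ** P - P ** \<Gamma> n c) /\<^sub>R a n)
      \<longlonglongrightarrow> cscale (2 * of_real pi * \<i>) ((\<kappa> *\<^sub>R log_pot D c) ** P - P ** (\<kappa> *\<^sub>R log_pot D c))"
    if "0 < \<epsilon>" "\<epsilon> < \<epsilon>1" for \<epsilon>
    by (rule loop_limits(2)[OF D cond(1,2,3,6)[OF that] sol a0 nz lim])
  have LQ1: "\<gamma> ** Q = Q ** \<gamma>" if "0 < \<epsilon>" "\<epsilon> < \<epsilon>1" for \<epsilon>
    by (rule loop_limits(1)[OF D'_def cond(1,4,5,7)[OF that] sol' a0 nz lim])
  have LQ2: "\<gamma> = \<kappa> *\<^sub>R mat 1 \<Longrightarrow> (\<lambda>n. \<kappa> *\<^sub>R loop_int D' q \<epsilon> (\<lambda>s. log_pot D' (circ q \<epsilon> s))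
        - cscale (2 * of_real pi * \<i>) (\<Gamma> n c ** Q - Q ** \<Gamma> n c) /\<^sub>R a n)
      \<longlonglongrightarrow> cscale (2 * of_real pi * \<i>) ((\<kappa> *\<^sub>R log_pot D' c) ** Q - Q ** (\<kappa> *\<^sub>R log_pot D' c))"
    if "0 < \<epsilon>" "\<epsilon> < \<epsilon>1" for \<epsilon>
    by (rule loop_limits(2)[OF D'_def cond(1,4,5,7)[OF that] sol' a0 nz lim])
  show "\<gamma> ** P = P ** \<gamma>" "\<gamma> ** Q = Q ** \<gamma>"
    using LP1[of "\<epsilon>1 / 2"] LQ1[of "\<epsilon>1 / 2"] e1 by auto
  assume \<gamma>: "\<gamma> = \<kappa> *\<^sub>R mat 1" and \<kappa>: "\<kappa> \<noteq> 0" and \<tau>: "trace (Q ** (R ** P - P ** R)) \<noteq> 0"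
  let ?I = "\<lambda>\<epsilon>. trace (Q ** loop_int D p \<epsilon> (\<lambda>s. log_pot D (circ p \<epsilon> s)))"
  let ?J = "\<lambda>\<epsilon>. trace (P ** loop_int D' q \<epsilon> (\<lambda>s. log_pot D' (circ q \<epsilon> s)))"
  have zero: "?I \<epsilon> + ?J \<epsilon> = 0" if \<epsilon>: "0 < \<epsilon>" "\<epsilon> < \<epsilon>1" for \<epsilon>
  proof -
    define z where "z = 2 * of_real pi * \<i>"
    define x where "x n = \<kappa> *\<^sub>R loop_int D p \<epsilon> (\<lambda>s. log_pot D (circ p \<epsilon> s)) - cscale z (\<Gamma> n c ** P - P ** \<Gamma> n c) /\<^sub>R a n" for n
    define y where "y n = \<kappa> *\<^sub>R loop_int D' q \<epsilon> (\<lambda>s. log_pot D' (circ q \<epsilon> s)) - cscale z (\<Gamma> n c ** Q - Q ** \<Gamma> n c) /\<^sub>R a n" for n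
    note lin = linear_simps[OF trace_mult_bounded_linear]
    have "(\<lambda>n. trace (Q ** x n) + trace (P ** y n)) \<longlonglongrightarrow> trace (Q ** cscale z ((\<kappa> *\<^sub>R log_pot D c) ** P - P ** (\<kappa> *\<^sub>R log_pot D c)))
       + trace (P ** cscale z ((\<kappa> *\<^sub>R log_pot D' c) ** Q - Q ** (\<kappa> *\<^sub>R log_pot D' c)))"
      unfolding x_def y_def z_def
      by (intro tendsto_add bounded_linear.tendsto[OF trace_mult_bounded_linear] LP2[OF \<epsilon> \<gamma>] LQ2[OF \<epsilon> \<gamma>])
    then have l0: "(\<lambda>n. trace (Q ** x n) + trace (P ** y n)) \<longlonglongrightarrow> 0"
      unfolding sw trace_commutator_antisym .
    have eq: "trace (Q ** x n) + trace (P ** y n) = \<kappa> *\<^sub>R (?I \<epsilon> + ?J \<epsilon>)" for n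
    proof -
      have "trace (Q ** x n) + trace (P ** y n) = \<kappa> *\<^sub>R (?I \<epsilon> + ?J \<epsilon>)
        - (trace (Q ** cscale z (\<Gamma> n c ** P - P ** \<Gamma> n c)) + trace (P ** cscale z (\<Gamma> n c ** Q - Q ** \<Gamma> n c))) /\<^sub>R a n"
        unfolding x_def y_def lin scaleR_add_right by simp
      then show ?thesis unfolding trace_commutator_antisym by simp
    qed
    have "\<kappa> *\<^sub>R (?I \<epsilon> + ?J \<epsilon>) = 0" using l0 unfolding eq by (rule LIMSEQ_const_iff[THEN iffD1])
    then show ?thesis using \<kappa> by simp
  qed
  define \<tau> where "\<tau> = trace (Q ** (R ** P - P ** R))"
  have "((\<lambda>\<epsilon>. ?I \<epsilon> + ?J \<epsilon>) \<longlongrightarrow> 2 * of_real pi * \<i> * of_real (2 * ln (norm (p - r))) * trace (Q ** (R ** P - P ** R))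
     + 2 * of_real pi * \<i> * of_real (2 * ln (norm (q - r))) * trace (P ** (R ** Q - Q ** R))) (at_right 0)"
    by (intro tendsto_add loop_trace_limit[OF D] loop_trace_limit[OF D'_def]) (use ne in auto)
  moreover have "trace (P ** (R ** Q - Q ** R)) = - \<tau>"
    by (simp add: \<tau>_def trace_2 cmat_mult_entry algebra_simps)
  ultimately have "((\<lambda>\<epsilon>. ?I \<epsilon> + ?J \<epsilon>) \<longlongrightarrow> 2 * of_real pi * \<i> * of_real (2 * ln (norm (p - r))) * \<tau>
     + 2 * of_real pi * \<i> * of_real (2 * ln (norm (q - r))) * - \<tau>) (at_right 0)"
    unfolding \<tau>_def by simp
  moreover have "((\<lambda>\<epsilon>. ?I \<epsilon> + ?J \<epsilon>) \<longlongrightarrow> 0) (at_right 0)"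
  proof (rule Lim_transform_eventually[OF tendsto_const])
    have "\<forall>\<^sub>F \<epsilon> in at_right (0::real). 0 < \<epsilon> \<and> \<epsilon> < \<epsilon>1"
      using e1 by (auto intro!: eventually_at_right_field[THEN iffD2] exI[of _ "\<epsilon>1"])
    then show "\<forall>\<^sub>F \<epsilon> in at_right 0. 0 = ?I \<epsilon> + ?J \<epsilon>" by (rule eventually_mono) (use zero in simp)
  qed
  ultimately have "2 * of_real pi * \<i> * of_real (2 * ln (norm (p - r))) * \<tau>
     + 2 * of_real pi * \<i> * of_real (2 * ln (norm (q - r))) * - \<tau> = 0"
    by (rule tendsto_unique[OF trivial_limit_at_right_real])
  then have "2 * of_real pi * \<i> * 2 * \<tau> * of_real (ln (norm (p - r)) - ln (norm (q - r))) = 0"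
    by (simp add: algebra_simps)
  then have "ln (norm (p - r)) = ln (norm (q - r))" using \<tau> by (simp add: \<tau>_def flip: of_real_diff)
  then show "norm (p - r) = norm (q - r)" using ne by simp
qed

section \<open>Parameters without a parallel form\<close>

lemma sep_base_exists:
  assumes P: "finite P" "c \<notin> P"
    and dir: "\<And>p p'. p \<in> P \<Longrightarrow> p' \<in> P \<Longrightarrow> p' \<noteq> p \<Longrightarrow> Im ((p' - c) / (p - c)) \<noteq> 0 \<or> Re ((p' - c) / (p - c)) < 0"
  shows "\<exists>\<epsilon>. sep_base \<epsilon> c P"
proof -
  have pair: "\<forall>\<^sub>F \<epsilon> in at_right 0. p' \<noteq> p \<longrightarrow> \<epsilon> * Re ((p' - c) / (p - c)) < \<bar>Im ((p' - c) / (p - c))\<bar>"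
    if "p \<in> P" "p' \<in> P" for p p'
  proof (cases "p' = p")
    case False
    define \<zeta> where "\<zeta> = (p' - c) / (p - c)"
    have "Im \<zeta> \<noteq> 0 \<or> Re \<zeta> < 0" using dir[OF that False] unfolding \<zeta>_def .
    then have "\<forall>\<^sub>F \<epsilon> in at_right 0. \<epsilon> * Re \<zeta> < \<bar>Im \<zeta>\<bar>"
    proof
      assume "Im \<zeta> \<noteq> 0"
      moreover have "((\<lambda>\<epsilon>. \<epsilon> * Re \<zeta>) \<longlongrightarrow> 0 * Re \<zeta>) (at_right 0)" by (intro tendsto_intros)
      ultimately show ?thesis by (intro order_tendstoD(2)) auto
    next
      assume "Re \<zeta> < 0"
      have "\<forall>\<^sub>F \<epsilon> in at_right (0::real). 0 < \<epsilon>" by (rule eventually_at_right_less)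
      then show ?thesis
      proof (rule eventually_mono)
        fix \<epsilon> :: real assume "0 < \<epsilon>"
        then have "\<epsilon> * Re \<zeta> < 0" using \<open>Re \<zeta> < 0\<close> by (rule mult_pos_neg)
        then show "\<epsilon> * Re \<zeta> < \<bar>Im \<zeta>\<bar>" by linarith
      qed
    qed
    then show ?thesis unfolding \<zeta>_def by (rule eventually_mono) simp
  qed simp
  have "\<forall>\<^sub>F \<epsilon> in at_right 0. \<forall>p\<in>P. \<forall>p'\<in>P. p' \<noteq> p \<longrightarrow> \<epsilon> * Re ((p' - c) / (p - c)) < \<bar>Im ((p' - c) / (p - c))\<bar>"
    by (intro eventually_ball_finite P(1) ballI pair)
  moreover have "\<forall>\<^sub>F \<epsilon> in at_right (0::real). 0 < \<epsilon>" by (rule eventually_at_right_less)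
  ultimately have "\<forall>\<^sub>F \<epsilon> in at_right 0. sep_base \<epsilon> c P"
    by eventually_elim (use P(2) in \<open>simp add: sep_base_def\<close>)
  then show ?thesis using eventually_happens[of _ "at_right (0::real)"] trivial_limit_at_right_real by blast
qed

lemma Im_divide_eq_0: "Im (a / b) = 0 \<longleftrightarrow> Im (a * cnj b) = 0" if "b \<noteq> 0"
proof -
  have "(Re b)\<^sup>2 + (Im b)\<^sup>2 \<noteq> 0" using that by (simp add: complex_eq_iff sum_power2_eq_zero_iff)
  then show ?thesis by (auto simp: Im_divide algebra_simps)
qed

lemma exists_not_preserving:
  assumes lam: "Im lam \<noteq> 0" "Re lam \<noteq> 1 / 2"
  shows "\<exists>a. \<not> preserves_herm_form lam a"
proof (rule ccontr)
  assume "\<not> ?thesis"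
  then have all: "preserves_herm_form lam a" for a by simp
  have M04: "lam \<in> M04" and lam': "lam \<noteq> 0" "lam \<noteq> 1" using lam by (auto simp: M04_def)
  define X where "X = - {0, 1, lam}"
  \<comment> \<open>The base point lies on the other side of the real axis from \<open>lam\<close>,
    so that segments from it to real points other than 0 and 1 avoid all poles.\<close>
  define c where "c = Complex (1 / 2) (- Im lam)"
  define a :: "nat \<Rightarrow> real" where "a n = 1 / Suc n" for n
  have a0: "a \<longlonglongrightarrow> 0" unfolding a_def by (rule LIMSEQ_Suc[OF lim_1_over_n])
  have anz: "a n \<noteq> 0" for n by (simp add: a_def)
  have seg: "closed_segment c (of_real x) \<subseteq> X" if x: "x \<noteq> 0" "x \<noteq> 1" for x :: real
  proof
    fix w assume "w \<in> closed_segment c (of_real x)"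
    then obtain u where u: "0 \<le> u" "u \<le> 1" "w = (1 - u) *\<^sub>R c + u *\<^sub>R of_real x" by (auto simp: closed_segment_def)
    have im: "Im w = - ((1 - u) * Im lam)" by (simp add: u(3) c_def)
    show "w \<in> X"
    proof (cases "u = 1")
      case True
      then have "w = of_real x" by (simp add: u(3))
      then show ?thesis using x lam(1) by (auto simp: X_def)
    next
      case False
      then have "Im w \<noteq> 0" using im lam(1) by simp
      moreover have "Im w \<noteq> Im lam"
      proof
        assume "Im w = Im lam"
        then have "(2 - u) * Im lam = 0" using im by (simp add: algebra_simps)
        then show False using u lam(1) by simp
      qed
      ultimately show ?thesis by (auto simp: X_def)
    qed
  qed
  have n: "lam - 1 / 2 \<noteq> 0"
  proof
    assume "lam - 1 / 2 = 0"
    then have "Im (lam - 1 / 2) = 0" by (simp only: zero_complex.sel)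
    then show False using lam(1) by simp
  qed
  \<comment> \<open>From 1/2 the poles 0 and 1 are seen in opposite directions and
    \<open>lam\<close> off the real line, so 1/2 is an admissible centre for the cuts. Nonvanishing
    of the forms at 1/2 is then carried to \<open>c\<close> along a segment.\<close>
  have "\<exists>\<epsilon>. sep_base \<epsilon> (1 / 2) {0, 1, lam}"
  proof (rule sep_base_exists)
    show "1 / 2 \<notin> {0, 1, lam}" using n by auto
    have nr: "Im (z / (lam - 1 / 2)) \<noteq> 0" if "z = 0 - 1 / 2 \<or> z = 1 - 1 / 2" for z
    proof -
      have e: "Im (z * cnj (lam - 1 / 2)) = - (Re z * Im lam)" and r: "Re z \<noteq> 0"
        using that by (elim disjE; hypsubst; simp)+
      then show ?thesis unfolding Im_divide_eq_0[OF n] e using lam(1) by simp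
    qed
    fix p p' assume p: "p \<in> {0, 1, lam}" "p' \<in> {0, 1, lam}" "p' \<noteq> p"
    then consider "p = lam" "p' = 0 \<or> p' = 1" | "p' = lam" "p = 0 \<or> p = 1" | "p = 0" "p' = 1" | "p = 1" "p' = 0"
      by blast
    then show "Im ((p' - 1 / 2) / (p - 1 / 2)) \<noteq> 0 \<or> Re ((p' - 1 / 2) / (p - 1 / 2)) < 0"
    proof cases
      case 1
      then have "Im ((p' - 1 / 2) / (p - 1 / 2)) \<noteq> 0" unfolding 1(1) by (intro nr) blast
      then show ?thesis ..
    next
      case 2
      then show ?thesis using lam(1) by auto
    qed simp_all
  qed simp
  then obtain \<epsilon> where sep: "sep_base \<epsilon> (1 / 2) {0, 1, lam}" by blast
  have "\<exists>g. parallel_on X (pole_conn lam (a n)) g \<and> (\<exists>t\<in>X. g t \<noteq> 0)" for n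
    using all[of "a n"] preserves_iff_parallel[OF M04] by (simp add: X_def)
  then obtain g where g: "\<And>n. parallel_on X (pole_conn lam (a n)) (g n)" "\<And>n. \<exists>t\<in>X. g n t \<noteq> 0" by metis
  have oX: "open X" by (simp add: X_def finite_imp_closed open_Compl)
  have hol: "entrywise_holomorphic (pole_conn lam (a n)) X" for n unfolding X_def by (rule pole_conn_holomorphic)
  have gc: "g n c \<noteq> 0" for n
  proof
    assume z: "g n c = 0"
    obtain t where t: "t \<in> X" "g n t \<noteq> 0" using g(2) by blast
    have "g n (1 / 2) \<noteq> 0"
      by (rule parallel_nonzero_base[OF sep _ hol[unfolded X_def] g(1)[unfolded X_def] t(1)[unfolded X_def] t(2)]) simp
    moreover have "closed_segment c (1 / 2) \<subseteq> X" using seg[of "1 / 2"] by simp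
    from parallel_on_transport[OF hol oX g(1) this] z have "g n (1 / 2) = 0" by (simp add: cmat_eq_iff cmat_mult_entry)
    ultimately show False by simp
  qed
  define K where "K = bal_metric lam"
  have "det K \<noteq> 0"
    unfolding K_def bal_metric_det using scale_pos[OF lam'] by (simp only: of_real_eq_0_iff)
  then have "invertible K" by (simp add: invertible_det_nz)
  then obtain J where JK: "J ** K = mat 1" "K ** J = mat 1" unfolding invertible_def by blast
  have Kh: "cmat_adj K = K" unfolding K_def by (simp add: cmat_eq_iff bal_metric_entry)
  \<comment> \<open>With \<open>J\<close> inverse to the metric, adjoint residues are replaced by
    the residues themselves in the equation for \<Gamma> = J g.\<close>
  have adjJ: "J ** cmat_adj (A_mat lam i) = A_mat lam i ** J" if "i \<in> {1..4}" for i
  proof -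
    have "J ** cmat_adj (A_mat lam i) = J ** (cmat_adj (A_mat lam i) ** K) ** J"
      by (simp add: matrix_mul_assoc[symmetric] JK)
    also have "\<dots> = A_mat lam i ** J" unfolding K_def A_mat_adjoint[OF lam' that]
      unfolding K_def[symmetric] by (simp add: matrix_mul_assoc JK)
    finally show ?thesis .
  qed
  define D where "D = ((0::complex, A_mat lam 1), (1::complex, A_mat lam 3), (lam, A_mat lam 4))"
  have pX: "- pole_set D = X" by (simp add: D_def pole_set_def X_def)
  \<comment> \<open>Scaling to norm 1 at \<open>c\<close> makes a convergent subsequence available
    and keeps its limit away from 0.\<close>
  define k where "k n = inverse (norm (J ** g n c))" for n
  define \<Gamma> where "\<Gamma> n t = k n *\<^sub>R (J ** g n t)" for n t
  have Jz: "J ** G = 0 \<Longrightarrow> G = 0" for G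
  proof -
    assume "J ** G = 0"
    then have "K ** (J ** G) = 0" by (simp add: cmat_eq_iff cmat_mult_entry)
    then show "G = 0" by (simp add: matrix_mul_assoc JK)
  qed
  have norm1: "norm (\<Gamma> n c) = 1" for n
  proof -
    have "J ** g n c \<noteq> 0" using Jz gc by blast
    then show ?thesis by (simp add: \<Gamma>_def k_def)
  qed
  have sol: "pert_sol D (a n) (\<Gamma> n)" for n
    unfolding pert_sol_def
  proof
    fix t assume "t \<in> - pole_set D"
    then have t: "t \<in> X" by (simp add: pX)
    have bl: "bounded_linear (\<lambda>G::cmat. k n *\<^sub>R (J ** G))"
      by (rule bounded_linear_compose[OF bounded_linear_scaleR_right
            bounded_bilinear.bounded_linear_right[OF bounded_bilinear_cmat_mult]])
    from bounded_linear.has_derivative[OF bl parallel_onD(2)[OF g(1) t]]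
    show "(\<Gamma> n has_derivative (\<lambda>v. - (a n *\<^sub>R pert_form D (\<Gamma> n t) t v))) (at t)"
      unfolding \<Gamma>_def
    proof (rule has_derivative_eq_rhs, intro ext)
      fix v
      let ?G = "g n t"
      have B: "cscale v (pole_conn lam (a n) t) = a n *\<^sub>R pole_form D t v"
        by (simp add: D_def pole_form_def pole_conn_def cmat_eq_iff scaleR_conv_of_real[where 'a = complex] algebra_simps)
      have "cmat_adj (cscale v (pole_conn lam (a n) t)) = a n *\<^sub>R (cscale (cnj (v / (t - 0))) (cmat_adj (A_mat lam 1))
         + cscale (cnj (v / (t - 1))) (cmat_adj (A_mat lam 3)) + cscale (cnj (v / (t - lam))) (cmat_adj (A_mat lam 4)))"
        by (simp add: pole_conn_def cmat_eq_iff scaleR_conv_of_real[where 'a = complex] algebra_simps)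
      then have "J ** cmat_adj (cscale v (pole_conn lam (a n) t)) = a n *\<^sub>R (pole_form_cnj D t v ** J)"
        by (simp add: cmat_mult_scaleR matrix_add_ldistrib cscale_mult adjJ D_def pole_form_cnj_def
            bounded_bilinear.add_left[OF bounded_bilinear_cmat_mult])
      then have B': "J ** (cmat_adj (cscale v (pole_conn lam (a n) t)) ** ?G) = a n *\<^sub>R (pole_form_cnj D t v ** (J ** ?G))"
        by (simp add: matrix_mul_assoc cmat_mult_scaleR)
      have "J ** - (?G ** cscale v (pole_conn lam (a n) t) + cmat_adj (cscale v (pole_conn lam (a n) t)) ** ?G)
        = - (J ** (?G ** cscale v (pole_conn lam (a n) t)) + J ** (cmat_adj (cscale v (pole_conn lam (a n) t)) ** ?G))"
        by (simp add: bounded_bilinear.minus_right[OF bounded_bilinear_cmat_mult] matrix_add_ldistrib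
            bounded_bilinear.diff_right[OF bounded_bilinear_cmat_mult])
      also have "\<dots> = - (a n *\<^sub>R pert_form D (J ** ?G) t v)"
        unfolding B' unfolding B pert_form_def
        by (simp add: cmat_mult_scaleR matrix_mul_assoc scaleR_add_right)
      finally show "k n *\<^sub>R (J ** - (?G ** cscale v (pole_conn lam (a n) t) + cmat_adj (cscale v (pole_conn lam (a n) t)) ** ?G))
        = - (a n *\<^sub>R pert_form D (k n *\<^sub>R (J ** ?G)) t v)"
        by (simp add: pert_form_linear(3) mult.commute)
    qed
  qed
  have "compact (sphere (0::cmat) 1)" by (rule compact_sphere)
  moreover have "\<Gamma> n c \<in> sphere 0 1" for n using norm1 by simp
  ultimately obtain \<gamma> \<rho> where \<gamma>: "\<gamma> \<in> sphere 0 1" and \<rho>: "strict_mono \<rho>" and lim: "((\<lambda>n. \<Gamma> n c) \<circ> \<rho>) \<longlonglongrightarrow> \<gamma>"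
    unfolding compact_def by metis
  have lim': "(\<lambda>n. \<Gamma> (\<rho> n) c) \<longlonglongrightarrow> \<gamma>" using lim by (simp add: comp_def)
  have a0': "(\<lambda>n. a (\<rho> n)) \<longlonglongrightarrow> 0" using LIMSEQ_subseq_LIMSEQ[OF a0 \<rho>] by (simp add: comp_def)
  have segs: "closed_segment c (z + of_real \<epsilon>) \<subseteq> - pole_set D" if "0 < \<epsilon>" "\<epsilon> < 1 / 2" "z \<in> {0, 1}" for \<epsilon> z
    using seg[of "Re z + \<epsilon>"] that unfolding pX by auto
  note obstruction = pert_obstruction[OF D_def _ _ _ sol a0' anz lim' _ segs]
  have comm: "\<gamma> ** A_mat lam 1 = A_mat lam 1 ** \<gamma>" "\<gamma> ** A_mat lam 3 = A_mat lam 3 ** \<gamma>"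
    using obstruction(1,2)[of "1 / 2"] lam' by auto
  have \<tau>: "trace (A_mat lam 3 ** (A_mat lam 4 ** A_mat lam 1 - A_mat lam 1 ** A_mat lam 4)) \<noteq> 0"
    by (rule trace_A_mat_nonzero[OF lam(1)])
  have "A_mat lam 1 ** A_mat lam 3 \<noteq> A_mat lam 3 ** A_mat lam 1"
  proof
    assume e: "A_mat lam 1 ** A_mat lam 3 = A_mat lam 3 ** A_mat lam 1"
    have "trace (A_mat lam 3 ** (A_mat lam 4 ** A_mat lam 1 - A_mat lam 1 ** A_mat lam 4))
      = trace (A_mat lam 4 ** (A_mat lam 1 ** A_mat lam 3 - A_mat lam 3 ** A_mat lam 1))"
      by (simp add: trace_2 cmat_mult_entry algebra_simps)
    also have "\<dots> = 0" unfolding e by (simp add: trace_2 cmat_mult_entry)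
    finally show False using \<tau> by simp
  qed
  from commuting_scalar[OF comm this] have sc: "\<gamma> = cscale (\<gamma>$1$1) (mat 1)" .
  \<comment> \<open>\<open>K ** \<gamma>\<close> is a limit of Hermitian matrices and hence
    Hermitian; this makes the scalar of \<open>\<gamma>\<close> real, as
    \<open>pert_obstruction\<close> requires.\<close>
  have "cmat_adj (K ** \<Gamma> n c) = K ** \<Gamma> n c" for n
  proof -
    have "K ** \<Gamma> n c = k n *\<^sub>R g n c" by (simp add: \<Gamma>_def cmat_mult_scaleR matrix_mul_assoc JK)
    moreover have "c \<in> X" using seg[of 2] by auto
    then have "cmat_adj (g n c) = g n c" by (rule parallel_onD(1)[OF g(1)])
    ultimately show ?thesis using linear_simps(5)[OF bounded_linear_cmat_adj] by simp
  qed
  moreover have "(\<lambda>n. K ** \<Gamma> (\<rho> n) c) \<longlonglongrightarrow> K ** \<gamma>"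
    by (rule bounded_bilinear.tendsto[OF bounded_bilinear_cmat_mult tendsto_const lim'])
  moreover from this have "(\<lambda>n. cmat_adj (K ** \<Gamma> (\<rho> n) c)) \<longlonglongrightarrow> cmat_adj (K ** \<gamma>)"
    by (rule bounded_linear.tendsto[OF bounded_linear_cmat_adj])
  ultimately have "cmat_adj (K ** \<gamma>) = K ** \<gamma>" by (simp add: LIMSEQ_unique)
  then have "cmat_adj (K ** \<gamma>) $ 1 $ 1 = (K ** \<gamma>) $ 1 $ 1" by simp
  then have "K $ 1 $ 1 * cnj (\<gamma>$1$1) = K $ 1 $ 1 * \<gamma>$1$1"
    using arg_cong[OF sc, of "\<lambda>A. A$2$1"] Kh by (simp add: cmat_mult_entry mat_def K_def bal_metric_entry)
  moreover have "K $ 1 $ 1 \<noteq> 0"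
  proof -
    have "1 + norm lam + norm (1 - lam) \<noteq> 0" using norm_ge_zero[of lam] norm_ge_zero[of "1 - lam"] by linarith
    then show ?thesis unfolding K_def bal_metric_entry of_real_eq_0_iff .
  qed
  ultimately have "cnj (\<gamma>$1$1) = \<gamma>$1$1" by simp
  then have re: "\<gamma>$1$1 = of_real (Re (\<gamma>$1$1))" by (simp add: complex_eq_iff)
  define \<kappa> where "\<kappa> = Re (\<gamma>$1$1)"
  have \<gamma>\<kappa>: "\<gamma> = \<kappa> *\<^sub>R mat 1"
    unfolding \<kappa>_def using sc re by (simp add: cmat_eq_iff mat_def scaleR_conv_of_real[where 'a = complex])
  then have "\<kappa> \<noteq> 0" using \<gamma> by auto
  then have "norm (0 - lam) = norm (1 - lam)"
    using obstruction(3)[of "1 / 2", OF _ _ _ _ _ _ _ \<gamma>\<kappa> _ \<tau>] lam' by auto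
  then have "(norm lam)\<^sup>2 = (norm (1 - lam))\<^sup>2" by simp
  then have "Re lam = 1 / 2" unfolding cmod_power2 by (simp add: power2_eq_square algebra_simps)
  then show False using lam(2) by simp
qed

section \<open>Complexification\<close>

type_synonym c3 = "complex \<times> complex \<times> complex"

context
  fixes A B C :: "complex set"
begin

private abbreviation "SH \<equiv> separately_holomorphic A B C"

lemma separately_holomorphic_const: "SH (\<lambda>_. k)"
  by (simp add: separately_holomorphic_def)

lemma separately_holomorphic_proj: "SH (\<lambda>z. fst z)" "SH (\<lambda>z. fst (snd z))" "SH (\<lambda>z. snd (snd z))"
  by (auto simp: separately_holomorphic_def intro!: continuous_intros holomorphic_intros)

lemma separately_holomorphic_add: "SH f \<Longrightarrow> SH g \<Longrightarrow> SH (\<lambda>z. f z + g z)"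
  by (auto simp: separately_holomorphic_def intro!: continuous_on_add holomorphic_on_add)

lemma separately_holomorphic_diff: "SH f \<Longrightarrow> SH g \<Longrightarrow> SH (\<lambda>z. f z - g z)"
  by (auto simp: separately_holomorphic_def intro!: continuous_on_diff holomorphic_on_diff)

lemma separately_holomorphic_minus: "SH f \<Longrightarrow> SH (\<lambda>z. - f z)"
  by (auto simp: separately_holomorphic_def intro!: continuous_on_minus holomorphic_on_minus)

lemma separately_holomorphic_mult: "SH f \<Longrightarrow> SH g \<Longrightarrow> SH (\<lambda>z. f z * g z)"
  by (auto simp: separately_holomorphic_def intro!: continuous_on_mult holomorphic_on_mult)

lemma separately_holomorphic_divide:
  "SH f \<Longrightarrow> SH g \<Longrightarrow> (\<And>z. z \<in> A \<times> B \<times> C \<Longrightarrow> g z \<noteq> 0) \<Longrightarrow> SH (\<lambda>z. f z / g z)"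
  by (auto simp: separately_holomorphic_def intro!: continuous_on_divide holomorphic_on_divide)

lemma separately_holomorphic_csqrt:
  assumes f: "SH f" and pos: "\<And>z. z \<in> A \<times> B \<times> C \<Longrightarrow> 0 < Re (f z)"
  shows "SH (\<lambda>z. csqrt (f z))"
proof -
  have np: "f z \<notin> \<real>\<^sub>\<le>\<^sub>0" if "z \<in> A \<times> B \<times> C" for z
    using pos[OF that] by (auto simp: complex_nonpos_Reals_iff)
  have "continuous_on (A \<times> B \<times> C) (\<lambda>z. csqrt (f z))"
    by (rule continuous_on_compose2[OF continuous_on_csqrt]) (use f np in \<open>auto simp: separately_holomorphic_def\<close>)
  moreover have "(\<lambda>u. csqrt (g u)) holomorphic_on S"
    if "g holomorphic_on S" "\<And>u. u \<in> S \<Longrightarrow> g u \<notin> \<real>\<^sub>\<le>\<^sub>0" for g :: "complex \<Rightarrow> complex" and S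
    by (rule holomorphic_on_csqrt'[OF that])
  ultimately show ?thesis using f np by (auto simp: separately_holomorphic_def)
qed

text \<open>Reflecting argument and value restores holomorphy. At real points the reflected function
  is the conjugate of f, and in this way the adjoints in the gluing conditions acquire holomorphic
  extensions.\<close>

lemma separately_holomorphic_cnj:
  assumes f: "SH f" and op: "open A" "open B" "open C" and sym: "cnj ` A = A" "cnj ` B = B" "cnj ` C = C"
  shows "SH (\<lambda>(u, v, w). cnj (f (cnj u, cnj v, cnj w)))"
proof -
  have mem: "cnj z \<in> A" if "z \<in> A" for z using imageI[OF that, of cnj] unfolding sym(1) .
  have mem': "cnj z \<in> B" if "z \<in> B" for z using imageI[OF that, of cnj] unfolding sym(2) .
  have mem'': "cnj z \<in> C" if "z \<in> C" for z using imageI[OF that, of cnj] unfolding sym(3) .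
  have ef: "(\<lambda>(u, v, w). cnj (f (cnj u, cnj v, cnj w))) = (\<lambda>z. cnj (f (cnj (fst z), cnj (fst (snd z)), cnj (snd (snd z)))))"
    by (simp add: case_prod_unfold)
  have m: "continuous_on (A \<times> B \<times> C) (\<lambda>z. (cnj (fst z), cnj (fst (snd z)), cnj (snd (snd z))))"
    by (intro continuous_intros)
  have m': "(\<lambda>z. (cnj (fst z), cnj (fst (snd z)), cnj (snd (snd z)))) ` (A \<times> B \<times> C) \<subseteq> A \<times> B \<times> C"
    by (auto intro: mem mem' mem'')
  have c: "continuous_on (A \<times> B \<times> C) f" using f unfolding separately_holomorphic_def by (elim conjE)
  have "continuous_on (A \<times> B \<times> C) (\<lambda>(u, v, w). cnj (f (cnj u, cnj v, cnj w)))"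
    unfolding ef by (rule continuous_on_cnj[OF continuous_on_compose2[OF c m m']])
  moreover have h: "(\<lambda>z. cnj (g (cnj z))) holomorphic_on S" if "g holomorphic_on S" "open S" "cnj ` S = S" for g S
    using holomorphic_on_compose_cnj_cnj[of g S] that by (simp add: comp_def)
  moreover have "(\<lambda>u. cnj (f (cnj u, cnj v, cnj w))) holomorphic_on A" if "v \<in> B" "w \<in> C" for v w
    by (rule h[OF _ op(1) sym(1), of "\<lambda>u. f (u, cnj v, cnj w)"])
      (use f mem'[OF that(1)] mem''[OF that(2)] in \<open>simp add: separately_holomorphic_def\<close>)
  moreover have "(\<lambda>v. cnj (f (cnj u, cnj v, cnj w))) holomorphic_on B" if "u \<in> A" "w \<in> C" for u w
    by (rule h[OF _ op(2) sym(2), of "\<lambda>v. f (cnj u, v, cnj w)"])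
      (use f mem[OF that(1)] mem''[OF that(2)] in \<open>simp add: separately_holomorphic_def\<close>)
  moreover have "(\<lambda>w. cnj (f (cnj u, cnj v, cnj w))) holomorphic_on C" if "u \<in> A" "v \<in> B" for u v
    by (rule h[OF _ op(3) sym(3), of "\<lambda>w. f (cnj u, cnj v, w)"])
      (use f mem[OF that(1)] mem'[OF that(2)] in \<open>simp add: separately_holomorphic_def\<close>)
  ultimately show ?thesis unfolding separately_holomorphic_def prod.case by blast
qed

end

lemma separately_holomorphic_transport:
  fixes b :: "c3 \<Rightarrow> real \<Rightarrow> cmat"
  assumes op: "open A" "open B" "open C"
    and cont: "continuous_on ((A \<times> B \<times> C) \<times> {0..1}) (\<lambda>(z, s). b z s)"
    and hol: "\<And>s i j. s \<in> {0..1} \<Longrightarrow> separately_holomorphic A B C (\<lambda>z. b z s $ i $ j)"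
  shows "separately_holomorphic A B C (\<lambda>z. transport (b z) 1 $ i $ j)"
proof -
  have "continuous_on (A \<times> B \<times> C) (\<lambda>z. transport (b z) 1)"
    by (rule transport_continuous_param[OF _ cont]) (use op in \<open>auto intro: open_Times\<close>)
  then have "continuous_on (A \<times> B \<times> C) (\<lambda>z. transport (b z) 1 $ i $ j)"
    by (intro continuous_intros)
  moreover have slice: "(\<lambda>u. transport (b (e u)) 1 $ i $ j) holomorphic_on S"
    if "open S" "continuous_on S e" "e ` S \<subseteq> A \<times> B \<times> C"
      "\<And>s i j. s \<in> {0..1} \<Longrightarrow> (\<lambda>u. b (e u) s $ i $ j) holomorphic_on S" for e :: "complex \<Rightarrow> c3" and S
  proof (rule transport_holomorphic[OF that(1) _ that(4)])
    have m: "continuous_on (S \<times> {0..1::real}) (\<lambda>p. (e (fst p), snd p))"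
      by (intro continuous_intros continuous_on_compose2[OF that(2)]) auto
    have "(\<lambda>p. (e (fst p), snd p)) ` (S \<times> {0..1}) \<subseteq> (A \<times> B \<times> C) \<times> {0..1::real}"
      using that(3) by auto
    from continuous_on_compose2[OF cont m this]
    show "continuous_on (S \<times> {0..1}) (\<lambda>(z, s). b (e z) s)" by (simp add: case_prod_unfold)
  qed auto
  moreover have "(\<lambda>u. transport (b (u, v, w)) 1 $ i $ j) holomorphic_on A" if "v \<in> B" "w \<in> C" for v w
    by (rule slice[OF op(1), of "\<lambda>u. (u, v, w)"])
      (use that hol in \<open>auto simp: separately_holomorphic_def intro!: continuous_intros\<close>)
  moreover have "(\<lambda>v. transport (b (u, v, w)) 1 $ i $ j) holomorphic_on B" if "u \<in> A" "w \<in> C" for u w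
    by (rule slice[OF op(2), of "\<lambda>v. (u, v, w)"])
      (use that hol in \<open>auto simp: separately_holomorphic_def intro!: continuous_intros\<close>)
  moreover have "(\<lambda>w. transport (b (u, v, w)) 1 $ i $ j) holomorphic_on C" if "u \<in> A" "v \<in> B" for u v
    by (rule slice[OF op(3), of "\<lambda>w. (u, v, w)"])
      (use that hol in \<open>auto simp: separately_holomorphic_def intro!: continuous_intros\<close>)
  ultimately show ?thesis by (simp add: separately_holomorphic_def)
qed

text \<open>Real analyticity on a box, witnessed by a holomorphic extension that is entire in the last variable.\<close>

definition box3 :: "complex \<Rightarrow> real \<Rightarrow> (complex \<times> real) set" where
  "box3 z0 \<delta> = {(z, a). \<bar>Re z - Re z0\<bar> < \<delta> \<and> \<bar>Im z - Im z0\<bar> < \<delta>}"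

definition extends :: "complex \<Rightarrow> real \<Rightarrow> (complex \<times> real \<Rightarrow> complex) \<Rightarrow> (c3 \<Rightarrow> complex) \<Rightarrow> bool" where
  "extends z0 \<delta> f \<Phi> \<longleftrightarrow>
     separately_holomorphic (ball (of_real (Re z0)) \<delta>) (ball (of_real (Im z0)) \<delta>) UNIV \<Phi> \<and>
     (\<forall>z a. (z, a) \<in> box3 z0 \<delta> \<longrightarrow> f (z, a) = \<Phi> (of_real (Re z), of_real (Im z), of_real a))"

definition ext_analytic :: "complex \<Rightarrow> real \<Rightarrow> (complex \<times> real \<Rightarrow> complex) \<Rightarrow> bool" where
  "ext_analytic z0 \<delta> f \<longleftrightarrow> (\<exists>\<Phi>. extends z0 \<delta> f \<Phi>)"

lemma box3_mem:
  "(z, a) \<in> box3 z0 \<delta> \<Longrightarrow> of_real (Re z) \<in> ball (of_real (Re z0) :: complex) \<delta>"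
  "(z, a) \<in> box3 z0 \<delta> \<Longrightarrow> of_real (Im z) \<in> ball (of_real (Im z0) :: complex) \<delta>"
  by (auto simp: box3_def dist_norm abs_minus_commute simp flip: of_real_diff)

context
  fixes z0 :: complex and \<delta> :: real
begin

lemma ext_analytic_const: "ext_analytic z0 \<delta> (\<lambda>_. k)"
  unfolding ext_analytic_def extends_def
  by (intro exI[of _ "\<lambda>_. k"]) (simp add: separately_holomorphic_const)

lemma ext_analytic_binary:
  assumes "ext_analytic z0 \<delta> f" "ext_analytic z0 \<delta> g"
  shows "ext_analytic z0 \<delta> (\<lambda>p. f p + g p)" "ext_analytic z0 \<delta> (\<lambda>p. f p - g p)" "ext_analytic z0 \<delta> (\<lambda>p. f p * g p)"
proof -
  obtain \<Phi> \<Psi> where "extends z0 \<delta> f \<Phi>" "extends z0 \<delta> g \<Psi>" using assms unfolding ext_analytic_def by blast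
  then have "extends z0 \<delta> (\<lambda>p. f p + g p) (\<lambda>z. \<Phi> z + \<Psi> z)" "extends z0 \<delta> (\<lambda>p. f p - g p) (\<lambda>z. \<Phi> z - \<Psi> z)"
    "extends z0 \<delta> (\<lambda>p. f p * g p) (\<lambda>z. \<Phi> z * \<Psi> z)"
    unfolding extends_def
    by (simp_all add: separately_holomorphic_add separately_holomorphic_diff separately_holomorphic_mult)
  then show "ext_analytic z0 \<delta> (\<lambda>p. f p + g p)" "ext_analytic z0 \<delta> (\<lambda>p. f p - g p)" "ext_analytic z0 \<delta> (\<lambda>p. f p * g p)"
    unfolding ext_analytic_def by blast+
qed

lemma ext_analytic_sum: "(\<And>i. i \<in> I \<Longrightarrow> ext_analytic z0 \<delta> (f i)) \<Longrightarrow> ext_analytic z0 \<delta> (\<lambda>p. \<Sum>i\<in>I. f i p)"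
  by (induction I rule: infinite_finite_induct) (auto intro: ext_analytic_const ext_analytic_binary)

lemma ext_analytic_prod: "(\<And>i. i \<in> I \<Longrightarrow> ext_analytic z0 \<delta> (f i)) \<Longrightarrow> ext_analytic z0 \<delta> (\<lambda>p. \<Prod>i\<in>I. f i p)"
  by (induction I rule: infinite_finite_induct) (auto intro: ext_analytic_const ext_analytic_binary)

lemma cnj_image_ball: "cnj ` ball (of_real x) d = ball (of_real x :: complex) d"
proof -
  have "cnj z \<in> ball (of_real x) d" if "z \<in> ball (of_real x :: complex) d" for z
  proof -
    have "norm (of_real x - cnj z) = norm (of_real x - z)"
      using complex_mod_cnj[of "of_real x - z"] by simp
    then show ?thesis using that by (simp add: dist_norm)
  qed
  then show ?thesis by (force intro: image_eqI[of _ _ "cnj z" for z])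
qed

lemma ext_analytic_cnj:
  assumes "ext_analytic z0 \<delta> f" shows "ext_analytic z0 \<delta> (\<lambda>p. cnj (f p))"
proof -
  obtain \<Phi> where \<Phi>: "extends z0 \<delta> f \<Phi>" using assms unfolding ext_analytic_def by blast
  have "surj cnj" by (metis complex_cnj_cnj surjI)
  then have "extends z0 \<delta> (\<lambda>p. cnj (f p)) (\<lambda>(u, v, w). cnj (\<Phi> (cnj u, cnj v, cnj w)))"
    using \<Phi> unfolding extends_def
    by (auto intro!: separately_holomorphic_cnj cnj_image_ball)
  then show ?thesis unfolding ext_analytic_def by blast
qed

end

text \<open>The monomials are real at real points, so the real parts of the coefficients form the
  power series of the real part.\<close>

lemma ext_analytic_real_analytic:
  assumes "extends z0 \<delta> f \<Phi>"
  shows "real_analytic_on3 (\<lambda>p. Re (f p)) (box3 z0 \<delta>)"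
  unfolding real_analytic_on3_def
proof
  fix p assume p: "p \<in> box3 z0 \<delta>"
  obtain z a where za: "p = (z, a)" by (cases p)
  define R where "R = min (\<delta> - \<bar>Re z - Re z0\<bar>) (\<delta> - \<bar>Im z - Im z0\<bar>)"
  have R: "0 < R" using p by (auto simp: R_def za box3_def)
  have sub: "ball (of_real x) R \<subseteq> ball (of_real y :: complex) \<delta>" if "R \<le> \<delta> - \<bar>x - y\<bar>" for x y :: real
  proof
    fix w :: complex assume "w \<in> ball (of_real x) R"
    then have "norm (of_real x - w) < R" by (simp add: dist_norm)
    moreover have "norm (of_real y - of_real x :: complex) = \<bar>x - y\<bar>" by (simp add: norm_minus_commute flip: of_real_diff)
    ultimately show "w \<in> ball (of_real y) \<delta>"
      using that norm_triangle_ineq[of "of_real y - of_real x" "of_real x - w"] by (simp add: dist_norm)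
  qed
  have SH: "separately_holomorphic (ball (of_real (Re z0)) \<delta>) (ball (of_real (Im z0)) \<delta>) UNIV \<Phi>"
    using assms by (simp add: extends_def)
  have s1: "ball (of_real (Re z)) R \<subseteq> ball (of_real (Re z0) :: complex) \<delta>" by (rule sub) (simp add: R_def)
  have s2: "ball (of_real (Im z)) R \<subseteq> ball (of_real (Im z0) :: complex) \<delta>" by (rule sub) (simp add: R_def)
  have "separately_holomorphic (ball (of_real (Re z)) R) (ball (of_real (Im z)) R) (ball (of_real a) R) \<Phi>"
    using SH unfolding separately_holomorphic_def
  proof (elim conjE, intro conjI ballI)
    assume "continuous_on (ball (of_real (Re z0)) \<delta> \<times> ball (of_real (Im z0)) \<delta> \<times> UNIV) \<Phi>"
    then show "continuous_on (ball (of_real (Re z)) R \<times> ball (of_real (Im z)) R \<times> ball (of_real a) R) \<Phi>"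
      by (rule continuous_on_subset) (use s1 s2 in blast)
  qed (use s1 s2 in \<open>blast intro: holomorphic_on_subset\<close>)+
  from separately_holomorphic_power_series[OF this, of "R / 2"] R
  have "\<exists>k :: nat \<times> nat \<times> nat \<Rightarrow> complex. \<forall>u\<in>ball (of_real (Re z)) (R / 2). \<forall>v\<in>ball (of_real (Im z)) (R / 2). \<forall>w\<in>ball (of_real a) (R / 2).
     ((\<lambda>(i, j, l). k (i, j, l) * (u - of_real (Re z)) ^ i * (v - of_real (Im z)) ^ j * (w - of_real a) ^ l) has_sum \<Phi> (u, v, w)) UNIV"
    by simp
  then obtain k :: "nat \<times> nat \<times> nat \<Rightarrow> complex" where k: "\<And>u v w. u \<in> ball (of_real (Re z)) (R / 2) \<Longrightarrow> v \<in> ball (of_real (Im z)) (R / 2) \<Longrightarrow> w \<in> ball (of_real a) (R / 2) \<Longrightarrow>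
     ((\<lambda>(i, j, l). k (i, j, l) * (u - of_real (Re z)) ^ i * (v - of_real (Im z)) ^ j * (w - of_real a) ^ l) has_sum \<Phi> (u, v, w)) UNIV"
    by blast
  show "\<exists>r>0. \<exists>c. \<forall>q. dist q p < r \<longrightarrow>
        ((\<lambda>(i, j, l). c (i, j, l) * (Re (fst q) - Re (fst p)) ^ i * (Im (fst q) - Im (fst p)) ^ j * (snd q - snd p) ^ l) has_sum Re (f q)) UNIV"
  proof (intro exI[of _ "R / 2"] conjI exI[of _ "\<lambda>i. Re (k i)"] allI impI)
    show "0 < R / 2" using R by simp
    fix q assume q: "dist q p < R / 2"
    obtain z' a' where q': "q = (z', a')" by (cases q)
    have "norm (z' - z) \<le> dist q p" "\<bar>a' - a\<bar> \<le> dist q p"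
      using norm_fst_le[of "z' - z" "a' - a"] norm_snd_le[of "a' - a" "z' - z"] by (simp_all add: dist_norm za q')
    then have d: "\<bar>Re z' - Re z\<bar> < R / 2" "\<bar>Im z' - Im z\<bar> < R / 2" "\<bar>a' - a\<bar> < R / 2"
      using q abs_Re_le_cmod[of "z' - z"] abs_Im_le_cmod[of "z' - z"] by simp_all
    moreover have "R \<le> \<delta> - \<bar>Re z - Re z0\<bar>" "R \<le> \<delta> - \<bar>Im z - Im z0\<bar>" by (simp_all add: R_def)
    ultimately have "\<bar>Re z' - Re z0\<bar> < \<delta>" "\<bar>Im z' - Im z0\<bar> < \<delta>" using R by linarith+
    then have "(z', a') \<in> box3 z0 \<delta>" by (simp add: box3_def)
    then have fq: "f q = \<Phi> (of_real (Re z'), of_real (Im z'), of_real a')"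
      using assms unfolding extends_def q' by blast
    have "((\<lambda>(i, j, l). k (i, j, l) * (of_real (Re z') - of_real (Re z)) ^ i * (of_real (Im z') - of_real (Im z)) ^ j * (of_real a' - of_real a) ^ l)
        has_sum f q) UNIV"
      unfolding fq using d by (intro k) (simp_all add: dist_norm abs_minus_commute flip: of_real_diff)
    from has_sum_Re[OF this]
    show "((\<lambda>(i, j, l). Re (k (i, j, l)) * (Re (fst q) - Re (fst p)) ^ i * (Im (fst q) - Im (fst p)) ^ j * (snd q - snd p) ^ l) has_sum Re (f q)) UNIV"
      unfolding za q' fst_conv snd_conv
      by (simp add: case_prod_unfold flip: of_real_diff of_real_power of_real_mult)
  qed
qed

section \<open>One determinant for all gluing conditions\<close>

text \<open>The Gram matrix has the same kernel as F, because x paired with G x is |F x|^2. This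
  turns an overdetermined linear system into a single scalar equation that is polynomial in its
  entries.\<close>

lemma gram_det_eq_0_iff:
  fixes F :: "real^'n \<Rightarrow> 'e::real_inner"
  assumes F: "linear F"
  shows "det (\<chi> k l. F (axis k 1) \<bullet> F (axis l 1)) = 0 \<longleftrightarrow> (\<exists>x. x \<noteq> 0 \<and> F x = 0)"
proof -
  define G :: "real^'n^'n" where "G = (\<chi> k l. F (axis k 1) \<bullet> F (axis l 1))"
  have ex: "F x = (\<Sum>l\<in>UNIV. x $ l *\<^sub>R F (axis l 1))" for x
  proof -
    have "x = (\<Sum>l\<in>UNIV. x $ l *\<^sub>R axis l 1)" using basis_expansion[of x] by (simp add: scalar_mult_eq_scaleR)
    then have "F x = F (\<Sum>l\<in>UNIV. x $ l *\<^sub>R axis l 1)" by simp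
    also have "\<dots> = (\<Sum>l\<in>UNIV. x $ l *\<^sub>R F (axis l 1))" by (simp add: linear_sum[OF F] linear_scale[OF F])
    finally show ?thesis .
  qed
  have Gx: "(G *v x) $ k = F (axis k 1) \<bullet> F x" for x k
    by (subst ex[of x]) (simp add: G_def matrix_vector_mult_def inner_sum_right mult.commute)
  have "G *v x = 0 \<longleftrightarrow> F x = 0" for x
  proof
    assume z: "G *v x = 0"
    have "F x \<bullet> F x = (\<Sum>k\<in>UNIV. x $ k * (F (axis k 1) \<bullet> F x))"
      by (subst (1) ex[of x]) (simp add: inner_sum_left)
    also have "\<dots> = 0" unfolding Gx[symmetric] z by simp
    finally show "F x = 0" by simp
  next
    assume "F x = 0"
    then show "G *v x = 0" by (simp add: vec_eq_iff Gx)
  qed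
  moreover have "det G = 0 \<longleftrightarrow> \<not> (\<forall>x. G *v x = 0 \<longrightarrow> x = 0)"
    unfolding matrix_left_invertible_ker[symmetric] invertible_left_inverse[symmetric] invertible_det_nz by simp
  ultimately show ?thesis unfolding G_def by blast
qed

definition herm_of :: "real^4 \<Rightarrow> cmat" where
  "herm_of x = mk_mat (of_real (x $ 1)) (Complex (x $ 3) (x $ 4)) (Complex (x $ 3) (- x $ 4)) (of_real (x $ 2))"

lemma herm_of_linear: "linear herm_of"
  by (rule linearI) (simp_all add: herm_of_def cmat_eq_iff complex_eq_iff)

lemma herm_of_eq_0: "herm_of x = 0 \<longleftrightarrow> x = 0"
proof -
  have "herm_of x = 0 \<longleftrightarrow> x $ 1 = 0 \<and> x $ 2 = 0 \<and> x $ 3 = 0 \<and> x $ 4 = 0"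
    by (auto simp: herm_of_def cmat_eq_iff complex_eq_iff)
  moreover have "x = 0 \<longleftrightarrow> x $ 1 = 0 \<and> x $ 2 = 0 \<and> x $ 3 = 0 \<and> x $ 4 = 0"
    by (auto simp: vec_eq_iff forall_4)
  ultimately show ?thesis by (simp only:)
qed

lemma range_herm_of: "cmat_adj g = g \<longleftrightarrow> (\<exists>x. g = herm_of x)"
proof
  assume h: "cmat_adj g = g"
  have e: "Im (g $ 1 $ 1) = 0" "Im (g $ 2 $ 2) = 0" "Re (g $ 2 $ 1) = Re (g $ 1 $ 2)" "Im (g $ 2 $ 1) = - Im (g $ 1 $ 2)"
    using arg_cong[OF h, of "\<lambda>M. Im (M $ 1 $ 1)"] arg_cong[OF h, of "\<lambda>M. Im (M $ 2 $ 2)"]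
      arg_cong[OF h, of "\<lambda>M. Re (M $ 2 $ 1)"] arg_cong[OF h, of "\<lambda>M. Im (M $ 2 $ 1)"]
    by (simp_all add: cmat_adj_def)
  have "g = herm_of (\<chi> k. if k = 1 then Re (g $ 1 $ 1) else if k = 2 then Re (g $ 2 $ 2)
      else if k = 3 then Re (g $ 1 $ 2) else Im (g $ 1 $ 2))"
    by (simp add: herm_of_def cmat_eq_iff complex_eq_iff e)
  then show "\<exists>x. g = herm_of x" ..
next
  have "cmat_adj (herm_of x) = herm_of x" for x
    by (simp add: herm_of_def cmat_eq_iff cmat_adj_def complex_eq_iff)
  then show "\<exists>x. g = herm_of x \<Longrightarrow> cmat_adj g = g" by blast
qed

text \<open>The real inner product is written through entries and their conjugates, operations under
  which \<open>ext_analytic\<close> is closed.\<close>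

lemma cmat_inner_eq:
  "of_real (A \<bullet> B) = (\<Sum>i\<in>UNIV. \<Sum>j\<in>UNIV. (A $ i $ j * cnj (B $ i $ j) + cnj (A $ i $ j) * B $ i $ j) / 2)" for A B :: cmat
proof -
  have "of_real (a \<bullet> b) = (a * cnj b + cnj a * b) / 2" for a b :: complex
    by (simp add: inner_complex_def complex_eq_iff)
  then show ?thesis by (simp only: inner_vec_def of_real_sum)
qed

context
  fixes z0 :: complex and \<delta> :: real
begin

private abbreviation "EA \<equiv> ext_analytic z0 \<delta>"

lemma ext_analytic_mat_mult:
  fixes A B :: "complex \<times> real \<Rightarrow> cmat"
  assumes "\<And>i j. EA (\<lambda>p. A p $ i $ j)" "\<And>i j. EA (\<lambda>p. B p $ i $ j)"
  shows "EA (\<lambda>p. (A p ** B p) $ i $ j)"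
  unfolding cmat_mult_entry by (intro ext_analytic_binary assms)

lemma ext_analytic_mat_adj:
  "(\<And>i j. EA (\<lambda>p. A p $ i $ j)) \<Longrightarrow> EA (\<lambda>p. cmat_adj (A p) $ i $ j)"
  by (simp add: cmat_adj_def ext_analytic_cnj)

lemma ext_analytic_inner:
  assumes "\<And>i j. EA (\<lambda>p. A p $ i $ j)" "\<And>i j. EA (\<lambda>p. B p $ i $ j)"
  shows "EA (\<lambda>p. of_real ((A p :: cmat) \<bullet> B p))"
  unfolding cmat_inner_eq divide_inverse
  by (intro ext_analytic_sum ext_analytic_binary ext_analytic_cnj ext_analytic_const assms)

lemma ext_analytic_det:
  fixes A :: "complex \<times> real \<Rightarrow> real^'n^'n"
  assumes "\<And>i j. EA (\<lambda>p. of_real (A p $ i $ j))"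
  shows "EA (\<lambda>p. of_real (det (A p)))"
  unfolding det_def of_real_sum of_real_mult of_real_prod
  by (intro ext_analytic_sum ext_analytic_binary ext_analytic_prod ext_analytic_const assms)

end

lemma Re_csqrt_pos: "0 < Re (csqrt z)" if "0 < Re z"
proof -
  have "Re z = (Re (csqrt z))\<^sup>2 - (Im (csqrt z))\<^sup>2"
    using arg_cong[OF power2_csqrt[of z], of Re] by (simp add: power2_eq_square)
  then have "0 < (Re (csqrt z))\<^sup>2" using that zero_le_power2[of "Im (csqrt z)"] by linarith
  then have "Re (csqrt z) \<noteq> 0" by (intro notI) (simp only: zero_power2 less_irrefl)
  then show ?thesis using Re_csqrt[of z] by linarith
qed

context
  fixes A B C :: "complex set"
begin

private abbreviation "SH' \<equiv> separately_holomorphic A B C"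

lemma separately_holomorphic_mk_mat:
  "SH' a \<Longrightarrow> SH' b \<Longrightarrow> SH' c \<Longrightarrow> SH' d \<Longrightarrow> SH' (\<lambda>z. mk_mat (a z) (b z) (c z) (d z) $ i $ j)"
  unfolding mk_mat_def by (cases "i = 1"; cases "j = 1") simp_all

lemma separately_holomorphic_If:
  "SH' (\<lambda>z. (F z :: cmat) $ i $ j) \<Longrightarrow> SH' (\<lambda>z. G z $ i $ j) \<Longrightarrow> SH' (\<lambda>z. (if P then F z else G z) $ i $ j)"
  by (cases P) simp_all

lemma separately_holomorphic_dunkl_res:
  assumes sh: "SH' l" "SH' k" "SH' r" "SH' s"
    and nz: "\<And>z. z \<in> A \<times> B \<times> C \<Longrightarrow> r z \<noteq> 0" "\<And>z. z \<in> A \<times> B \<times> C \<Longrightarrow> s z \<noteq> 0" "\<And>z. z \<in> A \<times> B \<times> C \<Longrightarrow> 1 + r z + s z \<noteq> 0"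
  shows "SH' (\<lambda>z. dunkl_res (l z) (k z) (r z) (s z) n $ i $ j)"
  unfolding dunkl_res_def Let_def
  by (intro separately_holomorphic_If separately_holomorphic_mk_mat separately_holomorphic_const
      separately_holomorphic_add separately_holomorphic_diff separately_holomorphic_minus
      separately_holomorphic_mult separately_holomorphic_divide sh;
      (frule nz(1), frule nz(2), frule nz(3), simp only: mult_eq_0_iff simp_thms))

end

text \<open>The complexification: \<open>Re \<lambda>\<close>, \<open>Im \<lambda>\<close> and \<open>a\<close> become complex variables \<open>u\<close>, \<open>v\<close>, \<open>w\<close>,
  so that \<open>\<lambda>\<close> and its conjugate become the independent quantities \<open>u + \<i> v\<close> and \<open>u - \<i> v\<close>.\<close>

definition lam_ext :: "c3 \<Rightarrow> complex" where "lam_ext z = fst z + \<i> * fst (snd z)"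

text \<open>The moduli of lam and 1 - lam become principal square roots, which are holomorphic as
  long as the radicands have positive real part.\<close>

definition res_ext :: "nat \<Rightarrow> c3 \<Rightarrow> cmat" where
  "res_ext n z = dunkl_res (lam_ext z) (fst z - \<i> * fst (snd z))
     (csqrt ((fst z)\<^sup>2 + (fst (snd z))\<^sup>2)) (csqrt ((1 - fst z)\<^sup>2 + (fst (snd z))\<^sup>2)) n"

definition conn_ext :: "c3 \<Rightarrow> complex \<Rightarrow> cmat" where
  "conn_ext z t = cscale (snd (snd z)) (cscale (1 / t) (res_ext 1 z) + cscale (1 / (t - 1)) (res_ext 3 z)
      + cscale (1 / (t - lam_ext z)) (res_ext 4 z))"

definition real_point :: "complex \<times> real \<Rightarrow> c3" where
  "real_point p = (of_real (Re (fst p)), of_real (Im (fst p)), of_real (snd p))"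

lemma lam_ext_real_point: "lam_ext (real_point (lam, a)) = lam"
  by (simp add: lam_ext_def real_point_def complex_eq_iff)

lemma conn_ext_real_point:
  assumes "lam \<in> M04" shows "conn_ext (real_point (lam, a)) = pole_conn lam a"
proof -
  have lam: "lam \<noteq> 0" "lam \<noteq> 1" using assms by (auto simp: M04_def)
  have k: "of_real (Re lam) - \<i> * of_real (Im lam) = cnj lam" by (simp add: complex_eq_iff)
  have r: "csqrt ((of_real (Re z))\<^sup>2 + (of_real (Im z))\<^sup>2) = of_real (norm z)" for z
  proof -
    have "(of_real (Re z))\<^sup>2 + (of_real (Im z))\<^sup>2 = (of_real ((Re z)\<^sup>2 + (Im z)\<^sup>2) :: complex)" by simp
    then show ?thesis unfolding cmod_def by (simp only: of_real_sqrt[OF sum_power2_ge_zero])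
  qed
  have s: "csqrt ((1 - of_real (Re lam))\<^sup>2 + (of_real (Im lam))\<^sup>2) = of_real (norm (1 - lam))"
    using r[of "1 - lam"] by (simp only: minus_complex.sel one_complex.sel of_real_diff of_real_1 diff_0 of_real_minus power2_minus)
  have "res_ext n (real_point (lam, a)) = A_mat lam n" if "n \<in> {1..4}" for n
    unfolding res_ext_def lam_ext_real_point A_mat_eq[OF lam that]
    unfolding real_point_def fst_conv snd_conv k r s ..
  then show ?thesis 
    by (simp add: fun_eq_iff conn_ext_def pole_conn_def lam_ext_real_point) (simp add: real_point_def)?
qed

definition branch :: "nat \<Rightarrow> c3 \<Rightarrow> complex" where
  "branch n z = (if n = 0 then 0 else if n = 1 then 1 else lam_ext z)"

text \<open>Together with \<open>lower_ext\<close> this collects the transports on the two sides of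
  \<open>glue_cond\<close>, now for complex parameters.\<close>

definition upper_ext :: "real \<Rightarrow> complex \<Rightarrow> nat \<Rightarrow> c3 \<Rightarrow> cmat" where
  "upper_ext \<sigma> c n z = seg_transport (conn_ext z) c (cut_point c (branch n z) \<sigma>)
     ** seg_transport (conn_ext z) (cut_point c (branch n z) \<sigma>) (cut_point c (branch n z) (- \<sigma>))"

definition lower_ext :: "real \<Rightarrow> complex \<Rightarrow> nat \<Rightarrow> c3 \<Rightarrow> cmat" where
  "lower_ext \<sigma> c n z = seg_transport (conn_ext z) c (cut_point c (branch n z) (- \<sigma>))"

definition glue_map :: "real \<Rightarrow> complex \<Rightarrow> nat \<Rightarrow> complex \<times> real \<Rightarrow> cmat \<Rightarrow> cmat" where
  "glue_map \<sigma> c n p g = cmat_adj (upper_ext \<sigma> c n (real_point p)) ** g ** upper_ext \<sigma> c n (real_point p)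
     - cmat_adj (lower_ext \<sigma> c n (real_point p)) ** g ** lower_ext \<sigma> c n (real_point p)"

definition glue_total :: "real \<Rightarrow> complex \<Rightarrow> complex \<times> real \<Rightarrow> real^4 \<Rightarrow> cmat \<times> cmat \<times> cmat" where
  "glue_total \<sigma> c p x = (glue_map \<sigma> c 0 p (herm_of x), glue_map \<sigma> c 1 p (herm_of x), glue_map \<sigma> c 2 p (herm_of x))"

definition glue_det :: "real \<Rightarrow> complex \<Rightarrow> complex \<times> real \<Rightarrow> real" where
  "glue_det \<sigma> c p = det (\<chi> k l. glue_total \<sigma> c p (axis k 1) \<bullet> glue_total \<sigma> c p (axis l 1))"

lemma glue_map_linear: "linear (glue_map \<sigma> c n p)"
proof (rule linearI)
  show "glue_map \<sigma> c n p (g + h) = glue_map \<sigma> c n p g + glue_map \<sigma> c n p h" for g h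
    by (simp add: glue_map_def cmat_eq_iff cmat_mult_entry algebra_simps)
  show "glue_map \<sigma> c n p (s *\<^sub>R g) = s *\<^sub>R glue_map \<sigma> c n p g" for s g
    by (simp add: glue_map_def cmat_mult_scaleR scaleR_diff_right)
qed

lemma glue_total_linear: "linear (glue_total \<sigma> c p)"
proof (rule linearI)
  show "glue_total \<sigma> c p (x + y) = glue_total \<sigma> c p x + glue_total \<sigma> c p y" for x y
    by (simp add: glue_total_def linear_add[OF herm_of_linear] linear_add[OF glue_map_linear])
  show "glue_total \<sigma> c p (s *\<^sub>R x) = s *\<^sub>R glue_total \<sigma> c p x" for s x
    by (simp add: glue_total_def linear_scale[OF herm_of_linear] linear_scale[OF glue_map_linear])
qed

lemma glue_cond_iff:
  assumes "lam \<in> M04"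
  shows "glue_cond (pole_conn lam a) c \<sigma> (branch n (real_point (lam, a))) g \<longleftrightarrow> glue_map \<sigma> c n (lam, a) g = 0"
  unfolding glue_cond_def Let_def glue_map_def upper_ext_def lower_ext_def conn_ext_real_point[OF assms]
  by (simp only: right_minus_eq)

lemma Z_set_iff_glue_det:
  assumes lam: "lam \<in> M04" and sep: "sep_base \<epsilon> c {0, 1, lam}" and \<sigma>: "0 < \<sigma>" "\<sigma> < \<epsilon>"
  shows "(lam, a) \<in> Z_set \<longleftrightarrow> glue_det \<sigma> c (lam, a) = 0"
proof -
  let ?G = "\<lambda>p g. glue_cond (pole_conn lam a) c \<sigma> p g"
  have b: "branch 0 (real_point (lam, a)) = 0" "branch 1 (real_point (lam, a)) = 1" "branch 2 (real_point (lam, a)) = lam"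
    by (simp_all add: branch_def lam_ext_real_point)
  have "(\<forall>p\<in>{0, 1, lam}. ?G p (herm_of x)) \<longleftrightarrow> glue_total \<sigma> c (lam, a) x = 0" for x
    using glue_cond_iff[OF lam, of a c \<sigma> 0 "herm_of x"] glue_cond_iff[OF lam, of a c \<sigma> 1 "herm_of x"]
      glue_cond_iff[OF lam, of a c \<sigma> 2 "herm_of x"]
    unfolding b by (simp add: glue_total_def zero_prod_def)
  note total = this
  have "(lam, a) \<in> Z_set \<longleftrightarrow> (\<exists>g. parallel_on (- {0, 1, lam}) (pole_conn lam a) g \<and> (\<exists>t\<in>- {0, 1, lam}. g t \<noteq> 0))"
    unfolding preserves_iff_parallel[OF lam, symmetric] by (simp add: Z_set_def lam)
  also have "\<dots> \<longleftrightarrow> (\<exists>g0. cmat_adj g0 = g0 \<and> g0 \<noteq> 0 \<and> (\<forall>p\<in>{0, 1, lam}. ?G p g0))"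
    by (rule parallel_iff_glue[OF sep _ pole_conn_holomorphic \<sigma>]) simp
  also have "\<dots> \<longleftrightarrow> (\<exists>x. herm_of x \<noteq> 0 \<and> (\<forall>p\<in>{0, 1, lam}. ?G p (herm_of x)))"
    unfolding range_herm_of by blast
  also have "\<dots> \<longleftrightarrow> (\<exists>x. x \<noteq> 0 \<and> glue_total \<sigma> c (lam, a) x = 0)"
    unfolding total herm_of_eq_0 ..
  also have "\<dots> \<longleftrightarrow> glue_det \<sigma> c (lam, a) = 0"
    unfolding glue_det_def gram_det_eq_0_iff[OF glue_total_linear] ..
  finally show ?thesis .
qed

context
  fixes lam0 c :: complex and \<epsilon> \<delta> :: real
  assumes sep: "\<And>l. l \<in> ball lam0 (2 * \<delta>) \<Longrightarrow> sep_base \<epsilon> c {0, 1, l}"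
    and pos: "\<And>u v. u \<in> ball (of_real (Re lam0)) \<delta> \<Longrightarrow> v \<in> ball (of_real (Im lam0)) \<delta> \<Longrightarrow>
      0 < Re (u\<^sup>2 + v\<^sup>2) \<and> 0 < Re ((1 - u)\<^sup>2 + v\<^sup>2)"
begin

private abbreviation "X \<equiv> ball (of_real (Re lam0)) \<delta> :: complex set"
private abbreviation "Y \<equiv> ball (of_real (Im lam0)) \<delta> :: complex set"
private abbreviation "SHX \<equiv> separately_holomorphic X Y UNIV"

text \<open>Each of the two complexified coordinates moves by less than \<delta>, hence the third
  pole by less than 2 \<delta>. This is the origin of the radius in the assumption on
  \<open>sep_base\<close>.\<close>

lemma lam_ext_mem:
  assumes "z \<in> X \<times> Y \<times> UNIV" shows "lam_ext z \<in> ball lam0 (2 * \<delta>)"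
proof -
  have e: "lam0 - lam_ext z = (of_real (Re lam0) - fst z) + \<i> * (of_real (Im lam0) - fst (snd z))"
    by (subst complex_eq[of lam0]) (simp add: lam_ext_def algebra_simps)
  have "norm (lam0 - lam_ext z) \<le> norm (of_real (Re lam0) - fst z) + norm (of_real (Im lam0) - fst (snd z))"
    unfolding e using norm_triangle_ineq[of "of_real (Re lam0) - fst z" "\<i> * (of_real (Im lam0) - fst (snd z))"]
    by (simp add: norm_mult)
  moreover have "norm (of_real (Re lam0) - fst z) < \<delta>" "norm (of_real (Im lam0) - fst (snd z)) < \<delta>"
    using assms by (auto simp: dist_norm)
  ultimately show ?thesis by (simp add: dist_norm)
qed

lemma lam_ext_holomorphic: "SHX lam_ext"
  unfolding lam_ext_def
  by (intro separately_holomorphic_add separately_holomorphic_mult separately_holomorphic_const separately_holomorphic_proj)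

lemma branch_holomorphic: "SHX (branch n)"
  unfolding branch_def
  by (cases "n = 0"; cases "n = 1") (simp_all add: separately_holomorphic_const lam_ext_holomorphic)

lemma res_ext_holomorphic: "SHX (\<lambda>z. res_ext n z $ i $ j)"
proof -
  note SHi = separately_holomorphic_add separately_holomorphic_diff separately_holomorphic_mult
    separately_holomorphic_const separately_holomorphic_proj
  have p: "0 < Re ((fst z)\<^sup>2 + (fst (snd z))\<^sup>2)" "0 < Re ((1 - fst z)\<^sup>2 + (fst (snd z))\<^sup>2)" if "z \<in> X \<times> Y \<times> UNIV" for z
  proof -
    have "fst z \<in> X" "fst (snd z) \<in> Y" using that by auto
    from pos[OF this] show "0 < Re ((fst z)\<^sup>2 + (fst (snd z))\<^sup>2)" "0 < Re ((1 - fst z)\<^sup>2 + (fst (snd z))\<^sup>2)" by blast+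
  qed
  have q: "SHX (\<lambda>z. (fst z)\<^sup>2 + (fst (snd z))\<^sup>2)" "SHX (\<lambda>z. (1 - fst z)\<^sup>2 + (fst (snd z))\<^sup>2)"
    unfolding power2_eq_square by (intro SHi)+
  note pc = Re_csqrt_pos[OF p(1)] Re_csqrt_pos[OF p(2)]
  have nz: "Re w > 0 \<Longrightarrow> w \<noteq> 0" for w by auto
  have nz3: "Re w > 0 \<Longrightarrow> Re w' > 0 \<Longrightarrow> 1 + w + w' \<noteq> 0" for w w' by (intro nz) simp
  show ?thesis unfolding res_ext_def
  proof (rule separately_holomorphic_dunkl_res)
    show "SHX (\<lambda>z. csqrt ((fst z)\<^sup>2 + (fst (snd z))\<^sup>2))" by (rule separately_holomorphic_csqrt[OF q(1) p(1)])
    show "SHX (\<lambda>z. csqrt ((1 - fst z)\<^sup>2 + (fst (snd z))\<^sup>2))" by (rule separately_holomorphic_csqrt[OF q(2) p(2)])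
    fix z assume z: "z \<in> X \<times> Y \<times> (UNIV :: complex set)"
    show "csqrt ((fst z)\<^sup>2 + (fst (snd z))\<^sup>2) \<noteq> 0" by (rule nz[OF pc(1)[OF z]])
    show "csqrt ((1 - fst z)\<^sup>2 + (fst (snd z))\<^sup>2) \<noteq> 0" by (rule nz[OF pc(2)[OF z]])
    show "1 + csqrt ((fst z)\<^sup>2 + (fst (snd z))\<^sup>2) + csqrt ((1 - fst z)\<^sup>2 + (fst (snd z))\<^sup>2) \<noteq> 0"
      by (rule nz3[OF pc(1)[OF z] pc(2)[OF z]])
  qed (intro SHi lam_ext_holomorphic)+
qed

text \<open>After parametrising the moving segment by [0, 1], the coefficients of the differential
  equation are separately holomorphic in the parameters, since the segment stays away from the
  moving pole.\<close>

lemma seg_transport_ext_holomorphic: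
  assumes x: "SHX x" and y: "SHX y"
    and seg: "\<And>z. z \<in> X \<times> Y \<times> UNIV \<Longrightarrow> closed_segment (x z) (y z) \<subseteq> - {0, 1, lam_ext z}"
  shows "SHX (\<lambda>z. seg_transport (conn_ext z) (x z) (y z) $ i $ j)"
  unfolding seg_transport_def
proof (rule separately_holomorphic_transport)
  let ?O = "X \<times> Y \<times> (UNIV :: complex set)"
  define w where "w z = snd (snd z)" for z :: c3
  have w: "SHX w" unfolding w_def by (rule separately_holomorphic_proj)
  have "x z + of_real s * (y z - x z) \<in> - {0, 1, lam_ext z}" if "z \<in> ?O" "s \<in> {0..1}" for z s
    using seg[OF that(1)] segment_point[OF that(2)] by blast
  then have av: "x z + of_real s * (y z - x z) \<noteq> 0" "x z + of_real s * (y z - x z) - 1 \<noteq> 0"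
      "x z + of_real s * (y z - x z) - lam_ext z \<noteq> 0" if "z \<in> ?O" "s \<in> {0..1}" for z s
    using that by force+
  have entry: "seg_conn (conn_ext z) (x z) (y z) s $ i $ j
      = - (y z - x z) * (w z * (1 / (x z + of_real s * (y z - x z)) * d1 z
          + 1 / (x z + of_real s * (y z - x z) - 1) * d3 z + 1 / (x z + of_real s * (y z - x z) - lam_ext z) * d4 z))"
    if "d1 = (\<lambda>z. res_ext 1 z $ i $ j)" "d3 = (\<lambda>z. res_ext 3 z $ i $ j)" "d4 = (\<lambda>z. res_ext 4 z $ i $ j)"
    for z s i j and d1 d3 d4 :: "c3 \<Rightarrow> complex"
    unfolding that by (simp only: seg_conn_def conn_ext_def cscale_entry vector_add_component w_def)
  have cf: "continuous_on (?O \<times> {0..1::real}) (\<lambda>p. h (fst p))" if "SHX h" for h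
  proof (rule continuous_on_compose2[of ?O h "?O \<times> {0..1::real}" fst])
    show "continuous_on ?O h" using that unfolding separately_holomorphic_def by (elim conjE)
  qed (auto intro: continuous_intros)
  show "continuous_on (?O \<times> {0..1}) (\<lambda>(z, s). seg_conn (conn_ext z) (x z) (y z) s)"
    unfolding case_prod_unfold
  proof (rule continuous_on_cmat)
    fix i j
    define d1 where "d1 = (\<lambda>z. res_ext 1 z $ i $ j)"
    define d3 where "d3 = (\<lambda>z. res_ext 3 z $ i $ j)"
    define d4 where "d4 = (\<lambda>z. res_ext 4 z $ i $ j)"
    have d: "SHX d1" "SHX d3" "SHX d4" unfolding d1_def d3_def d4_def by (rule res_ext_holomorphic)+
    note cs = d[THEN cf] w[THEN cf] x[THEN cf] y[THEN cf] lam_ext_holomorphic[THEN cf]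
    have sc: "continuous_on (?O \<times> {0..1}) (\<lambda>p. of_real (snd p) :: complex)" by (intro continuous_intros)
    have av': "x (fst p) + of_real (snd p) * (y (fst p) - x (fst p)) \<noteq> 0"
      "x (fst p) + of_real (snd p) * (y (fst p) - x (fst p)) - 1 \<noteq> 0"
      "x (fst p) + of_real (snd p) * (y (fst p) - x (fst p)) - lam_ext (fst p) \<noteq> 0" if "p \<in> ?O \<times> {0..1}" for p
      using av[of "fst p" "snd p"] that unfolding mem_Times_iff[of p] by blast+
    show "continuous_on (?O \<times> {0..1}) (\<lambda>p. seg_conn (conn_ext (fst p)) (x (fst p)) (y (fst p)) (snd p) $ i $ j)"
      unfolding entry[OF d1_def d3_def d4_def]
      by (intro continuous_on_mult continuous_on_minus continuous_on_add continuous_on_diff continuous_on_divide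
          continuous_on_const cs sc ballI av')
  qed
  fix s :: real and i j assume s: "s \<in> {0..1}"
  define d1 where "d1 = (\<lambda>z. res_ext 1 z $ i $ j)"
  define d3 where "d3 = (\<lambda>z. res_ext 3 z $ i $ j)"
  define d4 where "d4 = (\<lambda>z. res_ext 4 z $ i $ j)"
  have d: "SHX d1" "SHX d3" "SHX d4" unfolding d1_def d3_def d4_def by (rule res_ext_holomorphic)+
  show "SHX (\<lambda>z. seg_conn (conn_ext z) (x z) (y z) s $ i $ j)"
    unfolding entry[OF d1_def d3_def d4_def]
    by (intro separately_holomorphic_mult separately_holomorphic_minus separately_holomorphic_add separately_holomorphic_diff
        separately_holomorphic_divide separately_holomorphic_const d w x y lam_ext_holomorphic av[OF _ s])
qed auto

lemma cut_point_ext_holomorphic: "SHX (\<lambda>z. cut_point c (branch n z) \<sigma>)"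
  unfolding cut_point_def
  by (intro separately_holomorphic_add separately_holomorphic_diff separately_holomorphic_mult
      separately_holomorphic_const branch_holomorphic)

lemma cut_segments:
  assumes z: "z \<in> X \<times> Y \<times> UNIV" and \<sigma>: "\<sigma> \<noteq> 0" "\<bar>\<sigma>\<bar> < \<epsilon>"
  shows "closed_segment c (cut_point c (branch n z) \<sigma>) \<subseteq> - {0, 1, lam_ext z}"
    "closed_segment (cut_point c (branch n z) \<sigma>) (cut_point c (branch n z) (- \<sigma>)) \<subseteq> - {0, 1, lam_ext z}"
proof -
  note sp = sep[OF lam_ext_mem[OF z]]
  have b: "branch n z \<in> {0, 1, lam_ext z}" by (simp add: branch_def)
  show "closed_segment c (cut_point c (branch n z) \<sigma>) \<subseteq> - {0, 1, lam_ext z}"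
    using cut_point_in_star[OF sp b \<sigma>(2,1)] unfolding star_region_def by blast
  show "closed_segment (cut_point c (branch n z) \<sigma>) (cut_point c (branch n z) (- \<sigma>)) \<subseteq> - {0, 1, lam_ext z}"
    by (rule sector_segment(2)[OF sp b cut_point_in_sector[OF sp b] cut_point_in_sector[OF sp b]]) (use \<sigma> in simp_all)
qed

text \<open>The determinant is built from entries of transports by sums, products and conjugations,
  each of which preserves \<open>ext_analytic\<close>.\<close>

lemma glue_det_ext_analytic:
  assumes \<sigma>: "0 < \<sigma>" "\<sigma> < \<epsilon>"
  shows "ext_analytic lam0 \<delta> (\<lambda>p. of_real (glue_det \<sigma> c p))"
proof -
  have rp: "ext_analytic lam0 \<delta> (\<lambda>p. \<Phi> (real_point p))" if "SHX \<Phi>" for \<Phi>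
    unfolding ext_analytic_def extends_def using that by (intro exI[of _ \<Phi>]) (simp add: real_point_def)
  have c: "SHX (\<lambda>_. c)" by (rule separately_holomorphic_const)
  have \<sigma>': "\<sigma> \<noteq> 0" "\<bar>\<sigma>\<bar> < \<epsilon>" "- \<sigma> \<noteq> 0" "\<bar>- \<sigma>\<bar> < \<epsilon>" using \<sigma> by auto
  have up: "ext_analytic lam0 \<delta> (\<lambda>p. upper_ext \<sigma> c n (real_point p) $ i $ j)" for n i j
    unfolding upper_ext_def
    by (intro ext_analytic_mat_mult rp[of "\<lambda>z. seg_transport (conn_ext z) c (cut_point c (branch n z) \<sigma>) $ i $ j" for i j]
        rp[of "\<lambda>z. seg_transport (conn_ext z) (cut_point c (branch n z) \<sigma>) (cut_point c (branch n z) (- \<sigma>)) $ i $ j" for i j]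
        seg_transport_ext_holomorphic c cut_point_ext_holomorphic cut_segments \<sigma>')
  have lo: "ext_analytic lam0 \<delta> (\<lambda>p. lower_ext \<sigma> c n (real_point p) $ i $ j)" for n i j
    unfolding lower_ext_def
    by (intro rp[of "\<lambda>z. seg_transport (conn_ext z) c (cut_point c (branch n z) (- \<sigma>)) $ i $ j"]
        seg_transport_ext_holomorphic c cut_point_ext_holomorphic cut_segments \<sigma>')
  have gm: "ext_analytic lam0 \<delta> (\<lambda>p. glue_map \<sigma> c n p g $ i $ j)" for n g i j
    unfolding glue_map_def vector_minus_component
    by (intro ext_analytic_binary(2) ext_analytic_mat_mult ext_analytic_mat_adj up lo ext_analytic_const)
  have gt: "ext_analytic lam0 \<delta> (\<lambda>p. of_real (glue_total \<sigma> c p x \<bullet> glue_total \<sigma> c p y))" for x y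
    unfolding glue_total_def inner_prod_def fst_conv snd_conv of_real_add
    by (intro ext_analytic_binary(1) ext_analytic_inner gm)
  show ?thesis unfolding glue_det_def
    by (rule ext_analytic_det) (simp add: gt)
qed

end

section \<open>Local equations\<close>

lemma base_point_exists:
  assumes lam0: "lam0 \<in> M04"
  obtains c \<epsilon> where "sep_base \<epsilon> c {0, 1, lam0}"
proof -
  define x where "x = Re lam0"
  define y where "y = Im lam0"
  have "lam0 \<noteq> 0" "lam0 \<noteq> 1" using lam0 by (auto simp: M04_def)
  then have y0: "x \<noteq> 0 \<and> x \<noteq> 1" if "y = 0" using that by (auto simp: x_def y_def complex_eq_iff)
  \<comment> \<open>The two equations excluded say that c = s + i is collinear with 0 and
    \<open>lam0\<close>, respectively with 1 and \<open>lam0\<close>. For y \<noteq> 0 each rules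
    out at most one s, so one of three trial values works.\<close>
  have "\<exists>s. s * y \<noteq> x \<and> s * y \<noteq> x + y - 1"
  proof (cases "y = 0")
    case True
    then show ?thesis using y0 by auto
  next
    case False
    have "(0 * y \<noteq> x \<and> 0 * y \<noteq> x + y - 1) \<or> (1 * y \<noteq> x \<and> 1 * y \<noteq> x + y - 1) \<or> (2 * y \<noteq> x \<and> 2 * y \<noteq> x + y - 1)"
      using False by linarith
    then show ?thesis by blast
  qed
  then obtain s where s: "s * y \<noteq> x" "s * y \<noteq> x + y - 1" by blast
  define c where "c = Complex s 1"
  have l: "lam0 = Complex x y" by (simp add: x_def y_def)
  have nc: "c \<noteq> 0" "c \<noteq> 1" by (simp_all add: c_def complex_eq_iff)
  have nl: "c \<noteq> lam0" using s by (auto simp: c_def l)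
  have cr: "Im ((1 - c) * cnj (0 - c)) \<noteq> 0" "Im ((lam0 - c) * cnj (0 - c)) \<noteq> 0" "Im ((lam0 - c) * cnj (1 - c)) \<noteq> 0"
    using s by (simp_all add: c_def l algebra_simps)
  have cr': "Im ((0 - c) * cnj (1 - c)) \<noteq> 0" "Im ((0 - c) * cnj (lam0 - c)) \<noteq> 0" "Im ((1 - c) * cnj (lam0 - c)) \<noteq> 0"
    using s by (simp_all add: c_def l algebra_simps)
  have d: "Im ((p' - c) / (p - c)) \<noteq> 0" if p: "p \<in> {0, 1, lam0}" "p' \<in> {0, 1, lam0}" "p' \<noteq> p" for p p'
  proof -
    have "p - c \<noteq> 0" using p(1) nc nl by auto
    note iff = Im_divide_eq_0[OF this]
    consider "p' = 1" "p = 0" | "p' = lam0" "p = 0" | "p' = lam0" "p = 1" | "p' = 0" "p = 1" | "p' = 0" "p = lam0" | "p' = 1" "p = lam0"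
      using p by blast
    then show ?thesis unfolding iff
      by cases (use cr cr' in \<open>simp_all only: not_False_eq_True\<close>)
  qed
  obtain \<epsilon> where "sep_base \<epsilon> c {0, 1, lam0}"
    using sep_base_exists[of "{0, 1, lam0}" c] nc nl d by auto
  then show thesis by (rule that)
qed

lemma eventually_less_nhds:
  fixes f g :: "'a::topological_space \<Rightarrow> real"
  assumes "(f \<longlongrightarrow> f x) (nhds x)" "(g \<longlongrightarrow> g x) (nhds x)" "f x < g x"
  shows "\<forall>\<^sub>F y in nhds x. f y < g y"
proof -
  have "((\<lambda>y. g y - f y) \<longlongrightarrow> g x - f x) (nhds x)" by (intro tendsto_intros assms)
  then have "\<forall>\<^sub>F y in nhds x. 0 < g y - f y" using assms(3) by (intro order_tendstoD(1)) auto
  then show ?thesis by (rule eventually_mono) simp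
qed

text \<open>For a fixed base point and a fixed \<open>\<epsilon>\<close> the condition consists of
  finitely many strict inequalities that depend continuously on the third pole.\<close>

lemma sep_base_stable:
  assumes lam0: "lam0 \<in> M04" and sep: "sep_base \<epsilon> c {0, 1, lam0}"
  shows "\<forall>\<^sub>F l in nhds lam0. sep_base \<epsilon> c {0, 1, l} \<and> l \<in> M04"
proof -
  have ne: "lam0 \<noteq> 0" "lam0 \<noteq> 1" using lam0 by (auto simp: M04_def)
  have nc: "c \<noteq> 0" "c \<noteq> 1" "c \<noteq> lam0" "0 < \<epsilon>" using sep by (auto simp: sep_base_def)
  define h where "h a b = \<bar>Im (b / a)\<bar> - \<epsilon> * Re (b / a)" for a b :: complex
  have lim: "((\<lambda>l. l) \<longlongrightarrow> lam0) (nhds lam0)" by (rule filterlim_ident)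
  have ev: "\<forall>\<^sub>F l in nhds lam0. 0 < h (f l) (g l)"
    if "(f \<longlongrightarrow> f lam0) (nhds lam0)" "(g \<longlongrightarrow> g lam0) (nhds lam0)" "f lam0 \<noteq> 0" "0 < h (f lam0) (g lam0)" for f g
    
    by (rule eventually_less_nhds[where f = "\<lambda>_. 0" and g = "\<lambda>l. h (f l) (g l)", OF tendsto_const _ that(4)])
      (unfold h_def, intro tendsto_intros that)
  have pr: "0 < h (p - c) (p' - c)" if "p \<in> {0, 1, lam0}" "p' \<in> {0, 1, lam0}" "p' \<noteq> p" for p p'
    using sep that unfolding sep_base_def h_def by auto
  have lc: "((\<lambda>l. l - c) \<longlongrightarrow> lam0 - c) (nhds lam0)" by (intro tendsto_intros lim)
  have nz: "1 - c \<noteq> 0" "0 - c \<noteq> 0" "lam0 - c \<noteq> 0" using nc by simp_all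
  have i: "0 < h (1 - c) (lam0 - c)" "0 < h (0 - c) (lam0 - c)" "0 < h (lam0 - c) (1 - c)" "0 < h (lam0 - c) (0 - c)"
    by (rule pr; use ne in simp)+
  have cst: "0 < h (1 - c) (0 - c)" "0 < h (0 - c) (1 - c)" by (rule pr; simp)+
  have "\<forall>\<^sub>F l in nhds lam0. 0 < h (1 - c) (l - c)" by (rule ev[OF tendsto_const lc nz(1) i(1)])
  moreover have "\<forall>\<^sub>F l in nhds lam0. 0 < h (0 - c) (l - c)" by (rule ev[OF tendsto_const lc nz(2) i(2)])
  moreover have "\<forall>\<^sub>F l in nhds lam0. 0 < h (l - c) (1 - c)" by (rule ev[OF lc tendsto_const nz(3) i(3)])
  moreover have "\<forall>\<^sub>F l in nhds lam0. 0 < h (l - c) (0 - c)" by (rule ev[OF lc tendsto_const nz(3) i(4)])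
  moreover have "\<forall>\<^sub>F l in nhds lam0. l \<noteq> c" "\<forall>\<^sub>F l in nhds lam0. l \<noteq> 0" "\<forall>\<^sub>F l in nhds lam0. l \<noteq> 1"
    using t1_space_nhds[of lam0 c] t1_space_nhds[of lam0 0] t1_space_nhds[of lam0 1] nc ne by auto
  ultimately show ?thesis
  proof eventually_elim
    case (elim l)
    have "0 < h (p - c) (p' - c)" if pp: "p \<in> {0, 1, l}" "p' \<in> {0, 1, l}" "p' \<noteq> p" for p p'
    proof -
      consider "p' = 1" "p = 0" | "p' = l" "p = 0" | "p' = l" "p = 1" | "p' = 0" "p = 1" | "p' = 0" "p = l" | "p' = 1" "p = l"
        using pp by blast
      then show ?thesis by cases (use elim cst in \<open>simp_all only:\<close>)
    qed
    then have "\<forall>p\<in>{0, 1, l}. \<forall>p'\<in>{0, 1, l}. p' \<noteq> p \<longrightarrow> \<epsilon> * Re ((p' - c) / (p - c)) < \<bar>Im ((p' - c) / (p - c))\<bar>"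
      unfolding h_def diff_gt_0_iff_gt by blast
    then show ?case using elim nc unfolding sep_base_def M04_def by blast
  qed
qed

text \<open>The base point and slope chosen for \<open>lam0\<close> also serve all nearby
  complexified parameters, so a single Gram determinant describes \<open>Z_set\<close> over a whole
  box.\<close>

lemma real_analytic_chart:
  assumes lam0: "lam0 \<in> M04"
  obtains \<delta> f \<Phi> where "0 < \<delta>" "extends lam0 \<delta> (\<lambda>p. of_real (f p)) \<Phi>"
    "\<forall>lam a. (lam, a) \<in> box3 lam0 \<delta> \<longrightarrow> lam \<in> M04 \<and> ((lam, a) \<in> Z_set \<longleftrightarrow> f (lam, a) = 0)"
proof -
  obtain c \<epsilon> where sep: "sep_base \<epsilon> c {0, 1, lam0}" by (rule base_point_exists[OF lam0])
  have \<epsilon>: "0 < \<epsilon>" using sep by (simp add: sep_base_def)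
  obtain d where d0: "0 < d" "\<forall>l. dist l lam0 < d \<longrightarrow> sep_base \<epsilon> c {0, 1, l} \<and> l \<in> M04"
    using sep_base_stable[OF lam0 sep] unfolding eventually_nhds_metric by (elim exE conjE)
  have d: "0 < d" "\<And>l. l \<in> ball lam0 d \<Longrightarrow> sep_base \<epsilon> c {0, 1, l} \<and> l \<in> M04"
    using d0 by (simp_all only: mem_ball dist_commute[of lam0] simp_thms)
  define x where "x = complex_of_real (Re lam0)"
  define y where "y = complex_of_real (Im lam0)"
  define S where "S = {p :: complex \<times> complex. 0 < Re ((fst p)\<^sup>2 + (snd p)\<^sup>2) \<and> 0 < Re ((1 - fst p)\<^sup>2 + (snd p)\<^sup>2)}"
  have "open S" unfolding S_def by (intro open_Collect_conj open_Collect_less continuous_intros)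
  moreover have "(x, y) \<in> S"
  proof -
    have e: "Re (x\<^sup>2 + y\<^sup>2) = (norm lam0)\<^sup>2" "Re ((1 - x)\<^sup>2 + y\<^sup>2) = (norm (1 - lam0))\<^sup>2"
      unfolding cmod_power2 by (simp_all add: x_def y_def power2_eq_square)
    have "lam0 \<noteq> 0" "1 - lam0 \<noteq> 0" using lam0 by (auto simp: M04_def)
    then have "0 < (norm lam0)\<^sup>2" "0 < (norm (1 - lam0))\<^sup>2" by simp_all
    then show ?thesis unfolding S_def mem_Collect_eq fst_conv snd_conv e by blast
  qed
  ultimately obtain U V where UV: "open U" "open V" "(x, y) \<in> U \<times> V" "U \<times> V \<subseteq> S"
    by (rule open_prod_elim)
  have xU: "x \<in> U" "y \<in> V" using UV(3) by auto
  obtain d1 where d1: "0 < d1" "ball x d1 \<subseteq> U" by (rule openE[OF UV(1) xU(1)])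
  obtain d2 where d2: "0 < d2" "ball y d2 \<subseteq> V" by (rule openE[OF UV(2) xU(2)])
  \<comment> \<open>Half of \<open>d\<close> accounts for the factor 2 in
    \<open>lam_ext_mem\<close>; \<open>d1\<close> and \<open>d2\<close> keep the radicands of the
    two square roots in the right half-plane.\<close>
  define \<delta> where "\<delta> = min (d / 2) (min d1 d2)"
  have \<delta>: "0 < \<delta>" "2 * \<delta> \<le> d" "\<delta> \<le> d1" "\<delta> \<le> d2" using d d1 d2 by (auto simp: \<delta>_def)
  have sep': "sep_base \<epsilon> c {0, 1, l}" if "l \<in> ball lam0 (2 * \<delta>)" for l using d(2)[of l] that \<delta> by auto
  have pos: "0 < Re (u\<^sup>2 + v\<^sup>2) \<and> 0 < Re ((1 - u)\<^sup>2 + v\<^sup>2)" if "u \<in> ball x \<delta>" "v \<in> ball y \<delta>" for u v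
  proof -
    have "u \<in> ball x d1" "v \<in> ball y d2" using that \<delta> by simp_all
    then have "(u, v) \<in> S" using d1(2) d2(2) UV(4) by blast
    then show ?thesis by (simp only: S_def mem_Collect_eq fst_conv snd_conv)
  qed
  have \<sigma>: "0 < \<epsilon> / 2" "\<epsilon> / 2 < \<epsilon>" using \<epsilon> by auto
  have "ext_analytic lam0 \<delta> (\<lambda>p. of_real (glue_det (\<epsilon> / 2) c p))"
  proof (rule glue_det_ext_analytic[OF _ _ \<sigma>])
    show "sep_base \<epsilon> c {0, 1, l}" if "l \<in> ball lam0 (2 * \<delta>)" for l by (rule sep'[OF that])
    show "0 < Re (u\<^sup>2 + v\<^sup>2) \<and> 0 < Re ((1 - u)\<^sup>2 + v\<^sup>2)"
      if "u \<in> ball (of_real (Re lam0)) \<delta>" "v \<in> ball (of_real (Im lam0)) \<delta>" for u v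
      by (rule pos[unfolded x_def y_def, OF that])
  qed
  then obtain \<Phi> where \<Phi>: "extends lam0 \<delta> (\<lambda>p. of_real (glue_det (\<epsilon> / 2) c p)) \<Phi>"
    unfolding ext_analytic_def ..
  show thesis
  proof (rule that[OF \<delta>(1) \<Phi>], intro allI impI)
    fix lam a assume b: "(lam, a) \<in> box3 lam0 \<delta>"
    have "norm (lam - lam0) \<le> \<bar>Re (lam - lam0)\<bar> + \<bar>Im (lam - lam0)\<bar>" by (rule cmod_le)
    moreover have "\<bar>Re (lam - lam0)\<bar> < \<delta>" "\<bar>Im (lam - lam0)\<bar> < \<delta>" using b by (simp_all add: box3_def)
    moreover have "dist lam0 lam = norm (lam - lam0)" by (simp only: dist_norm norm_minus_commute)
    ultimately have "lam \<in> ball lam0 d" using \<delta>(2) unfolding mem_ball by linarith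
    from d(2)[OF this] have m: "lam \<in> M04" and sp: "sep_base \<epsilon> c {0, 1, lam}" by blast+
    show "lam \<in> M04 \<and> ((lam, a) \<in> Z_set \<longleftrightarrow> glue_det (\<epsilon> / 2) c (lam, a) = 0)"
      by (rule conjI[OF m Z_set_iff_glue_det[OF m sp \<sigma>]])
  qed
qed

section \<open>Nontriviality, closedness and measure\<close>

lemma box3_open: "open (box3 z0 \<delta>)"
proof -
  have "box3 z0 \<delta> = {p. \<bar>Re (fst p) - Re z0\<bar> < \<delta>} \<inter> {p. \<bar>Im (fst p) - Im z0\<bar> < \<delta>}" by (auto simp: box3_def)
  also have "open \<dots>" by (intro open_Int open_Collect_less continuous_intros)
  finally show ?thesis .
qed

lemma box3_connected: "connected (box3 z0 \<delta>)"
proof -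
  have c: "convex {p :: complex \<times> real. \<bar>L p - k\<bar> < \<delta>}" if "linear L" for L :: "complex \<times> real \<Rightarrow> real" and k
  proof -
    have "{p. \<bar>L p - k\<bar> < \<delta>} = L -` {k - \<delta><..<k + \<delta>}" by (auto simp: abs_less_iff)
    then show ?thesis using convex_linear_vimage[OF that convex_real_interval(8)] by simp
  qed
  have "box3 z0 \<delta> = {p. \<bar>Re (fst p) - Re z0\<bar> < \<delta>} \<inter> {p. \<bar>Im (fst p) - Im z0\<bar> < \<delta>}" by (auto simp: box3_def)
  also have "convex \<dots>" by (intro convex_Int c linearI) auto
  finally show ?thesis by (rule convex_connected)
qed

lemma generic_point_exists:
  assumes "0 < \<delta>"
  obtains lam where "\<bar>Re lam - Re z0\<bar> < \<delta>" "\<bar>Im lam - Im z0\<bar> < \<delta>" "Im lam \<noteq> 0" "Re lam \<noteq> 1 / 2"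
proof -
  have ex: "\<exists>t. \<bar>t - x\<bar> < \<delta> \<and> t \<noteq> k" for x k :: real
  proof (cases "x = k")
    case True
    then show ?thesis using assms by (intro exI[of _ "x + \<delta> / 2"]) auto
  next
    case False
    then show ?thesis using assms by (intro exI[of _ x]) auto
  qed
  obtain t where "\<bar>t - Re z0\<bar> < \<delta>" "t \<noteq> 1 / 2" using ex[of "Re z0" "1 / 2"] by blast
  moreover obtain s where "\<bar>s - Im z0\<bar> < \<delta>" "s \<noteq> 0" using ex[of "Im z0" 0] by blast
  ultimately show thesis by (intro that[of "Complex t s"]) auto
qed

text \<open>On a slice the equation extends to an entire function of \<open>a\<close>, which is not identically zero.\<close>

lemma Z_set_slice_countable:
  assumes lam: "Im lam \<noteq> 0" "Re lam \<noteq> 1 / 2"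
  shows "countable {a. (lam, a) \<in> Z_set}"
proof -
  have M: "lam \<in> M04" using lam by (auto simp: M04_def)
  obtain \<delta> f \<Phi> where \<delta>: "0 < \<delta>" and ext: "extends lam \<delta> (\<lambda>p. of_real (f p)) \<Phi>"
    and Z': "\<forall>l a. (l, a) \<in> box3 lam \<delta> \<longrightarrow> l \<in> M04 \<and> ((l, a) \<in> Z_set \<longleftrightarrow> f (l, a) = 0)"
    by (rule real_analytic_chart[OF M])
  note Z = Z'[rule_format]
  define h where "h w = \<Phi> (of_real (Re lam), of_real (Im lam), w)" for w
  have b: "(lam, a) \<in> box3 lam \<delta>" for a using \<delta> by (simp add: box3_def)
  have e: "\<forall>z a. (z, a) \<in> box3 lam \<delta> \<longrightarrow> of_real (f (z, a)) = \<Phi> (of_real (Re z), of_real (Im z), of_real a)"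
    using ext unfolding extends_def by (elim conjE)
  have hf: "h (of_real a) = of_real (f (lam, a))" for a
    unfolding h_def by (rule e[rule_format, OF b, symmetric])
  have Za: "(lam, a) \<in> Z_set \<longleftrightarrow> h (of_real a) = 0" for a
    using Z[OF b, of a] unfolding hf of_real_eq_0_iff by blast
  have sh: "\<forall>u\<in>ball (of_real (Re lam)) \<delta>. \<forall>v\<in>ball (of_real (Im lam)) \<delta>. (\<lambda>w. \<Phi> (u, v, w)) holomorphic_on UNIV"
    using ext unfolding extends_def separately_holomorphic_def by (elim conjE)
  have hol: "h holomorphic_on UNIV" unfolding h_def by (rule sh[rule_format]) (use \<delta> in simp_all)
  obtain a0 where a0: "h (of_real a0) \<noteq> 0"
    using exists_not_preserving[OF lam] Za unfolding Z_set_def by auto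
  have "countable {z \<in> UNIV. h z = 0}"
  proof (cases "h constant_on UNIV")
    case True
    then obtain k where "\<And>z. h z = k" by (auto simp: constant_on_def)
    then show ?thesis using a0 by simp
  next
    case False
    show ?thesis by (rule holomorphic_countable_zeros[OF hol open_UNIV connected_UNIV fsigma_UNIV False])
  qed
  then have "countable {a. of_real a \<in> {z \<in> UNIV. h z = 0}}" by (rule countable_image_inj[OF _ inj_of_real])
  then show ?thesis unfolding Za by simp
qed

lemma extends_continuous:
  assumes "extends z0 \<delta> f \<Phi>" shows "continuous_on (box3 z0 \<delta>) f"
proof -
  have c: "continuous_on (ball (of_real (Re z0)) \<delta> \<times> ball (of_real (Im z0)) \<delta> \<times> UNIV) \<Phi>"
    using assms unfolding extends_def separately_holomorphic_def by (elim conjE)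
  have r: "continuous_on (box3 z0 \<delta>) real_point" unfolding real_point_def by (intro continuous_intros)
  have m: "real_point ` box3 z0 \<delta> \<subseteq> ball (of_real (Re z0)) \<delta> \<times> ball (of_real (Im z0)) \<delta> \<times> UNIV"
  proof
    fix q assume "q \<in> real_point ` box3 z0 \<delta>"
    then obtain z a where "(z, a) \<in> box3 z0 \<delta>" "q = real_point (z, a)" by auto
    then show "q \<in> ball (of_real (Re z0)) \<delta> \<times> ball (of_real (Im z0)) \<delta> \<times> UNIV"
      using box3_mem[of z a z0 \<delta>] by (simp add: real_point_def)
  qed
  have "f p = \<Phi> (real_point p)" if "p \<in> box3 z0 \<delta>" for p
    using assms that unfolding extends_def by (cases p) (simp add: real_point_def)
  then show ?thesis using continuous_on_compose2[OF c r m] by (simp cong: continuous_on_cong)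
qed

lemma M04_open: "open (M04 \<times> (UNIV :: real set))"
  unfolding M04_def by (intro open_Times open_Compl finite_imp_closed open_UNIV) simp

text \<open>Inside each chart the complement is the nonvanishing locus of a continuous
  function.\<close>

lemma Z_set_closedin: "closedin (top_of_set (M04 \<times> UNIV)) Z_set"
proof -
  have "open (M04 \<times> UNIV - Z_set)"
    unfolding open_subopen[of "M04 \<times> UNIV - Z_set"]
  proof
    fix p assume p: "p \<in> M04 \<times> UNIV - Z_set"
    obtain lam0 a0 where p': "p = (lam0, a0)" by (cases p)
    then have "lam0 \<in> M04" using p by simp
    then obtain \<delta> f \<Phi> where \<delta>: "0 < \<delta>" and ext: "extends lam0 \<delta> (\<lambda>p. of_real (f p)) \<Phi>"
      and Z': "\<forall>l a. (l, a) \<in> box3 lam0 \<delta> \<longrightarrow> l \<in> M04 \<and> ((l, a) \<in> Z_set \<longleftrightarrow> f (l, a) = 0)"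
      by (rule real_analytic_chart)
  note Z = Z'[rule_format]
    have o: "open (box3 lam0 \<delta> \<inter> (\<lambda>p. of_real (f p) :: complex) -` (- {0}))"
      by (rule continuous_open_preimage[OF extends_continuous[OF ext] box3_open open_Compl[OF closed_singleton]])
    have b: "p \<in> box3 lam0 \<delta>" using \<delta> by (simp add: p' box3_def)
    have "f p \<noteq> 0" using Z[of lam0 a0] b p by (simp add: p')
    moreover have "box3 lam0 \<delta> \<inter> (\<lambda>p. of_real (f p) :: complex) -` (- {0}) \<subseteq> M04 \<times> UNIV - Z_set"
      using Z by auto
    ultimately show "\<exists>T. open T \<and> p \<in> T \<and> T \<subseteq> M04 \<times> UNIV - Z_set" using o b by (intro exI conjI) auto
  qed
  then have "openin (top_of_set (M04 \<times> UNIV)) (M04 \<times> UNIV - Z_set)"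
    by (rule open_subset[rotated]) blast
  moreover have "Z_set \<subseteq> M04 \<times> UNIV" by (auto simp: Z_set_def)
  ultimately show ?thesis by (simp add: closedin_def)
qed

text \<open>The lines Re lam = 1/2 and Im lam = 0 are null sets in the plane, and over all other lam
  the slice is countable; Tonelli's theorem then applies, measurability coming from relative
  closedness.\<close>

lemma Z_set_null: "Z_set \<in> null_sets lborel"
proof -
  obtain K where K: "closed K" "Z_set = M04 \<times> UNIV \<inter> K" using Z_set_closedin unfolding closedin_closed by blast
  have meas: "Z_set \<in> sets borel"
    unfolding K(2) by (intro sets.Int borel_open[OF M04_open] borel_closed[OF K(1)])
  have null: "{z :: complex. b \<bullet> z = k} \<in> null_sets lborel" if "b \<noteq> 0" for b k
  proof -
    have "{z. b \<bullet> z = k} \<in> null_sets lebesgue"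
      using negligible_hyperplane[of b k] that by (simp add: negligible_iff_null_sets)
    moreover have "{z. b \<bullet> z = k} \<in> sets lborel" using closed_hyperplane[of b k] by simp
    ultimately show ?thesis by (simp add: null_sets_completion_iff)
  qed
  \<comment> \<open>The inner products with 1 and \<i> are the real and the imaginary part.\<close>
  have "AE z in lborel. \<not> (1 :: complex) \<bullet> z = 1 / 2" by (rule AE_I'[OF null[of 1 "1 / 2"]]) auto
  moreover have "AE z in lborel. \<not> \<i> \<bullet> z = 0" by (rule AE_I'[OF null[of \<i> 0]]) auto
  ultimately have "AE z in lborel. emeasure lborel (Pair z -` Z_set) = 0"
  proof eventually_elim
    case (elim z)
    then have "countable {a. (z, a) \<in> Z_set}" by (intro Z_set_slice_countable) (auto simp: inner_complex_def)
    then show ?case by (simp add: emeasure_lborel_countable vimage_def)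
  qed
  moreover have "emeasure lborel Z_set = (\<integral>\<^sup>+z. emeasure lborel (Pair z -` Z_set) \<partial>lborel)"
  proof -
    have m: "Z_set \<in> sets ((lborel :: complex measure) \<Otimes>\<^sub>M (lborel :: real measure))"
      unfolding lborel_prod using meas by simp
    show ?thesis using lborel.emeasure_pair_measure_alt[OF m] unfolding lborel_prod .
  qed
  ultimately have "emeasure lborel Z_set = 0" by (simp cong: nn_integral_cong_AE)
  then show ?thesis using meas by (simp add: null_sets_def)
qed

theorem theorem1:
  shows "(\<forall>p\<in>M04 \<times> UNIV. \<exists>V F. open V \<and> connected V \<and> p \<in> V \<and> V \<subseteq> M04 \<times> UNIV \<and>
            finite F \<and> F \<noteq> {} \<and>
            (\<forall>f\<in>F. real_analytic_on3 f V \<and> (\<exists>q\<in>V. f q \<noteq> 0)) \<and>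
            Z_set \<inter> V = {q\<in>V. \<forall>f\<in>F. f q = 0})
         \<and> closedin (top_of_set (M04 \<times> UNIV)) Z_set
         \<and> Z_set \<in> null_sets lborel"
proof (intro conjI ballI Z_set_closedin Z_set_null)
  fix p :: "complex \<times> real" assume p: "p \<in> M04 \<times> UNIV"
  obtain lam0 a0 where p': "p = (lam0, a0)" by (cases p)
  then have "lam0 \<in> M04" using p by simp
  then obtain \<delta> f \<Phi> where \<delta>: "0 < \<delta>" and ext: "extends lam0 \<delta> (\<lambda>p. of_real (f p)) \<Phi>"
    and Z': "\<forall>l a. (l, a) \<in> box3 lam0 \<delta> \<longrightarrow> l \<in> M04 \<and> ((l, a) \<in> Z_set \<longleftrightarrow> f (l, a) = 0)"
    by (rule real_analytic_chart)
  note Z = Z'[rule_format]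
  have an: "real_analytic_on3 f (box3 lam0 \<delta>)" using ext_analytic_real_analytic[OF ext] by simp
  \<comment> \<open>The box is unbounded in \<open>a\<close>, so over a generic \<open>lam\<close>
    it contains every value of \<open>a\<close>, in particular one for which no form exists.\<close>
  obtain lam where lam: "\<bar>Re lam - Re lam0\<bar> < \<delta>" "\<bar>Im lam - Im lam0\<bar> < \<delta>" "Im lam \<noteq> 0" "Re lam \<noteq> 1 / 2"
    by (rule generic_point_exists[OF \<delta>])
  obtain a where a: "\<not> preserves_herm_form lam a" using exists_not_preserving[OF lam(3,4)] by blast
  have q: "(lam, a) \<in> box3 lam0 \<delta>" using lam by (simp add: box3_def)
  then have "f (lam, a) \<noteq> 0" using Z a by (auto simp: Z_set_def)
  then have nz: "\<exists>q\<in>box3 lam0 \<delta>. f q \<noteq> 0" using q by blast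
  have Zf: "q \<in> Z_set \<longleftrightarrow> f q = 0" "q \<in> M04 \<times> UNIV" if "q \<in> box3 lam0 \<delta>" for q
    using Z[of "fst q" "snd q"] that by (auto simp: mem_Times_iff)
  show "\<exists>V F. open V \<and> connected V \<and> p \<in> V \<and> V \<subseteq> M04 \<times> UNIV \<and> finite F \<and> F \<noteq> {} \<and>
      (\<forall>f\<in>F. real_analytic_on3 f V \<and> (\<exists>q\<in>V. f q \<noteq> 0)) \<and> Z_set \<inter> V = {q\<in>V. \<forall>f\<in>F. f q = 0}"
  proof (intro exI[of _ "box3 lam0 \<delta>"] exI[of _ "{f}"] conjI)
    show "p \<in> box3 lam0 \<delta>" using \<delta> by (simp add: p' box3_def)
    show "box3 lam0 \<delta> \<subseteq> M04 \<times> UNIV" using Zf(2) by blast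
    show "Z_set \<inter> box3 lam0 \<delta> = {q \<in> box3 lam0 \<delta>. \<forall>f\<in>{f}. f q = 0}" using Zf(1) by auto
  qed (use box3_open box3_connected an nz in auto)
qed

end
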